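(* If $\lambda\in C_6$, then $t^1_{\mathrm{conj}}(\lambda)=t^1_{\mathrm{MAX}}(\lambda)$, i.e. $t^1_{\mathrm{conj}}(\lambda)=\frac4{|c|}p_1^V(0)$.
   Context: Let $G=\mathbb R^5$ with coordinates $(x,y,z,v,w)$ (the Cartan group, identity $0$), vector fields $X_1=\partial_x-\frac y2\partial_z-\frac{x^2+y^2}{2}\partial_w$, $X_2=\partial_y+\frac x2\partial_z+\frac{x^2+y^2}{2}\partial_v$; sub-Riemannian problem $\dot g=u_1X_1+u_2X_2$, fixed endpoints, minimize $\int\sqrt{u_1^2+u_2^2}\,dt$. For $\lambda=(\theta,c,\alpha,\beta)$, $\theta,\beta\in S^1$, $c\in\mathbb R$, $\alpha\ge0$: $\mathrm{Exp}(\lambda,t)=g(t)$ with $g(0)=0$, $\dot g=\cos\theta(t)X_1+\sin\theta(t)X_2$, $\dot\theta=c$, $\dot c=-\alpha\sin(\theta-\beta)$, $(\theta(0),c(0))=(\theta,c)$. $C_6=\{\alpha=0,\ c\ne0\}$. $t^1_{\mathrm{conj}}(\lambda)=\sup\{t>0:\mathrm{Exp}(\lambda,\cdot)|_{[0,t]}\text{ is locally optimal}\}$ (minimizing length among admissible curves with same endpoints in a $C([0,t],G)$-neighborhood). $p_1^V(0)\in(\pi/2,\pi)$ is the first positive root of $f_V^0(p)=[(32p^2-1)\cos2p-8p\sin2p+\cos6p]/512$, and $t^1_{\mathrm{MAX}}(\lambda)=\frac4{|c|}p_1^V(0)$ for $\lambda\in C_6$. *)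

theory Defs
  imports "HOL-Analysis.Analysis"
begin

text \<open>The Cartan group G = R^5, coordinates (x,y,z,v,w), identity 0.\<close>
type_synonym cartan = "real \<times> real \<times> real \<times> real \<times> real"

definition X1 :: "cartan \<Rightarrow> cartan" where
  "X1 p = (case p of (x,y,z,v,w) \<Rightarrow> (1, 0, - y / 2, 0, - (x\<^sup>2 + y\<^sup>2) / 2))"

definition X2 :: "cartan \<Rightarrow> cartan" where
  "X2 p = (case p of (x,y,z,v,w) \<Rightarrow> (0, 1, x / 2, (x\<^sup>2 + y\<^sup>2) / 2, 0))"

text \<open>Admissible curve on [0,T] with L-infinity controls u1, u2:
  gamma is absolutely continuous and gamma' = u1 X1 + u2 X2 a.e.
  (in integral form).\<close>
definition admissible ::
  "real \<Rightarrow> (real \<Rightarrow> cartan) \<Rightarrow> (real \<Rightarrow> real) \<Rightarrow> (real \<Rightarrow> real) \<Rightarrow> bool" where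
  "admissible T \<gamma> u1 u2 \<longleftrightarrow>
     u1 \<in> borel_measurable (lebesgue_on {0..T}) \<and> bounded (u1 ` {0..T}) \<and>
     u2 \<in> borel_measurable (lebesgue_on {0..T}) \<and> bounded (u2 ` {0..T}) \<and>
     (\<forall>t\<in>{0..T}. ((\<lambda>s. u1 s *\<^sub>R X1 (\<gamma> s) + u2 s *\<^sub>R X2 (\<gamma> s))
                     has_integral (\<gamma> t - \<gamma> 0)) {0..t})"

definition sr_length :: "real \<Rightarrow> (real \<Rightarrow> real) \<Rightarrow> (real \<Rightarrow> real) \<Rightarrow> real" where
  "sr_length T u1 u2 = integral {0..T} (\<lambda>s. sqrt ((u1 s)\<^sup>2 + (u2 s)\<^sup>2))"

definition locally_optimal :: "real \<Rightarrow> (real \<Rightarrow> cartan) \<Rightarrow> bool" where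
  "locally_optimal T \<gamma> \<longleftrightarrow>
     (\<exists>u1 u2. admissible T \<gamma> u1 u2 \<and>
       (\<exists>\<epsilon>>0. \<forall>\<eta> v1 v2. admissible T \<eta> v1 v2 \<and> \<eta> 0 = \<gamma> 0 \<and> \<eta> T = \<gamma> T \<and>
                  (\<forall>s\<in>{0..T}. dist (\<eta> s) (\<gamma> s) < \<epsilon>)
                  \<longrightarrow> sr_length T u1 u2 \<le> sr_length T v1 v2))"

text \<open>(th, cc, g) is the extremal trajectory Exp(lambda, .) for lambda = (theta0, c0, alpha, beta).\<close>
definition is_Exp ::
  "real \<Rightarrow> real \<Rightarrow> real \<Rightarrow> real \<Rightarrow> (real \<Rightarrow> real) \<Rightarrow> (real \<Rightarrow> real) \<Rightarrow> (real \<Rightarrow> cartan) \<Rightarrow> bool" where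
  "is_Exp \<theta>0 c0 \<alpha> \<beta> th cc g \<longleftrightarrow>
     th 0 = \<theta>0 \<and> cc 0 = c0 \<and> g 0 = 0 \<and>
     (\<forall>t. (th has_real_derivative cc t) (at t)) \<and>
     (\<forall>t. (cc has_real_derivative (- \<alpha> * sin (th t - \<beta>))) (at t)) \<and>
     (\<forall>t. (g has_vector_derivative (cos (th t) *\<^sub>R X1 (g t) + sin (th t) *\<^sub>R X2 (g t))) (at t))"

definition t1_conj :: "(real \<Rightarrow> cartan) \<Rightarrow> real" where
  "t1_conj g = Sup {t. t > 0 \<and> locally_optimal t g}"

definition fV0 :: "real \<Rightarrow> real" where
  "fV0 p = ((32 * p\<^sup>2 - 1) * cos (2 * p) - 8 * p * sin (2 * p) + cos (6 * p)) / 512"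

definition p1V0 :: real where
  "p1V0 = (LEAST p. p > 0 \<and> fV0 p = 0)"

end

(* The planar projection of the trajectory is an arc of a circle. After a similarity it is the arc
   |angle| <= tau of the unit circle, and in polar coordinates (r, phi) the remaining coordinates of the
   end point fix the integrals of r^2, r^3 cos(phi) and r^3 sin(phi) with respect to phi. Thus the question is
   when the arc is a local minimum of length for these isoperimetric constraints. The first conjugate point
   belongs to the odd Jacobi field h = s cos(s) sin(tau) - tau cos(tau) sin(s), namely to the first zero
   t* in (5pi/4, 3pi/2) of int_{-tau}^{tau} h(s) sin(s) ds = - conj_fun(tau)/2, and fV0 p = conj_fun(2p)/128.

   For tau < t* the arc is calibrated. The multipliers of the constraints, and with them a combination h of the
   odd and the even Jacobi field, are chosen to depend on the competitor r = 1 + f so that f = h at the angles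
   -tau/3 and tau/3. Between the angles -tau, -tau/3, tau/3 and tau, which are less than pi apart, a solution
   c of the Riccati equation c' = - K^2 - c^2 with K > 1 is finite, and S = A(phi) + h' (f - h) + c (f - h)^2 / 2
   is a subsolution of the Hamilton-Jacobi equation up to an error o(|h|^2), which is absorbed by the second
   variation of h: this is negative definite.

   For t* < tau < 3pi/2 an odd perturbation with negative second variation that is orthogonal to sin exists;
   it is prescribed for r^3, which makes two constraints linear, and the area is corrected by an even
   second-order term. Local optimality is inherited by shorter times, so no later time is locally optimal. *)

theory Submission
  imports Defs
begin

section \<open>Lipschitz curves and the chain rule\<close>

text \<open>A neighbour of the trajectory is close in position only: its velocity is arbitrary and
  its polar angle may run backwards, so it need not be a graph over the angle. Positivity of a
  second variation therefore cannot prove local optimality; a calibration can, because it is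
  integrated along the curve in time and compares positions alone. For the converse a single smooth
  graph suffices. Three pieces of length 2 \<tau>/3 are shorter than pi exactly up to \<tau> = 3 pi
  / 2, beyond the conjugate angle, and this leaves room for K > 1. The price is an error
  proportional to k^2, where k measures the deviation at the cuts. Its constant can be made as small
  as desired by shrinking the neighbourhood, whereas the gain is a fixed multiple of k^2. Only a
  supremum is asked for. Nothing has to be decided at the conjugate angle itself, and half-angles
  below 5 pi / 4 are not treated: together with \<tau> < 3 pi / 2 this bound gives sin \<tau> < 0,
  cos \<tau> < 0 and (sin \<tau>)^2 >= 1/2, on which several signs rest.\<close>

definition ac_on :: "real \<Rightarrow> real \<Rightarrow> (real \<Rightarrow> 'a::euclidean_space) \<Rightarrow> (real \<Rightarrow> 'a) \<Rightarrow> bool" where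
  "ac_on a b f f' \<longleftrightarrow> f' \<in> borel_measurable (lebesgue_on {a..b}) \<and> bounded (f' ` {a..b}) \<and>
     (\<forall>t\<in>{a..b}. (f' has_integral (f t - f a)) {a..t})"

lemma ac_on_has_integral:
  assumes "ac_on a b f f'" "a \<le> s" "s \<le> t" "t \<le> b"
  shows "(f' has_integral (f t - f s)) {s..t}"
proof -
  have 1: "(f' has_integral (f s - f a)) {a..s}" and 2: "(f' has_integral (f t - f a)) {a..t}"
    using assms by (auto simp: ac_on_def)
  have "f' integrable_on {s..t}"
    using 2 assms by (meson has_integral_integrable integrable_on_subinterval atLeastatMost_subset_iff order_refl)
  then obtain i where i: "(f' has_integral i) {s..t}" by blast
  have "(f' has_integral ((f s - f a) + i)) {a..t}"
    using has_integral_combine[OF assms(2,3) 1 i] .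
  then have "(f s - f a) + i = f t - f a" using 2 has_integral_unique by blast
  then have "i = f t - f s" by (simp add: algebra_simps)
  with i show ?thesis by simp
qed

lemma ac_on_subinterval:
  assumes "ac_on a b f f'" "a \<le> s" "t \<le> b"
  shows "ac_on s t f f'"
  unfolding ac_on_def
proof (intro conjI ballI)
  have sub: "{s..t} \<subseteq> {a..b}" using assms by auto
  show "f' \<in> borel_measurable (lebesgue_on {s..t})"
    using assms(1) measurable_restrict_mono[OF _ sub] by (auto simp: ac_on_def)
  show "bounded (f' ` {s..t})"
    using assms(1) bounded_subset[OF _ image_mono[OF sub, of f']] by (auto simp: ac_on_def)
  show "(f' has_integral (f u - f s)) {s..u}" if "u \<in> {s..t}" for u
    using ac_on_has_integral[OF assms(1)] that assms by auto
qed

text \<open>\<open>ac_on\<close> carries a derivative with a value and a bound at every point, as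
  the controls do in \<open>admissible\<close>; both bounds below come from this one. It is made
  positive because the chain rule divides by it.\<close>

lemma ac_on_lipschitz:
  assumes "ac_on a b f f'"
  shows "\<exists>B>0. (\<forall>s\<in>{a..b}. \<forall>t\<in>{a..b}. norm (f t - f s) \<le> B * \<bar>t - s\<bar>) \<and> (\<forall>t\<in>{a..b}. norm (f' t) \<le> B)"
proof -
  obtain B where B: "B > 0" "\<And>t. t \<in> {a..b} \<Longrightarrow> norm (f' t) \<le> B"
    using assms unfolding ac_on_def bounded_pos by blast
  have *: "norm (f t - f s) \<le> B * (t - s)" if "a \<le> s" "s \<le> t" "t \<le> b" for s t
    using has_integral_bound_real[OF _ finite.emptyI ac_on_has_integral[OF assms that], of B] B that by auto
  have "norm (f t - f s) \<le> B * \<bar>t - s\<bar>" if "s \<in> {a..b}" "t \<in> {a..b}" for s t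
    using *[of s t] *[of t s] that by (cases "s \<le> t") (auto simp: norm_minus_commute)
  then show ?thesis using B by blast
qed

lemma ac_on_continuous:
  assumes "ac_on a b f f'"
  shows "continuous_on {a..b} f"
proof -
  obtain B where B: "B > 0" "\<And>s t. s \<in> {a..b} \<Longrightarrow> t \<in> {a..b} \<Longrightarrow> norm (f t - f s) \<le> B * \<bar>t - s\<bar>"
    "\<And>t. t \<in> {a..b} \<Longrightarrow> norm (f' t) \<le> B"
    using ac_on_lipschitz[OF assms] by blast
  then have "B-lipschitz_on {a..b} f"
    by (intro lipschitz_onI) (auto simp: dist_norm)
  then show ?thesis using lipschitz_on_continuous_on by blast
qed

lemma ac_on_times_integrable:
  fixes g f :: "real \<Rightarrow> real"
  assumes "continuous_on {a..b} g" "ac_on a b f f'"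
  shows "(\<lambda>t. g t * f' t) integrable_on {a..b}"
proof -
  have "g \<in> borel_measurable (lebesgue_on {a..b})"
    using assms(1) by (simp add: continuous_imp_measurable_on_sets_lebesgue)
  then have meas: "(\<lambda>t. g t * f' t) \<in> borel_measurable (lebesgue_on {a..b})"
    using assms(2) by (auto simp: ac_on_def)
  obtain B where B: "\<And>t. t \<in> {a..b} \<Longrightarrow> norm (f' t) \<le> B"
    using ac_on_lipschitz[OF assms(2)] by blast
  have "bounded (g ` {a..b})"
    using assms(1) compact_continuous_image compact_imp_bounded by blast
  then obtain M where M: "\<And>t. t \<in> {a..b} \<Longrightarrow> norm (g t) \<le> M" unfolding bounded_iff by blast
  show ?thesis
  proof (rule measurable_bounded_by_integrable_imp_integrable[OF meas integrable_const_ivl])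
    show "norm (g t * f' t) \<le> M * B" if t: "t \<in> {a..b}" for t
      unfolding norm_mult using M[OF t] B[OF t] norm_ge_zero[of "g t"] by (intro mult_mono) auto
  qed simp
qed

text \<open>The function \<open>F \<circ> f\<close> minus the integral of the claimed derivative is differentiable everywhere with
  derivative zero, although neither of the two terms need be: this avoids Lebesgue's differentiation theorem.\<close>

lemma ac_on_chain:
  fixes f :: "real \<Rightarrow> 'a::euclidean_space" and F :: "'a \<Rightarrow> real"
  assumes ac: "ac_on a b f f'"
    and der: "\<And>t. t \<in> {a..b} \<Longrightarrow> (F has_derivative (\<lambda>h. G t \<bullet> h)) (at (f t))"
    and cont: "continuous_on {a..b} G"
  shows "ac_on a b (\<lambda>t. F (f t)) (\<lambda>t. G t \<bullet> f' t)"
proof -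
  obtain B where B: "B > 0" "\<And>s t. s \<in> {a..b} \<Longrightarrow> t \<in> {a..b} \<Longrightarrow> norm (f t - f s) \<le> B * \<bar>t - s\<bar>"
    "\<And>t. t \<in> {a..b} \<Longrightarrow> norm (f' t) \<le> B"
    using ac_on_lipschitz[OF ac] by blast
  let ?D = "\<lambda>t. G t \<bullet> f' t"
  have "G \<in> borel_measurable (lebesgue_on {a..b})"
    using cont by (simp add: continuous_imp_measurable_on_sets_lebesgue)
  then have meas: "?D \<in> borel_measurable (lebesgue_on {a..b})"
    using ac by (auto simp: ac_on_def intro!: borel_measurable_inner)
  have "bounded (G ` {a..b})"
    using cont compact_continuous_image compact_imp_bounded by blast
  then obtain M where M: "M > 0" "\<And>t. t \<in> {a..b} \<Longrightarrow> norm (G t) \<le> M"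
    unfolding bounded_pos by auto
  have bd: "norm (?D t) \<le> M * B" if "t \<in> {a..b}" for t
  proof -
    have "norm (?D t) \<le> norm (G t) * norm (f' t)" by (simp add: Cauchy_Schwarz_ineq2)
    also have "\<dots> \<le> M * B" using M B that by (intro mult_mono) auto
    finally show ?thesis .
  qed
  have int: "?D integrable_on {a..b}"
    by (rule measurable_bounded_by_integrable_imp_integrable[OF meas integrable_const_ivl])
      (use bd in auto)
  have ints: "?D integrable_on {s..t}" if "a \<le> s" "t \<le> b" for s t
    using int that by (meson integrable_on_subinterval atLeastatMost_subset_iff)
  define I where "I t = integral {a..t} ?D" for t
  have Iadd: "integral {s..t} ?D = I t - I s" if "a \<le> s" "s \<le> t" "t \<le> b" for s t
    using Henstock_Kurzweil_Integration.integral_combine[of a s t ?D] ints[of a t] that by (auto simp: I_def)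
  have inner_int: "((\<lambda>u. G x \<bullet> f' u) has_integral (G x \<bullet> (f t - f s))) {s..t}"
    if "a \<le> s" "s \<le> t" "t \<le> b" for s t x
    using has_integral_linear[OF ac_on_has_integral[OF ac that] bounded_linear_inner_right[of "G x"]]
    by (simp add: o_def)
  \<comment> \<open>Both parts of the increment are compared with the same expression, the inner
    product of G x with f y - f x, so that only increments of \<open>f\<close> occur.\<close>
  have D0: "((\<lambda>t. F (f t) - I t) has_derivative (\<lambda>h. 0)) (at x within {a..b})" if x: "x \<in> {a..b}" for x
    unfolding has_derivative_within_alt2
  proof (intro conjI allI impI)
    show "bounded_linear (\<lambda>h::real. 0::real)" by simp
    fix e :: real assume e: "e > 0"
    \<comment> \<open>Half of e pays for the differentiability of \<open>F\<close> at f x, the other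
      half for the oscillation of \<open>G\<close> near x; the factor B converts both into multiples
      of |y - x|.\<close>
    define e1 where "e1 = e / (2 * B)"
    have e1: "e1 > 0" using e B by (simp add: e1_def)
    from der[OF x] have "\<exists>d>0. \<forall>y. norm (y - f x) < d \<longrightarrow> norm (F y - F (f x) - G x \<bullet> (y - f x)) \<le> e1 * norm (y - f x)"
      unfolding has_derivative_at_alt using e1 by blast
    then obtain d where d: "d > 0"
      "\<And>y. norm (y - f x) < d \<Longrightarrow> norm (F y - F (f x) - G x \<bullet> (y - f x)) \<le> e1 * norm (y - f x)"
      by blast
    obtain d2 where d2: "d2 > 0" "\<And>y. y \<in> {a..b} \<Longrightarrow> dist y x < d2 \<Longrightarrow> dist (G y) (G x) < e1"
      using cont x e1 unfolding continuous_on_iff by blast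
    \<comment> \<open>The radius d2 controls \<open>G\<close>, and d / B keeps f y within d of f x
      by the Lipschitz bound.\<close>
    define d3 where "d3 = min d2 (d / B)"
    have d3: "d3 > 0" using d d2 B by (simp add: d3_def)
    have key: "norm (F (f y) - I y - (F (f x) - I x) - 0) \<le> e * norm (y - x)"
      if y: "y \<in> {a..b}" "dist y x < d3" for y
    proof -
      have n1: "norm (f y - f x) \<le> B * \<bar>y - x\<bar>" using B(2)[of x y] x y by simp
      also have "\<dots> < B * (d / B)" using y B by (intro mult_strict_left_mono) (auto simp: d3_def dist_real_def)
      also have "\<dots> = d" using B by simp
      finally have "norm (F (f y) - F (f x) - G x \<bullet> (f y - f x)) \<le> e1 * norm (f y - f x)"
        using d by blast
      also have "\<dots> \<le> e1 * (B * \<bar>y - x\<bar>)" using n1 e1 by (intro mult_left_mono) auto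
      finally have A1: "norm (F (f y) - F (f x) - G x \<bullet> (f y - f x)) \<le> e/2 * \<bar>y - x\<bar>"
        using B by (simp add: e1_def)
      \<comment> \<open>With \<open>G\<close> frozen at x the integrand integrates exactly to the
        inner product of G x with the increment of \<open>f\<close>; what remains is the oscillation
        of \<open>G\<close> times the bound B.\<close>
      have A2': "norm ((I t - I s) - G x \<bullet> (f t - f s)) \<le> e1 * B * (t - s)"
        if st: "a \<le> s" "s \<le> t" "t \<le> b" "\<And>u. u \<in> {s..t} \<Longrightarrow> dist u x < d2" for s t
      proof -
        have "((\<lambda>u. ?D u - G x \<bullet> f' u) has_integral ((I t - I s) - G x \<bullet> (f t - f s))) {s..t}"
          using Iadd[OF st(1-3)] ints[OF st(1,3)] inner_int[OF st(1-3)]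
          by (intro has_integral_diff) (auto simp: has_integral_integrable_integral)
          have "norm ((I t - I s) - G x \<bullet> (f t - f s)) \<le> (e1 * B) * measure lborel {s..t}"
          proof (rule has_integral_bound_real[OF _ finite.emptyI])
          show "((\<lambda>u. ?D u - G x \<bullet> f' u) has_integral ((I t - I s) - G x \<bullet> (f t - f s))) {s..t}" by fact
          show "0 \<le> e1 * B" using e1 B by auto
          fix u assume "u \<in> {s..t} - {}"
          then have that: "u \<in> {s..t}" by simp
            have "norm (?D u - G x \<bullet> f' u) = norm ((G u - G x) \<bullet> f' u)" by (simp add: inner_diff_left)
            also have "\<dots> \<le> norm (G u - G x) * norm (f' u)" by (simp add: Cauchy_Schwarz_ineq2)
            also have "\<dots> \<le> e1 * B"
              using d2(2)[of u] B(3)[of u] st that e1 by (intro mult_mono) (auto simp: dist_norm less_imp_le)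
            finally show "norm (?D u - G x \<bullet> f' u) \<le> e1 * B" .
          qed
        then show ?thesis using st by simp
      qed
      have A2: "norm ((I y - I x) - G x \<bullet> (f y - f x)) \<le> e/2 * \<bar>y - x\<bar>"
      proof (cases "x \<le> y")
        case True
        then have "norm ((I y - I x) - G x \<bullet> (f y - f x)) \<le> e1 * B * (y - x)"
          using x y by (intro A2') (auto simp: d3_def dist_real_def)
        then show ?thesis using True B by (simp add: e1_def)
      next
        case False
        then have "norm ((I x - I y) - G x \<bullet> (f x - f y)) \<le> e1 * B * (x - y)"
          using x y by (intro A2') (auto simp: d3_def dist_real_def)
        moreover have "(I y - I x) - G x \<bullet> (f y - f x) = - ((I x - I y) - G x \<bullet> (f x - f y))"
          by (simp add: inner_diff_right)
        ultimately have "norm ((I y - I x) - G x \<bullet> (f y - f x)) \<le> e1 * B * (x - y)"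
          by (simp only: norm_minus_cancel)
        then show ?thesis using False B by (simp add: e1_def)
      qed
      have "e * norm (y - x) = e/2 * \<bar>y - x\<bar> + e/2 * \<bar>y - x\<bar>" by simp
      then show ?thesis using A1 A2 unfolding real_norm_def by linarith
    qed
    show "\<forall>\<^sub>F y in at x within {a..b}. norm (F (f y) - I y - (F (f x) - I x) - 0) \<le> e * norm (y - x)"
      unfolding eventually_at using d3 key by blast
  qed
  have const: "F (f t) - I t = F (f a) - I a" if "t \<in> {a..b}" for t
    by (rule has_derivative_zero_unique[OF convex_real_interval(5) D0]) (use that in auto)
  show ?thesis
    unfolding ac_on_def
  proof (intro conjI ballI)
    show "?D \<in> borel_measurable (lebesgue_on {a..b})" by fact
    show "bounded (?D ` {a..b})" unfolding bounded_iff using bd by blast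
    fix t assume t: "t \<in> {a..b}"
    have "I a = 0" by (simp add: I_def)
    then have "I t = F (f t) - F (f a)" using const[OF t] by simp
    moreover have "(?D has_integral I t) {a..t}"
      unfolding I_def using t by (intro integrable_integral ints) auto
    ultimately show "(?D has_integral (F (f t) - F (f a))) {a..t}" by simp
  qed
qed

section \<open>Pairs, sums, products and compositions of Lipschitz curves\<close>

lemma has_integral_Pair:
  assumes "(f has_integral i) S" "(g has_integral j) S"
  shows "((\<lambda>t. (f t, g t)) has_integral (i, j)) S"
proof -
  have "bounded_linear (\<lambda>x::'b. (x, 0::'c))" "bounded_linear (\<lambda>y::'c. (0::'b, y))"
    by (auto intro!: bounded_linear_Pair bounded_linear_ident bounded_linear_zero)
  from has_integral_add[OF has_integral_linear[OF assms(1) this(1)] has_integral_linear[OF assms(2) this(2)]]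
  show ?thesis by (simp add: o_def)
qed

lemma ac_on_Pair:
  assumes "ac_on a b f f'" "ac_on a b g g'"
  shows "ac_on a b (\<lambda>t. (f t, g t)) (\<lambda>t. (f' t, g' t))"
  unfolding ac_on_def
proof (intro conjI ballI)
  show "(\<lambda>t. (f' t, g' t)) \<in> borel_measurable (lebesgue_on {a..b})"
    using assms by (auto simp: ac_on_def intro!: borel_measurable_Pair)
  have sub: "(\<lambda>t. (f' t, g' t)) ` {a..b} \<subseteq> f' ` {a..b} \<times> g' ` {a..b}" by auto
  have "bounded (f' ` {a..b} \<times> g' ` {a..b})"
    using assms by (simp add: ac_on_def bounded_Times)
  from bounded_subset[OF this sub] show "bounded ((\<lambda>t. (f' t, g' t)) ` {a..b})" .
  show "((\<lambda>t. (f' t, g' t)) has_integral ((f t, g t) - (f a, g a))) {a..t}" if "t \<in> {a..b}" for t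
    using has_integral_Pair[of f' "f t - f a" "{a..t}" g' "g t - g a"] assms that by (simp add: ac_on_def)
qed

lemma ac_on_C1:
  assumes "\<And>t. t \<in> {a..b} \<Longrightarrow> (f has_vector_derivative f' t) (at t within {a..b})" "continuous_on {a..b} f'"
  shows "ac_on a b f f'"
  unfolding ac_on_def
proof (intro conjI ballI)
  show "f' \<in> borel_measurable (lebesgue_on {a..b})"
    using assms by (simp add: continuous_imp_measurable_on_sets_lebesgue)
  show "bounded (f' ` {a..b})"
    using assms compact_continuous_image compact_imp_bounded by blast
  show "(f' has_integral (f t - f a)) {a..t}" if "t \<in> {a..b}" for t
    using that by (intro fundamental_theorem_of_calculus)
      (auto intro: has_vector_derivative_within_subset[OF assms(1)])
qed

lemma ac_on_C1_real:
  fixes f :: "real \<Rightarrow> real"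
  assumes "\<And>t. (f has_real_derivative f' t) (at t)" "continuous_on {a..b} f'"
  shows "ac_on a b f f'"
  using assms by (intro ac_on_C1) (auto simp: has_real_derivative_iff_has_vector_derivative has_vector_derivative_at_within)

lemma ac_on_chain2:
  fixes f g :: "real \<Rightarrow> real" and F :: "real \<Rightarrow> real \<Rightarrow> real"
  assumes "ac_on a b f f'" "ac_on a b g g'"
    and "\<And>t. t \<in> {a..b} \<Longrightarrow> ((\<lambda>p. F (fst p) (snd p)) has_derivative (\<lambda>h. P t * fst h + Q t * snd h)) (at (f t, g t))"
    and "continuous_on {a..b} P" "continuous_on {a..b} Q"
  shows "ac_on a b (\<lambda>t. F (f t) (g t)) (\<lambda>t. P t * f' t + Q t * g' t)"
  using ac_on_chain[OF ac_on_Pair[OF assms(1,2)], where F="\<lambda>p. F (fst p) (snd p)" and G="\<lambda>t. (P t, Q t)"] assms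
  by (auto simp: inner_prod_def continuous_on_Pair)

lemma ac_on_cong:
  assumes "ac_on a b f f'" "\<And>t. t \<in> {a..b} \<Longrightarrow> f t = g t" "\<And>t. t \<in> {a..b} \<Longrightarrow> f' t = g' t"
  shows "ac_on a b g g'"
  unfolding ac_on_def
proof (intro conjI ballI)
  show "g' \<in> borel_measurable (lebesgue_on {a..b})"
    using assms by (subst measurable_cong[where g=f']) (auto simp: ac_on_def)
  show "bounded (g' ` {a..b})"
    using assms(1) image_cong[OF refl assms(3), of "{a..b}"] by (simp add: ac_on_def)
  show "(g' has_integral (g t - g a)) {a..t}" if "t \<in> {a..b}" for t
    using has_integral_eq[of "{a..t}" f' g' "f t - f a"] assms that by (auto simp: ac_on_def)
qed

lemma ac_on_add:
  fixes f g :: "real \<Rightarrow> real"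
  assumes "ac_on a b f f'" "ac_on a b g g'"
  shows "ac_on a b (\<lambda>t. f t + g t) (\<lambda>t. f' t + g' t)"
  using ac_on_chain2[OF assms, where F="(+)" and P="\<lambda>_. 1" and Q="\<lambda>_. 1"]
  by (auto simp: bounded_linear_imp_has_derivative bounded_linear_add bounded_linear_fst bounded_linear_snd)

lemma ac_on_mult:
  fixes f g :: "real \<Rightarrow> real"
  assumes "ac_on a b f f'" "ac_on a b g g'"
  shows "ac_on a b (\<lambda>t. f t * g t) (\<lambda>t. g t * f' t + f t * g' t)"
  using assms by (intro ac_on_chain2[where F="(*)"])
    (auto intro!: derivative_eq_intros ac_on_continuous[OF assms(1)] ac_on_continuous[OF assms(2)])

lemma ac_on_const: "ac_on a b (\<lambda>_. c) (\<lambda>_. 0)"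
  by (rule ac_on_C1) auto

lemma ac_on_cmult:
  fixes f :: "real \<Rightarrow> real"
  assumes "ac_on a b f f'"
  shows "ac_on a b (\<lambda>t. c * f t) (\<lambda>t. c * f' t)"
  using ac_on_mult[OF ac_on_const[of a b c] assms] by simp

lemma ac_on_C1_comp:
  fixes f :: "real \<Rightarrow> real"
  assumes "ac_on a b f f'" "\<And>t. t \<in> {a..b} \<Longrightarrow> (F has_real_derivative F' (f t)) (at (f t))"
    "continuous_on {a..b} (\<lambda>t. F' (f t))"
  shows "ac_on a b (\<lambda>t. F (f t)) (\<lambda>t. F' (f t) * f' t)"
  using ac_on_chain[OF assms(1), where F=F and G="\<lambda>t. F' (f t)"] assms
  by (auto simp: has_field_derivative_def)

section \<open>The conjugate angle\<close>

definition conj_fun :: "real \<Rightarrow> real" where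
  "conj_fun t = 2 * t\<^sup>2 * cos t - (sin t)\<^sup>2 * cos t - t * sin t"

lemma fV0_eq_conj_fun: "fV0 p = conj_fun (2 * p) / 128"
proof -
  have c: "cos (6 * p) = 4 * cos (2*p) ^ 3 - 3 * cos (2*p)"
    using cos_treble_cos[of "2*p"] by simp
  have s: "(sin (2*p))\<^sup>2 = 1 - (cos (2*p))\<^sup>2" by (simp add: sin_squared_eq)
  show ?thesis
    unfolding fV0_def conj_fun_def c s by (simp add: field_simps power2_eq_square power3_eq_cube)
qed

text \<open>This is \<open>conj_fun\<close> divided by -sin t. Unlike \<open>conj_fun\<close> itself
  it has a perfect square as derivative, up to the factor 2, and so has at most one zero between
  consecutive positive zeros of sin.\<close>

definition conj_quot :: "real \<Rightarrow> real" where
  "conj_quot t = t + sin t * cos t - 2 * t\<^sup>2 * cos t / sin t"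

lemma conj_fun_eq: "sin t \<noteq> 0 \<Longrightarrow> conj_fun t = - sin t * conj_quot t"
  by (simp add: conj_fun_def conj_quot_def field_simps power2_eq_square)

lemma conj_quot_deriv:
  assumes "sin t \<noteq> 0"
  shows "(conj_quot has_real_derivative 2 * (cos t - t / sin t)\<^sup>2) (at t)"
proof -
  have s: "sin t * sin t = 1 - cos t * cos t"
    using sin_squared_eq[of t] by (simp add: power2_eq_square)
  have "(conj_quot has_real_derivative (1 + (cos t * cos t - sin t * sin t)
      - ((4 * t * cos t - 2 * t\<^sup>2 * sin t) * sin t - 2 * t\<^sup>2 * cos t * cos t) / (sin t * sin t))) (at t)"
    unfolding conj_quot_def using assms
    by (auto intro!: derivative_eq_intros simp: power2_eq_square)
  moreover have "1 + (cos t * cos t - sin t * sin t)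
      - ((4 * t * cos t - 2 * t\<^sup>2 * sin t) * sin t - 2 * t\<^sup>2 * cos t * cos t) / (sin t * sin t)
     = 2 * (cos t - t / sin t)\<^sup>2"
  proof -
    have "((4 * t * cos t - 2 * t\<^sup>2 * sin t) * sin t - 2 * t\<^sup>2 * cos t * cos t)
       = 4 * t * cos t * sin t - 2 * t\<^sup>2 * (sin t * sin t + cos t * cos t)" by algebra
    also have "\<dots> = 4 * t * cos t * sin t - 2 * t\<^sup>2" using s by simp
    finally have e: "((4 * t * cos t - 2 * t\<^sup>2 * sin t) * sin t - 2 * t\<^sup>2 * cos t * cos t)
      = 4 * t * cos t * sin t - 2 * t\<^sup>2" .
    have "2 * (cos t - t / sin t)\<^sup>2 = 2 * (cos t * cos t) - (4 * t * cos t * sin t - 2 * t\<^sup>2) / (sin t * sin t)"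
      using assms by (simp add: field_simps power2_eq_square)
    then show ?thesis unfolding e using s by simp
  qed
  ultimately show ?thesis by simp
qed

text \<open>The derivative vanishes only where sin x cos x = x. This is impossible for x > 0 away
  from the zeros of sin, since there |sin x cos x| < |sin x| <= x.\<close>

lemma conj_quot_strict_mono:
  assumes "0 < s" "s < t" "\<And>u. u \<in> {s..t} \<Longrightarrow> sin u \<noteq> 0"
  shows "conj_quot s < conj_quot t"
proof (rule DERIV_pos_imp_increasing[OF assms(2)])
  fix x assume x: "s \<le> x" "x \<le> t"
  then have sx: "sin x \<noteq> 0" and x0: "x > 0" using assms by auto
  have "\<bar>cos x\<bar> < 1"
  proof -
    have "(cos x)\<^sup>2 < 1" using sx by (simp add: cos_squared_eq)
    then show ?thesis by (simp add: abs_square_less_1)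
  qed
  then have "\<bar>sin x\<bar> * \<bar>cos x\<bar> < \<bar>sin x\<bar> * 1" using sx by (intro mult_strict_left_mono) auto
  also have "\<dots> \<le> x" using abs_sin_x_le_abs_x[of x] x0 by simp
  finally have "\<bar>sin x * cos x\<bar> < x" by (simp add: abs_mult)
  then have "cos x \<noteq> x / sin x" using sx by (auto simp: field_simps)
  then show "\<exists>y. (conj_quot has_real_derivative y) (at x) \<and> 0 < y"
    using conj_quot_deriv[OF sx] by (intro exI[of _ "2 * (cos x - x / sin x)\<^sup>2"]) auto
qed

text \<open>The function increases on (0, pi) and starts from the value 0. The limit at 0 yields
  only a weak inequality, so it is taken at t/2, and strict growth from t/2 to t gives the strict
  one. The half also lies below pi/2, where cos is positive.\<close>

lemma conj_quot_pos:
  assumes "0 < t" "t < pi"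
  shows "conj_quot t > 0"
proof -
  have sn: "sin u \<noteq> 0" if "0 < u" "u \<le> t" for u using sin_gt_zero[of u] that assms by auto
  have lt: "conj_quot (t/2) < conj_quot t" using assms sn by (intro conj_quot_strict_mono) auto
  have "0 \<le> conj_quot (t/2)"
  proof (rule tendsto_upperbound)
    \<comment> \<open>A minorant of \<open>conj_quot\<close> whose limit at 0 is immediate. It comes
      from s cos s <= sin s, that is from s <= tan s.\<close>
    show "((\<lambda>s. sin s * cos s - s) \<longlongrightarrow> 0) (at_right (0::real))"
      by (rule tendsto_eq_intros | simp)+
    show "at_right (0::real) \<noteq> bot" by simp
    show "\<forall>\<^sub>F s in at_right 0. sin s * cos s - s \<le> conj_quot (t/2)"
      unfolding eventually_at_right_field
    proof (intro exI[of _ "t/2"] conjI allI impI)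
      show "t/2 > 0" using assms by simp
      fix s :: real assume s: "0 < s" "s < t/2"
      have "0 < s" "s < pi/2" using s assms by auto
      then have p: "sin s > 0" "cos s > 0" using sin_gt_zero[of s] cos_gt_zero[of s] by auto
      have "s \<le> tan s" using arctan_le_self[of "tan s"] arctan_tan[of s] tan_gt_zero[of s] s assms by simp
      then have "s * cos s \<le> sin s" using p by (simp add: tan_def field_simps)
      then have "s * (s * cos s / sin s) \<le> s * 1" using p s by (intro mult_left_mono) (auto simp: field_simps)
      then have "sin s * cos s - s \<le> conj_quot s" by (simp add: conj_quot_def power2_eq_square)
      also have "conj_quot s < conj_quot (t/2)" using s sn assms by (intro conj_quot_strict_mono) auto
      finally show "sin s * cos s - s \<le> conj_quot (t/2)" by simp
    qed
  qed
  with lt show ?thesis by simp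
qed

lemma sin_cos_third_quadrant:
  fixes t :: real
  assumes "5 * pi / 4 \<le> t" "t < 3 * pi / 2"
  shows "sin t < 0" "cos t < 0" "(sin t)\<^sup>2 \<ge> 1/2"
proof -
  define u where "u = t - pi"
  have u: "pi/4 \<le> u" "u < pi/2" using assms by (auto simp: u_def)
  have t: "t = u + pi" by (simp add: u_def)
  have p: "sin u > 0" "cos u > 0" using u by (auto intro: sin_gt_zero cos_gt_zero)
  then show "sin t < 0" "cos t < 0" by (auto simp: t)
  have "cos (2*u) \<le> cos (pi/2)" using u by (intro cos_monotone_0_pi_le) auto
  then have "1 - 2 * (sin u)\<^sup>2 \<le> 0" by (simp add: cos_double_sin)
  then show "(sin t)\<^sup>2 \<ge> 1/2" by (simp add: t)
qed

text \<open>Between 0 and pi the factor -sin t is negative and \<open>conj_quot\<close> positive.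
  Between pi and 3 pi / 2 the factor is positive and \<open>conj_quot\<close> increases through a
  single zero. At t = pi the quotient has no meaning and \<open>conj_fun\<close> is evaluated
  directly.\<close>

lemma first_conjugate_angle:
  "5 * pi / 4 < 2 * p1V0" "2 * p1V0 < 3 * pi / 2"
  "\<And>t. 0 < t \<Longrightarrow> t < 2 * p1V0 \<Longrightarrow> conj_fun t < 0"
  "\<And>t. 2 * p1V0 < t \<Longrightarrow> t < 3 * pi / 2 \<Longrightarrow> conj_fun t > 0"
proof -
  have sneg: "sin t < 0" if "pi < t" "t \<le> 3*pi/2" for t
    using that sin_lt_zero[of t] by auto
  \<comment> \<open>Here sin and cos agree and the value is t + 1/2 - 2 t^2, which is negative as t
    > 2.\<close>
  have q54: "conj_quot (5 * pi / 4) < 0"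
  proof -
    have e: "5 * pi / 4 = pi/4 + pi" by simp
    have "conj_quot (5*pi/4) = 5*pi/4 + 1/2 - 2 * (5*pi/4)\<^sup>2"
      unfolding conj_quot_def e sin_periodic_pi cos_periodic_pi by (simp add: sin_45 cos_45)
    also have "\<dots> < 0"
    proof -
      have "5*pi/4 > 2" using pi_gt3 by simp
      then have "2 * (5*pi/4) < (5*pi/4) * (5*pi/4)" using pi_gt3 by (intro mult_strict_right_mono) auto
      then show ?thesis using \<open>5*pi/4 > 2\<close> unfolding power2_eq_square by linarith
    qed
    finally show ?thesis .
  qed
  have q32: "conj_quot (3 * pi / 2) > 0"
  proof -
    have e: "3 * pi / 2 = pi/2 + pi" by simp
    show ?thesis unfolding conj_quot_def e sin_periodic_pi cos_periodic_pi by simp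
  qed
  have sin_ne: "sin u \<noteq> 0" if "u \<in> {5*pi/4..3*pi/2}" for u
  proof -
    have "pi < u" "u \<le> 3*pi/2" using that pi_gt_zero by (simp_all only: atLeastAtMost_iff) linarith+
    then show ?thesis using sneg[of u] by simp
  qed
  have cont: "continuous_on {5*pi/4..3*pi/2} conj_quot"
    unfolding conj_quot_def using sin_ne by (intro continuous_intros) auto
  obtain ts where ts: "5*pi/4 \<le> ts" "ts \<le> 3*pi/2" "conj_quot ts = 0"
    using IVT'[of conj_quot "5*pi/4" 0 "3*pi/2"] q54 q32 cont by auto
  have ts1: "5*pi/4 < ts" "ts < 3*pi/2" using ts q54 q32 by (metis less_irrefl order_le_less)+
  have neg: "conj_fun t < 0" if t: "0 < t" "t < ts" for t
  proof -
    consider "t < pi" | "t = pi" | "pi < t" by linarith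
    then show ?thesis
    proof cases
      case 1
      then have "sin t > 0" "conj_quot t > 0" using t sin_gt_zero conj_quot_pos by auto
      then show ?thesis using conj_fun_eq[of t] by (simp add: mult_neg_pos)
    next
      case 2
      then show ?thesis by (simp add: conj_fun_def)
    next
      case 3
      then have s: "sin t < 0" using sneg t ts by auto
        have "sin u \<noteq> 0" if "u \<in> {t..ts}" for u
      proof -
        have "sin u < 0" by (rule sneg) (use 3 that ts(2) in auto)
        then show ?thesis by simp
      qed
      then have "conj_quot t < conj_quot ts" using t by (intro conj_quot_strict_mono)
      then show ?thesis using conj_fun_eq[of t] s ts by (simp add: mult_neg_neg mult_pos_neg)
    qed
  qed
  have pos: "conj_fun t > 0" if t: "ts < t" "t < 3*pi/2" for t
  proof -
    have s: "sin t < 0" using sneg t ts1 pi_gt_zero by auto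
    have "conj_quot ts < conj_quot t"
      using t ts1 pi_gt_zero by (intro conj_quot_strict_mono sin_ne) auto
    then show ?thesis using conj_fun_eq[of t] s ts by (simp add: mult_neg_pos)
  qed
  have z: "conj_fun ts = 0" using conj_fun_eq[of ts] ts sin_ne[of ts] by simp
  have "p1V0 = ts / 2"
    unfolding p1V0_def
  proof (rule Least_equality)
    show "ts / 2 > 0 \<and> fV0 (ts / 2) = 0" using z ts1 pi_gt_zero by (simp add: fV0_eq_conj_fun)
    fix p assume "p > 0 \<and> fV0 p = 0"
    then have "p > 0" "conj_fun (2*p) = 0" by (auto simp: fV0_eq_conj_fun)
    then show "ts / 2 \<le> p" using neg[of "2*p"] by (cases "2*p < ts") auto
  qed
  then have e: "2 * p1V0 = ts" by simp
  show "5 * pi / 4 < 2 * p1V0" "2 * p1V0 < 3 * pi / 2"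
    "\<And>t. 0 < t \<Longrightarrow> t < 2 * p1V0 \<Longrightarrow> conj_fun t < 0"
    "\<And>t. 2 * p1V0 < t \<Longrightarrow> t < 3 * pi / 2 \<Longrightarrow> conj_fun t > 0"
    unfolding e using ts1 neg pos by auto
qed

section \<open>Calibration of circular arcs\<close>

lemma speed_integrable:
  fixes f g :: "real \<Rightarrow> real"
  assumes f: "f \<in> borel_measurable (lebesgue_on {a..b})" "bounded (f ` {a..b})"
    and g: "g \<in> borel_measurable (lebesgue_on {a..b})" "bounded (g ` {a..b})"
  shows "(\<lambda>t. sqrt ((f t)\<^sup>2 + (g t)\<^sup>2)) integrable_on {a..b}"
proof -
  obtain B where B: "\<And>t. t \<in> {a..b} \<Longrightarrow> norm (f t) \<le> B" using f(2) unfolding bounded_iff by blast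
  obtain C where C: "\<And>t. t \<in> {a..b} \<Longrightarrow> norm (g t) \<le> C" using g(2) unfolding bounded_iff by blast
  have "(\<lambda>t. sqrt ((f t)\<^sup>2 + (g t)\<^sup>2)) \<in> borel_measurable (lebesgue_on {a..b})" using f g by measurable
  then show ?thesis
  proof (rule measurable_bounded_by_integrable_imp_integrable)
    show "(\<lambda>t::real. B + C) integrable_on {a..b}" by (rule integrable_const_ivl)
    fix t assume t: "t \<in> {a..b}"
    have "sqrt ((f t)\<^sup>2 + (g t)\<^sup>2) \<le> \<bar>f t\<bar> + \<bar>g t\<bar>" by (rule sqrt_sum_squares_le_sum_abs)
    then show "norm (sqrt ((f t)\<^sup>2 + (g t)\<^sup>2)) \<le> B + C" using B[OF t] C[OF t] by simp
  qed simp
qed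

lemma ac_on_speed_integrable:
  fixes r \<phi> :: "real \<Rightarrow> real"
  assumes r: "ac_on a b r r'" and \<phi>: "ac_on a b \<phi> \<phi>'"
  shows "(\<lambda>t. sqrt ((r' t)\<^sup>2 + (r t * \<phi>' t)\<^sup>2)) integrable_on {a..b}"
proof (rule speed_integrable)
  have cr: "continuous_on {a..b} r" using ac_on_continuous[OF r] .
  then have "r \<in> borel_measurable (lebesgue_on {a..b})"
    by (simp add: continuous_imp_measurable_on_sets_lebesgue)
  then show "(\<lambda>t. r t * \<phi>' t) \<in> borel_measurable (lebesgue_on {a..b})" using \<phi> by (auto simp: ac_on_def)
  obtain M where M: "\<And>t. t \<in> {a..b} \<Longrightarrow> norm (r t) \<le> M"
    using compact_imp_bounded[OF compact_continuous_image[OF cr compact_Icc]] unfolding bounded_iff by blast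
  obtain C where C: "\<And>t. t \<in> {a..b} \<Longrightarrow> norm (\<phi>' t) \<le> C"
    using ac_on_lipschitz[OF \<phi>] by blast
  have "norm (r t * \<phi>' t) \<le> M * C" if t: "t \<in> {a..b}" for t
    unfolding norm_mult using M[OF t] C[OF t] norm_ge_zero[of "r t"] by (intro mult_mono) auto
  then show "bounded ((\<lambda>t. r t * \<phi>' t) ` {a..b})" unfolding bounded_iff by blast
qed (use r in \<open>auto simp: ac_on_def\<close>)

section \<open>The calibration: pointwise estimate and integration along a piece\<close>

lemma calibration_remainder:
  fixes f h hp c mu rho k N d \<delta> :: real
  assumes N: "N \<ge> 1" and d: "0 < d" "d \<le> N" and \<delta>: "0 < \<delta>" "\<delta> \<le> 1/4"
    and f: "\<bar>f\<bar> \<le> \<delta>" and k: "0 \<le> k" "k \<le> \<delta>"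
    and h: "\<bar>h\<bar> \<le> N * k" and hp: "\<bar>hp\<bar> \<le> N * k" and mu: "\<bar>mu\<bar> \<le> N * k"
    and rho: "\<bar>rho\<bar> \<le> N * k" and c: "\<bar>c\<bar> \<le> N"
    and g_def: "g = f - h" and s_def: "s = hp + c * g"
    and P_def: "P = 1 + f - s\<^sup>2/2 - d * g\<^sup>2/2 + mu * f\<^sup>2/2 + rho * f\<^sup>2 + rho * f^3/3"
  shows "P\<^sup>2 + (1+f)\<^sup>2 * s\<^sup>2 - (1+f)\<^sup>2 \<le> - (3/4) * d * g\<^sup>2 + 200 * N^8 * \<delta> * (g\<^sup>2 + k\<^sup>2)"
proof -
  \<comment> \<open>The combined size of two deviations: \<open>g\<close> is that of the competitor
    from the comparison field, and k bounds that of the field from the circle. All errors below are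
    at most multiples of N^8 \<delta> q.\<close>
  define q where "q = g\<^sup>2 + k\<^sup>2"
  define E2 where "E2 = (mu/2 + rho + rho * f/3) * f\<^sup>2"
  define E where "E = - d * g\<^sup>2/2 + E2"
  have q0: "q \<ge> 0" by (simp add: q_def)
  have Np: "N^i \<le> N^j" if "i \<le> j" for i j using N that by (rule power_increasing[rotated])
  have sq: "(x + y)\<^sup>2 \<le> 2 * x\<^sup>2 + 2 * y\<^sup>2" for x y :: real
    using zero_le_power2[of "x - y"] by (simp add: power2_sum power2_diff)
  have absq: "x\<^sup>2 \<le> y\<^sup>2" if "\<bar>x\<bar> \<le> y" for x y :: real
    using that abs_le_square_iff by (metis abs_ge_self abs_of_nonneg order_trans abs_ge_zero)
  have h2: "h\<^sup>2 \<le> N\<^sup>2 * k\<^sup>2" using absq[OF h] by (simp add: power_mult_distrib)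
  have hp2: "hp\<^sup>2 \<le> N\<^sup>2 * k\<^sup>2" using absq[OF hp] by (simp add: power_mult_distrib)
  have c2: "c\<^sup>2 \<le> N\<^sup>2" using absq[OF c] .
  have N2: "1 \<le> N\<^sup>2" using Np[of 0 2] by simp
  have Nk: "N * k \<le> N * \<delta>" using k N by (intro mult_left_mono) auto
  have "\<bar>g\<bar> \<le> \<delta> + N * \<delta>" using f h Nk unfolding g_def by linarith
  also have "\<dots> \<le> 2 * N * \<delta>" using N \<delta> by (simp add: field_simps)
  finally have "g\<^sup>2 \<le> (2 * N * \<delta>)\<^sup>2" by (rule absq)
  then have g2: "g\<^sup>2 \<le> 4 * N\<^sup>2 * \<delta>\<^sup>2" by (simp add: power_mult_distrib)
  have k2: "k\<^sup>2 \<le> \<delta>\<^sup>2" using k by (intro power_mono) auto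
  have "\<delta>\<^sup>2 \<le> \<delta> * 1" unfolding power2_eq_square using \<delta> by (intro mult_left_mono) auto
  then have d2: "\<delta>\<^sup>2 \<le> \<delta>" by simp
  have "q \<le> 5 * N\<^sup>2 * \<delta>\<^sup>2"
    using g2 k2 mult_right_mono[OF N2, of "\<delta>\<^sup>2"] by (simp add: q_def)
  also have "\<dots> \<le> 5 * N\<^sup>2 * \<delta>" using d2 by (intro mult_left_mono) auto
  finally have q1: "q \<le> 5 * N\<^sup>2 * \<delta>" .
  have s2: "s\<^sup>2 \<le> 2 * N\<^sup>2 * q"
  proof -
    have "s\<^sup>2 \<le> 2 * hp\<^sup>2 + 2 * (c\<^sup>2 * g\<^sup>2)" using sq[of hp "c*g"] by (simp add: s_def power_mult_distrib)
    also have "\<dots> \<le> 2 * (N\<^sup>2 * k\<^sup>2) + 2 * (N\<^sup>2 * g\<^sup>2)"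
      using hp2 c2 by (intro add_mono mult_left_mono mult_right_mono) auto
    finally show ?thesis by (simp add: q_def algebra_simps)
  qed
  have f2: "f\<^sup>2 \<le> 2 * N\<^sup>2 * q"
  proof -
    have "f\<^sup>2 \<le> 2 * g\<^sup>2 + 2 * h\<^sup>2" using sq[of g h] by (simp add: g_def)
    also have "\<dots> \<le> 2 * (N\<^sup>2 * g\<^sup>2) + 2 * (N\<^sup>2 * k\<^sup>2)"
      using h2 mult_right_mono[OF N2, of "g\<^sup>2"] by simp
    finally show ?thesis by (simp add: q_def algebra_simps)
  qed
  have E2b: "\<bar>E2\<bar> \<le> 4 * N^3 * \<delta> * q"
  proof -
    have rf: "\<bar>rho * f\<bar> \<le> \<bar>rho\<bar>" unfolding abs_mult using f \<delta> by (intro mult_left_le) auto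
    have "\<bar>mu/2 + rho + rho * f/3\<bar> \<le> 2 * (N * \<delta>)"
      using mu rho rf Nk by linarith
    then have "\<bar>E2\<bar> \<le> (2 * (N * \<delta>)) * (2 * N\<^sup>2 * q)"
      unfolding E2_def abs_mult using f2 N \<delta> by (intro mult_mono) auto
    then show ?thesis by (simp add: power2_eq_square power3_eq_cube mult_ac)
  qed
  have Eb: "\<bar>E\<bar> \<le> 5 * N^3 * q"
  proof -
    have "d * g\<^sup>2 \<le> N^3 * q"
      using d Np[of 1 3] by (intro mult_mono) (auto simp: q_def)
    moreover have "4 * N^3 * \<delta> * q \<le> 4 * N^3 * 1 * q"
      using \<delta> N q0 by (intro mult_left_mono mult_right_mono) auto
    moreover have "N^3 * q \<ge> 0" using N q0 by simp
    moreover have "d * g\<^sup>2 \<ge> 0" using d by simp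
    ultimately show ?thesis unfolding E_def using E2b unfolding abs_le_iff by linarith
  qed
  have mono: "a * N^i * \<delta> * q \<le> a * N^8 * \<delta> * q" if "a \<ge> 0" "i \<le> 8" for a i
    using Np[OF that(2)] that(1) \<delta> q0 by (intro mult_right_mono mult_left_mono) auto
  have qq: "q * q \<le> 5 * N\<^sup>2 * \<delta> * q" using q1 q0 by (rule mult_right_mono)
  have t1: "s\<^sup>2 * ((1 + f) * f) \<le> 3 * N^2 * \<delta> * q"
  proof -
    have "(1 + f) * f \<le> \<bar>1 + f\<bar> * \<bar>f\<bar>" by (metis abs_ge_self abs_mult)
    also have "\<dots> \<le> (3/2) * \<delta>" using f \<delta> by (intro mult_mono) auto
    finally have "s\<^sup>2 * ((1 + f) * f) \<le> s\<^sup>2 * ((3/2) * \<delta>)" by (intro mult_left_mono) auto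
    also have "\<dots> \<le> (2 * N\<^sup>2 * q) * ((3/2) * \<delta>)" using s2 \<delta> by (intro mult_right_mono) auto
    finally show ?thesis by (simp add: mult_ac)
  qed
  have t2: "(s\<^sup>2)\<^sup>2 / 4 \<le> 5 * N^6 * \<delta> * q"
  proof -
    have "(s\<^sup>2)\<^sup>2 \<le> (2 * N\<^sup>2 * q)\<^sup>2" using s2 by (intro power_mono) auto
    also have "\<dots> = 4 * N^4 * (q * q)" by (simp add: power2_eq_square power4_eq_xxxx)
    also have "\<dots> \<le> 4 * N^4 * (5 * N\<^sup>2 * \<delta> * q)" using qq by (intro mult_left_mono) auto
    also have "\<dots> = 4 * (5 * N^6 * \<delta> * q)" by (simp add: power_numeral_reduce)
    finally show ?thesis by simp
  qed
  have t3: "E\<^sup>2 \<le> 125 * N^8 * \<delta> * q"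
  proof -
    have "E\<^sup>2 \<le> (5 * N^3 * q)\<^sup>2" using Eb by (rule absq)
    also have "\<dots> = 25 * N^6 * (q * q)" by (simp add: power_numeral_reduce)
    also have "\<dots> \<le> 25 * N^6 * (5 * N\<^sup>2 * \<delta> * q)" using qq by (intro mult_left_mono) auto
    also have "\<dots> = 125 * N^8 * \<delta> * q" by (simp add: power_numeral_reduce)
    finally show ?thesis .
  qed
  have t4: "- (s\<^sup>2 * E) \<le> 50 * N^7 * \<delta> * q"
  proof -
    have "- (s\<^sup>2 * E) \<le> s\<^sup>2 * \<bar>E\<bar>" using mult_left_mono[of "- E" "\<bar>E\<bar>" "s\<^sup>2"] by simp
    also have "\<dots> \<le> (2 * N\<^sup>2 * q) * (5 * N^3 * q)" using s2 Eb q0 by (intro mult_mono) auto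
    also have "\<dots> = 10 * N^5 * (q * q)" by (simp add: power_numeral_reduce)
    also have "\<dots> \<le> 10 * N^5 * (5 * N\<^sup>2 * \<delta> * q)" using qq N by (intro mult_left_mono) auto
    also have "\<dots> = 50 * N^7 * \<delta> * q" by (simp add: power_numeral_reduce)
    finally show ?thesis .
  qed
  have t5: "2 * (1 + f) * E \<le> - (3/4) * d * g\<^sup>2 + 10 * N^3 * \<delta> * q"
  proof -
    have "(3/4) * (d * g\<^sup>2) \<le> (1 + f) * (d * g\<^sup>2)" using f \<delta> d by (intro mult_right_mono) auto
    moreover have "2 * (1 + f) * E2 \<le> (5/2) * (4 * N^3 * \<delta> * q)"
    proof -
      have "2 * (1 + f) * E2 \<le> \<bar>2 * (1 + f)\<bar> * \<bar>E2\<bar>" by (metis abs_ge_self abs_mult)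
      also have "\<dots> \<le> (5/2) * (4 * N^3 * \<delta> * q)" using f \<delta> E2b by (intro mult_mono) auto
      finally show ?thesis .
    qed
    moreover have "2 * (1 + f) * E = - ((1 + f) * (d * g\<^sup>2)) + 2 * (1 + f) * E2"
      by (simp add: E_def algebra_simps)
    ultimately show ?thesis by linarith
  qed
  have P: "P = 1 + f - s\<^sup>2/2 + E" by (simp add: P_def E_def E2_def algebra_simps power2_eq_square power3_eq_cube)
  \<comment> \<open>The contribution -(1 + f) s^2 of the square of \<open>P\<close> meets (1 + f)^2
    s^2, and only s^2 (1 + f) f is left of them. Thus the one surviving quadratic term is -d g^2,
    contained in 2 (1 + f) E; it has the favourable sign.\<close>
  have "P\<^sup>2 + (1+f)\<^sup>2 * s\<^sup>2 - (1+f)\<^sup>2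
      = s\<^sup>2 * ((1 + f) * f) + (s\<^sup>2)\<^sup>2 / 4 + E\<^sup>2 + 2 * (1 + f) * E - s\<^sup>2 * E"
    unfolding P by (simp add: field_simps power2_eq_square)
  also have "\<dots> \<le> - (3/4) * d * g\<^sup>2 + 200 * (N^8 * \<delta> * q)"
  proof -
    \<comment> \<open>The constant 200 rounds up 3 + 5 + 125 + 50 + 10 from \<open>t1\<close> to
      \<open>t5\<close>, and N^8 is the largest power of N among them.\<close>
    have "N^8 * \<delta> * q \<ge> 0" using N \<delta> q0 by simp
    then show ?thesis
      using t1 t2 t3 t4 t5 mono[of 3 2] mono[of 5 6] mono[of 50 7] mono[of 10 3] by linarith
  qed
  finally show ?thesis by (simp add: q_def mult_ac)
qed

text \<open>Errors in g^2 are swallowed by d, later K^2 - 1, and only the errors in k^2 survive,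
  with a constant that is small with \<delta>. \<open>P\<close> stands for the angular derivative of
  the calibration plus the multiplier terms and s for its radial derivative, so the conclusion
  bounds the norm of the corrected gradient in polar coordinates by sqrt (1 + \<theta> k^2).\<close>

lemma calibration_pointwise:
  fixes N d \<theta> :: real
  assumes N: "N \<ge> 1" and d: "0 < d" "d \<le> N" and \<theta>: "0 < \<theta>"
  shows "\<exists>\<delta>>0. \<delta> \<le> 1/4 \<and> (\<forall>f h hp c mu rho k g s P. \<bar>f\<bar> \<le> \<delta> \<and> 0 \<le> k \<and> k \<le> \<delta> \<and> \<bar>h\<bar> \<le> N * k \<and>
      \<bar>hp\<bar> \<le> N * k \<and> \<bar>mu\<bar> \<le> N * k \<and> \<bar>rho\<bar> \<le> N * k \<and> \<bar>c\<bar> \<le> N \<and> g = f - h \<and> s = hp + c * g \<and>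
      P = 1 + f - s\<^sup>2/2 - d * g\<^sup>2/2 + mu * f\<^sup>2/2 + rho * f\<^sup>2 + rho * f^3/3
      \<longrightarrow> P\<^sup>2 + (1+f)\<^sup>2 * s\<^sup>2 \<le> (1+f)\<^sup>2 * (1 + \<theta> * k\<^sup>2))"
proof -
  \<comment> \<open>This makes 200 N^8 \<delta> at most a quarter of d and of \<theta>. A quarter of
    d is less than the available 3/4, and a quarter of \<theta> is compensated by (1 + f)^2 >=
    1/4.\<close>
  define \<delta> where "\<delta> = min (1/4) (min d \<theta> / (800 * N^8))"
  have N8: "N^8 > 0" using N by simp
  have \<delta>: "\<delta> > 0" "\<delta> \<le> 1/4" using N8 d \<theta> by (auto simp: \<delta>_def)
  have "\<delta> \<le> min d \<theta> / (800 * N^8)" by (simp add: \<delta>_def)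
  then have small: "200 * N^8 * \<delta> \<le> min d \<theta> / 4" using N8 by (simp add: field_simps)
  have "P\<^sup>2 + (1+f)\<^sup>2 * s\<^sup>2 \<le> (1+f)\<^sup>2 * (1 + \<theta> * k\<^sup>2)"
    if H: "\<bar>f\<bar> \<le> \<delta>" "0 \<le> k" "k \<le> \<delta>" "\<bar>h\<bar> \<le> N * k" "\<bar>hp\<bar> \<le> N * k" "\<bar>mu\<bar> \<le> N * k" "\<bar>rho\<bar> \<le> N * k"
      "\<bar>c\<bar> \<le> N" "g = f - h" "s = hp + c * g"
      "P = 1 + f - s\<^sup>2/2 - d * g\<^sup>2/2 + mu * f\<^sup>2/2 + rho * f\<^sup>2 + rho * f^3/3"
    for f h hp c mu rho k g s P :: real
  proof -
    have "P\<^sup>2 + (1+f)\<^sup>2 * s\<^sup>2 - (1+f)\<^sup>2 \<le> - (3/4) * d * g\<^sup>2 + 200 * N^8 * \<delta> * (g\<^sup>2 + k\<^sup>2)"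
      by (rule calibration_remainder[OF N d \<delta> H])
    also have "\<dots> \<le> - (3/4) * d * g\<^sup>2 + (d/4 * g\<^sup>2 + \<theta>/4 * k\<^sup>2)"
    proof -
      have "200 * N^8 * \<delta> * g\<^sup>2 \<le> d/4 * g\<^sup>2" "200 * N^8 * \<delta> * k\<^sup>2 \<le> \<theta>/4 * k\<^sup>2"
        using small by (intro mult_right_mono; simp)+
      then show ?thesis by (simp add: distrib_left)
    qed
    also have "\<dots> \<le> (1/4) * (\<theta> * k\<^sup>2)" using d by (simp add: mult_nonneg_nonneg)
    also have "\<dots> \<le> (1+f)\<^sup>2 * (\<theta> * k\<^sup>2)"
    proof (rule mult_right_mono)
      have "(1/2)\<^sup>2 \<le> (1+f)\<^sup>2" using H(1) \<delta> by (intro power_mono) auto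
      then show "1/4 \<le> (1+f)\<^sup>2" by (simp add: power2_eq_square)
    qed (use \<theta> in auto)
    finally show ?thesis by (simp add: algebra_simps)
  qed
  with \<delta> show ?thesis by blast
qed

text \<open>Cauchy-Schwarz for the corrected gradient of the calibration against the velocity (r', r
  \<phi>'). The parts of the calibration that are linear and quadratic in the deviation vanish at
  both ends, where the competitor meets 1 + h, so only the increment of \<open>A\<close> remains.
  The factor M makes room for a gradient slightly longer than 1.\<close>

lemma calibration_piece:
  fixes r \<phi> h hp rho A :: "real \<Rightarrow> real" and mu K m a b :: real
  assumes r: "ac_on a b r r'" and \<phi>: "ac_on a b \<phi> \<phi>'" and ab: "a \<le> b"
    and h: "\<And>s. (h has_real_derivative hp s) (at s)"
    and hp: "\<And>s. (hp has_real_derivative - h s - (mu + rho s)) (at s)"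
    and rho: "continuous_on UNIV rho"
    and A: "\<And>s. (A has_real_derivative 1/2 - mu/2 - rho s/3 + ((hp s)\<^sup>2 - (h s)\<^sup>2)/2 - (mu + rho s) * h s) (at s)"
    and ends: "r a = 1 + h (\<phi> a)" "r b = 1 + h (\<phi> b)"
    and rpos: "\<And>t. t \<in> {a..b} \<Longrightarrow> r t > 0"
    and cospos: "\<And>t. t \<in> {a..b} \<Longrightarrow> cos (K * (\<phi> t - m)) > 0"
    and bound: "\<And>t g s P. t \<in> {a..b} \<Longrightarrow> g = r t - 1 - h (\<phi> t) \<Longrightarrow> s = hp (\<phi> t) - K * tan (K * (\<phi> t - m)) * g \<Longrightarrow>
        P = r t - s\<^sup>2/2 - (K\<^sup>2 - 1) * g\<^sup>2/2 + mu * (r t - 1)\<^sup>2/2 + rho (\<phi> t) * (r t - 1)\<^sup>2 + rho (\<phi> t) * (r t - 1)^3/3 \<Longrightarrow>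
        P\<^sup>2 + (r t)\<^sup>2 * s\<^sup>2 \<le> (r t)\<^sup>2 * M\<^sup>2"
    and M: "M \<ge> 0"
    and I: "((\<lambda>t. (1 + mu) * ((r t)\<^sup>2 * \<phi>' t) / 2 + rho (\<phi> t) * ((r t)^3 * \<phi>' t) / 3) has_integral I) {a..b}"
  shows "A (\<phi> b) - A (\<phi> a) + I \<le> M * integral {a..b} (\<lambda>t. sqrt ((r' t)\<^sup>2 + (r t * \<phi>' t)\<^sup>2))"
proof -
  \<comment> \<open>The solution of c' = - K^2 - c^2 that vanishes at m, the centre of the piece; it
    is finite while K |s - m| < pi/2.\<close>
  define c where "c s = - K * tan (K * (s - m))" for s
  define A' where "A' s = 1/2 - mu/2 - rho s/3 + ((hp s)\<^sup>2 - (h s)\<^sup>2)/2 - (mu + rho s) * h s" for s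
  define F where "F x s = A s + hp s * (x - 1 - h s) + c s * (x - 1 - h s)\<^sup>2 / 2" for x s
  define G where "G t = r t - 1 - h (\<phi> t)" for t
  \<comment> \<open>\<open>S\<close> and \<open>Q\<close> are the partial derivatives of
    \<open>F\<close> in radius and angle, evaluated along the curve.\<close>
  define S where "S t = hp (\<phi> t) + c (\<phi> t) * G t" for t
  define Q where "Q t = A' (\<phi> t) + (- h (\<phi> t) - (mu + rho (\<phi> t))) * G t - (hp (\<phi> t))\<^sup>2
      + (- K\<^sup>2 - (c (\<phi> t))\<^sup>2) * (G t)\<^sup>2 / 2 - c (\<phi> t) * G t * hp (\<phi> t)" for t
  have cder: "(c has_real_derivative - K\<^sup>2 - (c s)\<^sup>2) (at s)" if "cos (K * (s - m)) > 0" for s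
  proof -
    have "(c has_real_derivative - K * (inverse ((cos (K * (s - m)))\<^sup>2) * K)) (at s)"
      unfolding c_def using that by (auto intro!: derivative_eq_intros)
    moreover have "inverse ((cos (K * (s - m)))\<^sup>2) = 1 + (tan (K * (s - m)))\<^sup>2"
      using tan_sec[of "K * (s - m)"] that by (simp add: power_inverse)
    ultimately show ?thesis by (simp add: c_def power2_eq_square algebra_simps)
  qed
  have Ad: "(A has_real_derivative A' s) (at s)" for s using A by (simp add: A'_def)
  have ch: "((\<lambda>p. u (snd p)) has_derivative (\<lambda>h. u' * snd h)) (at p)"
    if "(u has_real_derivative u') (at (snd p))" for u u' and p :: "real \<times> real"
  proof -
    have "(u has_derivative (*) u') (at (snd p))" using that by (simp add: has_field_derivative_def)
    from has_derivative_compose[OF has_derivative_snd[OF has_derivative_ident] this] show ?thesis .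
  qed
  have cr: "continuous_on {a..b} r" and c\<phi>: "continuous_on {a..b} \<phi>"
    using ac_on_continuous r \<phi> by auto
  have ch_c: "continuous_on UNIV h" using h by (meson DERIV_isCont continuous_at_imp_continuous_on)
  have chp_c: "continuous_on UNIV hp" using hp by (meson DERIV_isCont continuous_at_imp_continuous_on)
  have comp: "continuous_on {a..b} (\<lambda>t. u (\<phi> t))" if "continuous_on UNIV u" for u :: "real \<Rightarrow> real"
    using continuous_on_compose2[OF that c\<phi>] by simp
  have ccomp: "continuous_on {a..b} (\<lambda>t. c (\<phi> t))"
    unfolding c_def using cospos by (intro continuous_intros c\<phi>) fastforce
  have cG: "continuous_on {a..b} G"
    unfolding G_def by (intro continuous_intros cr comp ch_c)
  have cS: "continuous_on {a..b} S"
    unfolding S_def by (intro continuous_intros cG ccomp comp chp_c)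
  have cQ: "continuous_on {a..b} Q"
    unfolding Q_def A'_def by (intro continuous_intros cG ccomp comp chp_c ch_c rho) auto
  have "ac_on a b (\<lambda>t. F (r t) (\<phi> t)) (\<lambda>t. S t * r' t + Q t * \<phi>' t)"
  proof (rule ac_on_chain2[OF r \<phi> _ cS cQ])
    fix t assume t: "t \<in> {a..b}"
    show "((\<lambda>p. F (fst p) (snd p)) has_derivative (\<lambda>h. S t * fst h + Q t * snd h)) (at (r t, \<phi> t))"
    proof -
      let ?p = "(r t, \<phi> t)"
      have dg: "((\<lambda>p. fst p - 1 - h (snd p)) has_derivative (\<lambda>v. fst v - 0 - hp (\<phi> t) * snd v)) (at ?p)"
        by (intro has_derivative_diff has_derivative_fst has_derivative_ident has_derivative_const ch) (simp add: h)
      have dA: "((\<lambda>p. A (snd p)) has_derivative (\<lambda>v. A' (\<phi> t) * snd v)) (at ?p)"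
        by (rule ch) (simp add: Ad)
      have dhp: "((\<lambda>p. hp (snd p)) has_derivative (\<lambda>v. (- h (\<phi> t) - (mu + rho (\<phi> t))) * snd v)) (at ?p)"
        by (rule ch) (simp only: snd_conv hp)
      have dc: "((\<lambda>p. c (snd p)) has_derivative (\<lambda>v. (- K\<^sup>2 - (c (\<phi> t))\<^sup>2) * snd v)) (at ?p)"
        by (rule ch) (simp only: snd_conv cder[OF cospos[OF t]])
      have half: "(\<lambda>p. F (fst p) (snd p)) = (\<lambda>p. A (snd p) + hp (snd p) * (fst p - 1 - h (snd p))
          + (1/2) * (c (snd p) * ((fst p - 1 - h (snd p)) * (fst p - 1 - h (snd p)))))"
        by (simp add: F_def power2_eq_square fun_eq_iff)
      have alg: "a1 * y + (u * (x - 0 - u * y) + w * y * g) + (1/2) * (k * (g * (x - 0 - u * y) + (x - 0 - u * y) * g) + k1 * y * (g * g))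
        = (u + k * g) * x + (a1 + w * g - u\<^sup>2 + k1 * g\<^sup>2 / 2 - k * g * u) * y" for a1 x y u w g k k1 :: real
        by (simp add: field_simps power2_eq_square)
      show ?thesis
        unfolding half
        by (rule has_derivative_eq_rhs[OF has_derivative_add[OF has_derivative_add[OF dA has_derivative_mult[OF dhp dg]]
              has_derivative_mult_right[OF has_derivative_mult[OF dc has_derivative_mult[OF dg dg]]]]])
          (simp only: fst_conv snd_conv alg S_def Q_def G_def)
    qed
  qed
  from ac_on_has_integral[OF this order_refl ab order_refl]
  have "((\<lambda>t. S t * r' t + Q t * \<phi>' t) has_integral (A (\<phi> b) - A (\<phi> a))) {a..b}"
    using ends by (simp add: F_def)
  from has_integral_add[OF this I]
  have int: "((\<lambda>t. S t * r' t + Q t * \<phi>' t + ((1 + mu) * ((r t)\<^sup>2 * \<phi>' t) / 2 + rho (\<phi> t) * ((r t)^3 * \<phi>' t) / 3))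
     has_integral (A (\<phi> b) - A (\<phi> a) + I)) {a..b}" .
  have Lint: "((\<lambda>t. M * sqrt ((r' t)\<^sup>2 + (r t * \<phi>' t)\<^sup>2)) has_integral
     M * integral {a..b} (\<lambda>t. sqrt ((r' t)\<^sup>2 + (r t * \<phi>' t)\<^sup>2))) {a..b}"
    using ac_on_speed_integrable[OF r \<phi>] by (intro has_integral_mult_right) (simp add: has_integral_integrable_integral)
  show ?thesis
  proof (rule has_integral_le[OF int Lint])
    fix t assume t: "t \<in> {a..b}"
    define P where "P = r t - (S t)\<^sup>2/2 - (K\<^sup>2 - 1) * (G t)\<^sup>2/2 + mu * (r t - 1)\<^sup>2/2
      + rho (\<phi> t) * (r t - 1)\<^sup>2 + rho (\<phi> t) * (r t - 1)^3/3"
    have rt: "r t > 0" using rpos[OF t] .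
    \<comment> \<open>The derivative of \<open>A\<close>, the equation for \<open>hp\<close> and the
      Riccati equation are designed for this identity: the terms of order 0 and 1 in r - 1 collapse
      to r, and besides -s^2/2 there remain the strict term with K^2 - 1 and terms that are small of
      third order.\<close>
    have PQ: "Q t + (1 + mu) * (r t)\<^sup>2 / 2 + rho (\<phi> t) * (r t)^3 / 3 = P"
      unfolding P_def Q_def A'_def S_def G_def by (simp add: field_simps power2_eq_square power3_eq_cube)
    have "S t * r' t + Q t * \<phi>' t + ((1 + mu) * ((r t)\<^sup>2 * \<phi>' t) / 2 + rho (\<phi> t) * ((r t)^3 * \<phi>' t) / 3)
       = S t * r' t + P * \<phi>' t" unfolding PQ[symmetric] by (simp add: algebra_simps)
    also have "\<dots> = S t * r' t + (P / r t) * (r t * \<phi>' t)" using rt by simp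
    also have "\<dots> \<le> sqrt ((S t)\<^sup>2 + (P / r t)\<^sup>2) * sqrt ((r' t)\<^sup>2 + (r t * \<phi>' t)\<^sup>2)"
    proof -
      have "(S t, P / r t) \<bullet> (r' t, r t * \<phi>' t) \<le> norm (S t, P / r t) * norm (r' t, r t * \<phi>' t)"
        by (rule norm_cauchy_schwarz)
      then show ?thesis
        by (simp only: inner_prod_def norm_prod_def inner_real_def real_norm_def power2_abs fst_conv snd_conv)
    qed
    also have "\<dots> \<le> M * sqrt ((r' t)\<^sup>2 + (r t * \<phi>' t)\<^sup>2)"
    proof (rule mult_right_mono)
      have "P\<^sup>2 + (r t)\<^sup>2 * (S t)\<^sup>2 \<le> (r t)\<^sup>2 * M\<^sup>2"
        by (rule bound[OF t _ _ P_def]) (simp_all add: G_def S_def c_def)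
      moreover have "(S t)\<^sup>2 + (P / r t)\<^sup>2 = (P\<^sup>2 + (r t)\<^sup>2 * (S t)\<^sup>2) / (r t)\<^sup>2"
        using rt by (simp add: add_divide_distrib power_divide)
      ultimately have "(S t)\<^sup>2 + (P / r t)\<^sup>2 \<le> M\<^sup>2"
        using rt by (simp add: pos_divide_le_eq mult.commute)
      then show "sqrt ((S t)\<^sup>2 + (P / r t)\<^sup>2) \<le> M" using M by (rule real_le_lsqrt[rotated])
    qed auto
    finally show "S t * r' t + Q t * \<phi>' t + ((1 + mu) * ((r t)\<^sup>2 * \<phi>' t) / 2 + rho (\<phi> t) * ((r t)^3 * \<phi>' t) / 3)
       \<le> M * sqrt ((r' t)\<^sup>2 + (r t * \<phi>' t)\<^sup>2)" .
  qed
qed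

section \<open>Jacobi fields of the circle and their second variation\<close>

text \<open>Odd and even solutions \<open>h\<close> of \<open>- h'' - h = \<mu> + \<rho>\<close>, \<open>\<rho>\<close> a combination of \<open>sin\<close> and \<open>cos\<close>, that vanish
  at \<open>\<plusminus>\<tau>\<close>: the Jacobi fields of the unit circle for fixed area and moments.\<close>

definition jac_odd :: "real \<Rightarrow> real \<Rightarrow> real" where
  "jac_odd \<tau> s = s * cos s * sin \<tau> - \<tau> * cos \<tau> * sin s"
definition jac_odd' :: "real \<Rightarrow> real \<Rightarrow> real" where
  "jac_odd' \<tau> s = cos s * sin \<tau> - s * sin s * sin \<tau> - \<tau> * cos \<tau> * cos s"
definition jac_even :: "real \<Rightarrow> real \<Rightarrow> real" where
  "jac_even \<tau> s = s * sin s - \<tau> * sin \<tau>"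
definition jac_even' :: "real \<Rightarrow> real" where
  "jac_even' s = sin s + s * cos s"

lemma jac_odd_deriv: "(jac_odd \<tau> has_real_derivative jac_odd' \<tau> s) (at s)"
  unfolding jac_odd_def jac_odd'_def by (auto intro!: derivative_eq_intros simp: algebra_simps)

lemma jac_odd'_deriv: "(jac_odd' \<tau> has_real_derivative - jac_odd \<tau> s - 2 * sin \<tau> * sin s) (at s)"
  unfolding jac_odd_def jac_odd'_def by (auto intro!: derivative_eq_intros simp: algebra_simps)

lemma jac_even_deriv: "(jac_even \<tau> has_real_derivative jac_even' s) (at s)"
  unfolding jac_even_def jac_even'_def by (auto intro!: derivative_eq_intros simp: algebra_simps)

lemma jac_even'_deriv: "(jac_even' has_real_derivative - jac_even \<tau> s - (\<tau> * sin \<tau> - 2 * cos s)) (at s)"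
  unfolding jac_even_def jac_even'_def by (auto intro!: derivative_eq_intros simp: algebra_simps)

lemma jac_minus [simp]: "jac_odd \<tau> (- s) = - jac_odd \<tau> s" "jac_even \<tau> (- s) = jac_even \<tau> s"
  by (auto simp: jac_odd_def jac_even_def)

lemma jac_end [simp]: "jac_odd \<tau> \<tau> = 0" "jac_even \<tau> \<tau> = 0"
  by (auto simp: jac_odd_def jac_even_def)

text \<open>Integration by parts turns the integral of h'^2 - h^2, for a field that vanishes at both
  ends, into that of (\<mu> + \<rho>) h. For the odd field \<mu> + \<rho> is 2 sin \<tau> sin s, and
  this is a primitive of the resulting integrand. \<open>even_prim\<close> and
  \<open>mixed_prim\<close> serve the even field and the cross term.\<close>

definition odd_prim :: "real \<Rightarrow> real \<Rightarrow> real" where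
  "odd_prim \<tau> s = 2 * sin \<tau> * (sin \<tau> * (s * (sin s)\<^sup>2 / 2 - s / 4 + sin s * cos s / 4)
     - \<tau> * cos \<tau> * (s - sin s * cos s) / 2)"

lemma odd_prim_deriv: "(odd_prim \<tau> has_real_derivative 2 * sin \<tau> * sin s * jac_odd \<tau> s) (at s)"
proof -
  have c: "(cos s)\<^sup>2 = 1 - (sin s)\<^sup>2" by (simp add: cos_squared_eq)
  have "(odd_prim \<tau> has_real_derivative 2 * sin \<tau> * (sin \<tau> * ((sin s)\<^sup>2 / 2 + s * sin s * cos s - 1/4 + ((cos s)\<^sup>2 - (sin s)\<^sup>2) / 4)
     - \<tau> * cos \<tau> * (1 - ((cos s)\<^sup>2 - (sin s)\<^sup>2)) / 2)) (at s)"
    unfolding odd_prim_def by (auto intro!: derivative_eq_intros simp: power2_eq_square field_simps)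
  then show ?thesis unfolding c jac_odd_def
    by (rule DERIV_cong) (simp add: field_simps power2_eq_square)
qed

text \<open>This ties the conjugate angle to the second variation: where sin \<tau> < 0, the second
  variation of the odd field has the sign of \<open>conj_fun\<close>.\<close>

lemma odd_prim_diff: "odd_prim \<tau> \<tau> - odd_prim \<tau> (- \<tau>) = - sin \<tau> * conj_fun \<tau>"
proof -
  have "odd_prim \<tau> \<tau> = - sin \<tau> * conj_fun \<tau> / 2"
  proof -
    define S C where "S = sin \<tau>" and "C = cos \<tau>"
    have "S\<^sup>2 + C\<^sup>2 = 1" by (simp add: S_def C_def)
    then show ?thesis
      unfolding odd_prim_def conj_fun_def S_def[symmetric] C_def[symmetric]
      by algebra
  qed
  moreover have "odd_prim \<tau> (- \<tau>) = - odd_prim \<tau> \<tau>" by (simp add: odd_prim_def field_simps)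
  ultimately show ?thesis by simp
qed

definition even_prim :: "real \<Rightarrow> real \<Rightarrow> real" where
  "even_prim \<tau> s = \<tau> * sin \<tau> * (sin s - s * cos s) - \<tau>\<^sup>2 * (sin \<tau>)\<^sup>2 * s
     - (s * (sin s)\<^sup>2 - s / 2 + sin s * cos s / 2) + 2 * \<tau> * sin \<tau> * sin s"

lemma even_prim_deriv: "(even_prim \<tau> has_real_derivative (\<tau> * sin \<tau> - 2 * cos s) * jac_even \<tau> s) (at s)"
proof -
  have c: "(cos s)\<^sup>2 = 1 - (sin s)\<^sup>2" by (simp add: cos_squared_eq)
  have "(even_prim \<tau> has_real_derivative \<tau> * sin \<tau> * (s * sin s) - \<tau>\<^sup>2 * (sin \<tau>)\<^sup>2
     - ((sin s)\<^sup>2 + 2 * s * sin s * cos s - 1 / 2 + ((cos s)\<^sup>2 - (sin s)\<^sup>2) / 2) + 2 * \<tau> * sin \<tau> * cos s) (at s)"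
    unfolding even_prim_def by (auto intro!: derivative_eq_intros simp: power2_eq_square field_simps)
  then show ?thesis unfolding c jac_even_def
    by (rule DERIV_cong) (simp add: field_simps power2_eq_square)
qed

text \<open>The term - \<tau>^3 (sin \<tau>)^2 dominates because \<tau> > 3 and (sin \<tau>)^2 >=
  1/2, and the product sin \<tau> cos \<tau> is positive. So the even field does not degenerate
  anywhere on this range.\<close>

lemma even_prim_diff_neg:
  assumes "5 * pi / 4 \<le> \<tau>" "\<tau> < 3 * pi / 2"
  shows "even_prim \<tau> \<tau> - even_prim \<tau> (- \<tau>) < 0"
proof -
  define S C where "S = sin \<tau>" and "C = cos \<tau>"
  have S: "S < 0" "C < 0" "S\<^sup>2 \<ge> 1/2" unfolding S_def C_def using sin_cos_third_quadrant[OF assms] by auto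
  have t: "\<tau> > 3" using assms pi_gt3 by linarith
  then have t2: "\<tau>\<^sup>2 > 9" using power_strict_mono[of 3 \<tau> 2] by simp
  have "even_prim \<tau> (- \<tau>) = - even_prim \<tau> \<tau>" by (simp add: even_prim_def field_simps)
  moreover have "even_prim \<tau> \<tau> = \<tau> * (2 * S\<^sup>2 + 1/2 - \<tau>\<^sup>2 * S\<^sup>2) - S * C * (\<tau>\<^sup>2 + 1/2)"
    unfolding even_prim_def S_def[symmetric] C_def[symmetric] by (simp add: field_simps power2_eq_square)
  moreover have "S * C * (\<tau>\<^sup>2 + 1/2) > 0" using S t2 by (intro mult_pos_pos mult_neg_neg) auto
  moreover have "\<tau> * (2 * S\<^sup>2 + 1/2 - \<tau>\<^sup>2 * S\<^sup>2) < 0"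
  proof (rule mult_pos_neg)
    have "3 * (1/2) \<le> (\<tau>\<^sup>2 - 2) * S\<^sup>2" using t2 S by (intro mult_mono) auto
    then show "2 * S\<^sup>2 + 1/2 - \<tau>\<^sup>2 * S\<^sup>2 < 0" by (simp add: algebra_simps)
  qed (use t in auto)
  ultimately show ?thesis by linarith
qed

definition mixed_prim :: "real \<Rightarrow> real \<Rightarrow> real" where
  "mixed_prim \<tau> s = - 2 * sin \<tau> * (s * sin s * cos s + (1 - 2 * (sin s)\<^sup>2) / 4) + 2 * \<tau> * (sin \<tau>)\<^sup>2 * cos s
    + \<tau> * (sin \<tau>)\<^sup>2 * (s * sin s + cos s) + \<tau>\<^sup>2 * sin \<tau> * cos \<tau> * cos s + \<tau> * cos \<tau> * (sin s)\<^sup>2"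

lemma mixed_prim_deriv: "(mixed_prim \<tau> has_real_derivative
    2 * sin \<tau> * sin s * jac_even \<tau> s + (\<tau> * sin \<tau> - 2 * cos s) * jac_odd \<tau> s) (at s)"
proof -
  have "(mixed_prim \<tau> has_real_derivative - 2 * sin \<tau> * (sin s * cos s + s * ((cos s)\<^sup>2 - (sin s)\<^sup>2) - sin s * cos s)
     - 2 * \<tau> * (sin \<tau>)\<^sup>2 * sin s
     + \<tau> * (sin \<tau>)\<^sup>2 * (s * cos s) - \<tau>\<^sup>2 * sin \<tau> * cos \<tau> * sin s + 2 * \<tau> * cos \<tau> * sin s * cos s) (at s)"
    unfolding mixed_prim_def by (auto intro!: derivative_eq_intros simp: power2_eq_square field_simps)
  then show ?thesis unfolding jac_odd_def jac_even_def
    by (rule DERIV_cong) (simp add: field_simps power2_eq_square)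
qed

text \<open>The cross term of an odd and an even field has an odd integrand, hence an even
  primitive. It cancels over the symmetric arc, and the second variation is diagonal in the two
  coefficients.\<close>

lemma mixed_prim_minus [simp]: "mixed_prim \<tau> (- s) = mixed_prim \<tau> s"
  by (simp add: mixed_prim_def)

text \<open>Guarantees that the two fields can interpolate any values at the angles -\<tau>/3 and
  \<tau>/3. With u = \<tau>/3, the triple angle formulas give 8 u cos u (sin u)^3 for the odd field
  and 4 u sin u (3 (sin u)^2 - 2) for the even one. The last factor is positive because u >
  pi/3.\<close>

lemma jac_third_nonzero:
  assumes "5 * pi / 4 \<le> \<tau>" "\<tau> < 3 * pi / 2"
  shows "jac_odd \<tau> (\<tau>/3) \<noteq> 0" "jac_even \<tau> (\<tau>/3) \<noteq> 0"
proof -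
  define u where "u = \<tau> / 3"
  have u: "5 * pi / 12 \<le> u" "u < pi/2" "\<tau> = 3 * u" "u > 0" using assms pi_gt_zero by (auto simp: u_def)
  have p: "sin u > 0" "cos u > 0" using u by (auto intro: sin_gt_zero cos_gt_zero)
  have c3: "cos (3*u) = 4 * cos u ^ 3 - 3 * cos u" using cos_treble_cos[of u] by simp
  have s3: "sin (3*u) = 3 * sin u - 4 * sin u ^ 3"
  proof -
    have "sin (3*u) = sin (2*u) * cos u + cos (2*u) * sin u" using sin_add[of "2*u" u] by simp
    also have "\<dots> = 2 * sin u * (cos u)\<^sup>2 + (1 - 2 * (sin u)\<^sup>2) * sin u"
      by (simp add: sin_double cos_double_sin power2_eq_square)
    also have "\<dots> = 3 * sin u - 4 * sin u ^ 3"
      using sin_cos_squared_add[of u] by algebra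
    finally show ?thesis .
  qed
  have sc: "(sin u)\<^sup>2 + (cos u)\<^sup>2 = 1" by simp
  have "jac_odd \<tau> u = 8 * u * cos u * sin u ^ 3"
    unfolding jac_odd_def u(3) c3 s3 using sc by algebra
  then have "jac_odd \<tau> u \<noteq> 0" using p u(4) by simp
  then show "jac_odd \<tau> (\<tau>/3) \<noteq> 0" by (simp add: u_def)
  have e: "jac_even \<tau> u = 4 * u * sin u * (3 * (sin u)\<^sup>2 - 2)"
    unfolding jac_even_def u(3) s3 by algebra
  have "sin (pi/3) < sin u" using u pi_gt_zero by (intro sin_monotone_2pi) auto
  then have "(sin (pi/3))\<^sup>2 < (sin u)\<^sup>2" by (intro power_strict_mono) (auto simp: sin_60)
  then have "3/4 < (sin u)\<^sup>2" by (simp add: sin_60 power_divide)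
  then have "jac_even \<tau> u \<noteq> 0" using p u(4) e by simp
  then show "jac_even \<tau> (\<tau>/3) \<noteq> 0" by (simp add: u_def)
qed

text \<open>The half-length \<tau>/3 of a piece is below pi/2, so some frequency K > 1 still keeps
  the tangent finite on the piece and slightly beyond it. The margin e is for the deviation of the
  competitor's angle.\<close>

lemma tan_coefficient:
  assumes "0 < \<tau>" "\<tau> < 3 * pi / 2"
  shows "\<exists>K N e::real. K > 1 \<and> N \<ge> 1 \<and> K\<^sup>2 - 1 \<le> N \<and> e > 0 \<and>
    (\<forall>x. \<bar>x\<bar> \<le> \<tau>/3 + e \<longrightarrow> cos (K * x) > 0 \<and> \<bar>K * tan (K * x)\<bar> \<le> N)"
proof -
  define \<beta> where "\<beta> = (\<tau>/3 + pi/2) / 2"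
  have \<beta>: "\<tau>/3 < \<beta>" "\<beta> < pi/2" "\<beta> > 0" using assms pi_gt_zero by (auto simp: \<beta>_def)
  \<comment> \<open>K is halfway between 1 and (pi/2)/\<beta>, which puts K \<beta> halfway between
    \<beta> and pi/2.\<close>
  define K where "K = (1 + (pi/2) / \<beta>) / 2"
  have K1: "K > 1" using \<beta> by (simp add: K_def field_simps)
  have "K * \<beta> = (\<beta> + pi/2) / 2" using \<beta> by (simp add: K_def field_simps)
  then have K\<beta>: "K * \<beta> < pi/2" "0 < K * \<beta>" using \<beta> by auto
  define N where "N = 1 + \<bar>K\<^sup>2 - 1\<bar> + \<bar>K * tan (K * \<beta>)\<bar>"
  have b: "cos (K * x) > 0 \<and> \<bar>K * tan (K * x)\<bar> \<le> N" if "\<bar>x\<bar> \<le> \<beta>" for x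
  proof -
    have "\<bar>K * x\<bar> \<le> K * \<beta>" using that K1 by (simp add: abs_mult)
    then have x: "- (K * \<beta>) \<le> K * x" "K * x \<le> K * \<beta>" by auto
    then have c: "cos (K * x) > 0" using K\<beta> by (intro cos_gt_zero_pi) auto
    have "tan (K * x) \<le> tan (K * \<beta>)"
      using x K\<beta> tan_monotone'[of "K * \<beta>" "K * x"] by (auto simp: not_less[symmetric])
    moreover have "tan (- (K * \<beta>)) \<le> tan (K * x)"
      using x K\<beta> tan_monotone'[of "K * x" "- (K * \<beta>)"] by (auto simp: not_less[symmetric])
    ultimately have "\<bar>tan (K * x)\<bar> \<le> tan (K * \<beta>)" by (simp add: abs_le_iff)
    then have "K * \<bar>tan (K * x)\<bar> \<le> K * tan (K * \<beta>)" using K1 by (intro mult_left_mono) auto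
    moreover have "\<bar>K * tan (K * x)\<bar> = K * \<bar>tan (K * x)\<bar>" using K1 by (simp add: abs_mult)
    ultimately have "\<bar>K * tan (K * x)\<bar> \<le> N" unfolding N_def by linarith
    with c show ?thesis by simp
  qed
  have "\<beta> - \<tau>/3 > 0" "N \<ge> 1" "K\<^sup>2 - 1 \<le> N" using \<beta> by (auto simp: N_def)
  moreover have "\<forall>x. \<bar>x\<bar> \<le> \<tau>/3 + (\<beta> - \<tau>/3) \<longrightarrow> cos (K * x) > 0 \<and> \<bar>K * tan (K * x)\<bar> \<le> N"
    using b by simp
  ultimately show ?thesis using K1 by blast
qed

text \<open>The bound 6 exceeds every angle that a competitor reaches, as \<tau> < 5 and its angle
  deviates by at most 1/4. The worst case is \<open>jac_odd'\<close>, with 13 = 1 + 6 + 6.\<close>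

lemma jac_bounds:
  assumes "\<bar>s\<bar> \<le> 6" "\<bar>\<tau>\<bar> \<le> 6"
  shows "\<bar>jac_odd \<tau> s\<bar> \<le> 13" "\<bar>jac_even \<tau> s\<bar> \<le> 13" "\<bar>jac_odd' \<tau> s\<bar> \<le> 13" "\<bar>jac_even' s\<bar> \<le> 13"
    "\<bar>\<tau> * sin \<tau>\<bar> \<le> 13"
proof -
  have t: "\<bar>x * y\<bar> \<le> a" if "\<bar>x\<bar> \<le> a" "\<bar>y\<bar> \<le> 1" for x y a :: real
    unfolding abs_mult using mult_mono[of "\<bar>x\<bar>" a "\<bar>y\<bar>" 1] that by auto
  have "\<bar>s * cos s * sin \<tau>\<bar> \<le> 6" "\<bar>\<tau> * cos \<tau> * sin s\<bar> \<le> 6" "\<bar>s * sin s\<bar> \<le> 6" "\<bar>\<tau> * sin \<tau>\<bar> \<le> 6"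
    "\<bar>cos s * sin \<tau>\<bar> \<le> 1" "\<bar>s * sin s * sin \<tau>\<bar> \<le> 6" "\<bar>\<tau> * cos \<tau> * cos s\<bar> \<le> 6" "\<bar>sin s\<bar> \<le> 1" "\<bar>s * cos s\<bar> \<le> 6"
    using assms by (auto intro!: t)
  then show "\<bar>jac_odd \<tau> s\<bar> \<le> 13" "\<bar>jac_even \<tau> s\<bar> \<le> 13" "\<bar>jac_odd' \<tau> s\<bar> \<le> 13" "\<bar>jac_even' s\<bar> \<le> 13"
    "\<bar>\<tau> * sin \<tau>\<bar> \<le> 13"
    unfolding jac_odd_def jac_even_def jac_odd'_def jac_even'_def abs_le_iff by linarith+
qed

lemma jac_combination_bound:
  fixes k1 k2 x y :: real
  assumes "\<bar>x\<bar> \<le> 13" "\<bar>y\<bar> \<le> 13"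
  shows "\<bar>k1 * x + k2 * y\<bar> \<le> 13 * (\<bar>k1\<bar> + \<bar>k2\<bar>)"
proof -
  have "\<bar>k1 * x + k2 * y\<bar> \<le> \<bar>k1\<bar> * \<bar>x\<bar> + \<bar>k2\<bar> * \<bar>y\<bar>" by (metis abs_mult abs_triangle_ineq)
  also have "\<dots> \<le> \<bar>k1\<bar> * 13 + \<bar>k2\<bar> * 13" using assms by (intro add_mono mult_left_mono) auto
  finally show ?thesis by (simp add: algebra_simps)
qed

section \<open>Minimality of the arc in polar coordinates\<close>

text \<open>Curves in polar coordinates that are uniformly close to the arc \<open>\<bar>angle\<bar> \<le> \<tau>\<close> of the unit circle, with
  its end points, area and first moments (up to exact differentials).\<close>

definition arc_competitor ::
  "real \<Rightarrow> real \<Rightarrow> real \<Rightarrow> real \<Rightarrow> (real \<Rightarrow> real) \<Rightarrow> (real \<Rightarrow> real) \<Rightarrow> (real \<Rightarrow> real) \<Rightarrow> (real \<Rightarrow> real) \<Rightarrow> bool" where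
  "arc_competitor \<tau> \<delta> \<kappa> T r r' \<phi> \<phi>' \<longleftrightarrow> \<kappa> > 0 \<and> T = 2 * \<tau> / \<kappa> \<and> ac_on 0 T r r' \<and> ac_on 0 T \<phi> \<phi>' \<and>
    (\<forall>t\<in>{0..T}. \<bar>r t - 1\<bar> \<le> \<delta> \<and> \<bar>\<phi> t - (\<kappa> * t - \<tau>)\<bar> \<le> \<delta>) \<and>
    r 0 = 1 \<and> r T = 1 \<and> \<phi> 0 = - \<tau> \<and> \<phi> T = \<tau> \<and>
    ((\<lambda>t. (r t)\<^sup>2 * \<phi>' t) has_integral 2 * \<tau>) {0..T} \<and>
    ((\<lambda>t. (r t)^3 * cos (\<phi> t) * \<phi>' t) has_integral 2 * sin \<tau>) {0..T} \<and>
    ((\<lambda>t. (r t)^3 * sin (\<phi> t) * \<phi>' t) has_integral 0) {0..T}"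

text \<open>The slope function of the calibration is singular after an angle \<open>pi\<close>, while the arc is longer
  than that. It is therefore cut at the angles \<open>\<plusminus>\<tau>/3\<close>, and the calibration is centred at
  the combination of Jacobi fields that agrees with the competitor at the cuts.\<close>

lemma arc_minimal_polar:
  assumes \<tau>: "5 * pi / 4 \<le> \<tau>" "\<tau> < 3 * pi / 2" and neg: "conj_fun \<tau> < 0"
  shows "\<exists>\<delta>>0. \<forall>T \<kappa> r r' \<phi> \<phi>'. arc_competitor \<tau> \<delta> \<kappa> T r r' \<phi> \<phi>' \<longrightarrow>
    2 * \<tau> \<le> integral {0..T} (\<lambda>t. sqrt ((r' t)\<^sup>2 + (r t * \<phi>' t)\<^sup>2))"
proof -
  have \<tau>0: "\<tau> > 0" using \<tau> pi_gt_zero by linarith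
  have \<tau>5: "\<tau> < 5" using \<tau> pi_approx by simp
  obtain K N0 e where K: "K > 1" and N0: "N0 \<ge> 1" "K\<^sup>2 - 1 \<le> N0" and e: "e > 0"
    and tanb: "\<And>x. \<bar>x\<bar> \<le> \<tau>/3 + e \<Longrightarrow> cos (K * x) > 0 \<and> \<bar>K * tan (K * x)\<bar> \<le> N0"
    using tan_coefficient[OF \<tau>0 \<tau>(2)] by blast
  define N where "N = max 13 N0"
  have N: "N \<ge> 1" "N \<ge> 13" "N \<ge> N0" by (auto simp: N_def)
  have d: "0 < K\<^sup>2 - 1" "K\<^sup>2 - 1 \<le> N" using K N0 N by (auto simp: one_less_power)
  define Qo where "Qo = odd_prim \<tau> \<tau> - odd_prim \<tau> (- \<tau>)"
  define Qe where "Qe = even_prim \<tau> \<tau> - even_prim \<tau> (- \<tau>)"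
  have Qo: "Qo < 0" using neg sin_cos_third_quadrant[OF \<tau>] by (simp add: Qo_def odd_prim_diff mult_neg_neg)
  have Qe: "Qe < 0" using even_prim_diff_neg[OF \<tau>] by (simp add: Qe_def)
  define q0 where "q0 = min (- Qo) (- Qe)"
  have q0: "q0 > 0" "Qo \<le> - q0" "Qe \<le> - q0" using Qo Qe by (auto simp: q0_def)
  \<comment> \<open>With this \<theta> the error 2 \<tau> \<theta> k^2 equals q0 k^2 / 4, which is
    the least gain from the second variation.\<close>
  define \<theta> where "\<theta> = q0 / (8 * \<tau>)"
  have \<theta>: "\<theta> > 0" using q0 \<tau>0 by (simp add: \<theta>_def)
  obtain \<delta>0 where \<delta>0: "\<delta>0 > 0" "\<delta>0 \<le> 1/4" and pw: "\<And>f h hp c mu rho k g s P. \<bar>f\<bar> \<le> \<delta>0 \<Longrightarrow> 0 \<le> k \<Longrightarrow> k \<le> \<delta>0 \<Longrightarrow> \<bar>h\<bar> \<le> N * k \<Longrightarrow>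
      \<bar>hp\<bar> \<le> N * k \<Longrightarrow> \<bar>mu\<bar> \<le> N * k \<Longrightarrow> \<bar>rho\<bar> \<le> N * k \<Longrightarrow> \<bar>c\<bar> \<le> N \<Longrightarrow> g = f - h \<Longrightarrow> s = hp + c * g \<Longrightarrow>
      P = 1 + f - s\<^sup>2/2 - (K\<^sup>2 - 1) * g\<^sup>2/2 + mu * f\<^sup>2/2 + rho * f\<^sup>2 + rho * f^3/3
      \<Longrightarrow> P\<^sup>2 + (1+f)\<^sup>2 * s\<^sup>2 \<le> (1+f)\<^sup>2 * (1 + \<theta> * k\<^sup>2)"
    using calibration_pointwise[OF N(1) d \<theta>] by metis
  define Jo where "Jo = jac_odd \<tau> (\<tau>/3)"
  define Je where "Je = jac_even \<tau> (\<tau>/3)"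
  have J: "Jo \<noteq> 0" "Je \<noteq> 0" using jac_third_nonzero[OF \<tau>] by (auto simp: Jo_def Je_def)
  \<comment> \<open>Deviations of at most \<delta> at the cuts give coefficients of the Jacobi
    fields with k <= D \<delta>.\<close>
  define D where "D = 1 + 1 / \<bar>Jo\<bar> + 1 / \<bar>Je\<bar>"
  have D: "D \<ge> 1" by (simp add: D_def)
  define \<delta> where "\<delta> = min (min (\<delta>0 / D) (e/2)) (1/4)"
  have \<delta>: "\<delta> > 0" "2 * \<delta> \<le> e" "\<delta> \<le> 1/4" "D * \<delta> \<le> \<delta>0"
  proof -
    show "\<delta> > 0" using \<delta>0 D e by (simp add: \<delta>_def)
    show "2 * \<delta> \<le> e" "\<delta> \<le> 1/4" unfolding \<delta>_def by linarith+
    have "\<delta> \<le> \<delta>0 / D" by (simp add: \<delta>_def)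
    then show "D * \<delta> \<le> \<delta>0" using D by (simp add: pos_le_divide_eq mult.commute)
  qed
  have \<delta>\<delta>0: "\<delta> \<le> \<delta>0" 
  proof -
    have "1 * \<delta> \<le> D * \<delta>" using D \<delta>(1) by (intro mult_right_mono) auto
    then show ?thesis using \<delta>(4) by linarith
  qed
  have main: "2 * \<tau> \<le> integral {0..T} (\<lambda>t. sqrt ((r' t)\<^sup>2 + (r t * \<phi>' t)\<^sup>2))"
    if comp: "arc_competitor \<tau> \<delta> \<kappa> T r r' \<phi> \<phi>'" for T \<kappa> r r' \<phi> \<phi>'
  proof -
    have \<kappa>: "\<kappa> > 0" and T: "T = 2 * \<tau> / \<kappa>" and r: "ac_on 0 T r r'" and \<phi>: "ac_on 0 T \<phi> \<phi>'"
      and close: "\<And>t. t \<in> {0..T} \<Longrightarrow> \<bar>r t - 1\<bar> \<le> \<delta> \<and> \<bar>\<phi> t - (\<kappa> * t - \<tau>)\<bar> \<le> \<delta>"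
      and ends: "r 0 = 1" "r T = 1" "\<phi> 0 = - \<tau>" "\<phi> T = \<tau>"
      and Ia: "((\<lambda>t. (r t)\<^sup>2 * \<phi>' t) has_integral 2 * \<tau>) {0..T}"
      and Ic: "((\<lambda>t. (r t)^3 * cos (\<phi> t) * \<phi>' t) has_integral 2 * sin \<tau>) {0..T}"
      and Is: "((\<lambda>t. (r t)^3 * sin (\<phi> t) * \<phi>' t) has_integral 0) {0..T}"
      using comp unfolding arc_competitor_def by blast+
    have T0: "T > 0" using T \<kappa> \<tau>0 by simp
    have \<kappa>T: "\<kappa> * T = 2 * \<tau>" using T \<kappa> by simp
    have c\<phi>: "continuous_on {0..T} \<phi>" using ac_on_continuous[OF \<phi>] .
    \<comment> \<open>The angle may pass through the two cut values several times. Any passage will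
      do; the second is sought after the first, so that the times are ordered.\<close>
    obtain t1 where t1: "0 \<le> t1" "t1 \<le> T" "\<phi> t1 = - (\<tau>/3)"
      using IVT'[of \<phi> 0 "- (\<tau>/3)" T] ends \<tau>0 T0 c\<phi> by auto
    have c\<phi>2: "continuous_on {t1..T} \<phi>" using c\<phi> t1 by (auto intro: continuous_on_subset)
    obtain t2 where t2: "t1 \<le> t2" "t2 \<le> T" "\<phi> t2 = \<tau>/3"
      using IVT'[of \<phi> t1 "\<tau>/3" T] ends \<tau>0 t1 c\<phi>2 by auto
    \<comment> \<open>Half the difference and half the sum of the deviations at the cuts: as the
      cuts are symmetric, the odd and the even field interpolate them separately.\<close>
    define k1 where "k1 = ((r t2 - 1) - (r t1 - 1)) / (2 * Jo)"
    define k2 where "k2 = ((r t2 - 1) + (r t1 - 1)) / (2 * Je)"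
    define k where "k = \<bar>k1\<bar> + \<bar>k2\<bar>"
    have cl1: "\<bar>r t1 - 1\<bar> \<le> \<delta>" "\<bar>r t2 - 1\<bar> \<le> \<delta>" using close t1 t2 by auto
    have k: "0 \<le> k" "k \<le> \<delta>0"
    proof -
      have "\<bar>(r t2 - 1) - (r t1 - 1)\<bar> \<le> 2 * \<delta>" "\<bar>(r t2 - 1) + (r t1 - 1)\<bar> \<le> 2 * \<delta>" using cl1 by linarith+
      then have "\<bar>k1\<bar> \<le> 2 * \<delta> / (2 * \<bar>Jo\<bar>)" "\<bar>k2\<bar> \<le> 2 * \<delta> / (2 * \<bar>Je\<bar>)"
        unfolding k1_def k2_def abs_divide abs_mult abs_numeral by (intro divide_right_mono; simp)+
      then have "k \<le> \<delta> / \<bar>Jo\<bar> + \<delta> / \<bar>Je\<bar>" by (simp add: k_def)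
      also have "\<dots> \<le> D * \<delta>" using \<delta> by (simp add: D_def algebra_simps)
      finally show "k \<le> \<delta>0" using \<delta> by simp
    qed (simp add: k_def)
    define h where "h s = k1 * jac_odd \<tau> s + k2 * jac_even \<tau> s" for s
    define hp where "hp s = k1 * jac_odd' \<tau> s + k2 * jac_even' s" for s
    \<comment> \<open>The equation - h'' - h = \<mu> + \<rho> dictates the multipliers: the constant
      belongs to the area, the coefficients of sin and cos to the two moments.\<close>
    define mu where "mu = k2 * (\<tau> * sin \<tau>)"
    define rho where "rho s = k1 * (2 * sin \<tau> * sin s) + k2 * (- 2 * cos s)" for s
    \<comment> \<open>A primitive of the derivative that the calibration requires. The term with h
      hp is the boundary term of the integration by parts; after it only -1/2 times the integral of
      (\<mu> + \<rho>) h is left, and that is expressed by the three primitives.\<close>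
    define A where "A s = s/2 - mu * s / 2 - (k1 * (- 2 * sin \<tau> * cos s) + k2 * (- 2 * sin s)) / 3 + h s * hp s / 2
      - (k1\<^sup>2 * odd_prim \<tau> s + k1 * k2 * mixed_prim \<tau> s + k2\<^sup>2 * even_prim \<tau> s) / 2" for s
    have hd: "(h has_real_derivative hp s) (at s)" for s
      unfolding h_def hp_def by (auto intro!: derivative_eq_intros jac_odd_deriv jac_even_deriv)
    have hpd: "(hp has_real_derivative - h s - (mu + rho s)) (at s)" for s
      unfolding hp_def h_def mu_def rho_def
      by (auto intro!: derivative_eq_intros jac_odd'_deriv jac_even'_deriv[where \<tau>=\<tau>] simp: algebra_simps)
    have Ad: "(A has_real_derivative 1/2 - mu/2 - rho s/3 + ((hp s)\<^sup>2 - (h s)\<^sup>2)/2 - (mu + rho s) * h s) (at s)" for s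
    proof -
      have d: "(A has_real_derivative 1/2 - mu/2 - (k1 * (2 * sin \<tau> * sin s) + k2 * (- 2 * cos s)) / 3
        + (hp s * hp s + (- h s - (mu + rho s)) * h s) / 2 - (k1\<^sup>2 * (2 * sin \<tau> * sin s * jac_odd \<tau> s)
        + k1 * k2 * (2 * sin \<tau> * sin s * jac_even \<tau> s + (\<tau> * sin \<tau> - 2 * cos s) * jac_odd \<tau> s)
        + k2\<^sup>2 * ((\<tau> * sin \<tau> - 2 * cos s) * jac_even \<tau> s)) / 2) (at s)"
        unfolding A_def
        by (auto intro!: derivative_eq_intros hd hpd odd_prim_deriv mixed_prim_deriv even_prim_deriv simp: field_simps)
      have e1: "k1\<^sup>2 * (2 * sin \<tau> * sin s * jac_odd \<tau> s)
        + k1 * k2 * (2 * sin \<tau> * sin s * jac_even \<tau> s + (\<tau> * sin \<tau> - 2 * cos s) * jac_odd \<tau> s)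
        + k2\<^sup>2 * ((\<tau> * sin \<tau> - 2 * cos s) * jac_even \<tau> s) = (mu + rho s) * h s"
        unfolding mu_def rho_def h_def by (simp add: algebra_simps power2_eq_square)
      have e2: "k1 * (2 * sin \<tau> * sin s) + k2 * (- 2 * cos s) = rho s" by (simp add: rho_def)
      show ?thesis
        by (rule DERIV_cong[OF d[unfolded e1 e2]]) (simp add: field_simps power2_eq_square)
    qed
    have hend: "h \<tau> = 0" "h (- \<tau>) = 0" by (auto simp: h_def)
    have h1: "h (- (\<tau>/3)) = r t1 - 1" and h2: "h (\<tau>/3) = r t2 - 1"
      using J unfolding h_def k1_def k2_def jac_minus Jo_def[symmetric] Je_def[symmetric]
      by (simp_all add: field_simps)
    define M where "M = sqrt (1 + \<theta> * k\<^sup>2)"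
    have M2: "M\<^sup>2 = 1 + \<theta> * k\<^sup>2" and M0: "M \<ge> 0" using \<theta> by (auto simp: M_def)
    define w where "w t = (1 + mu) * ((r t)\<^sup>2 * \<phi>' t) / 2 + rho (\<phi> t) * ((r t)^3 * \<phi>' t) / 3" for t
    \<comment> \<open>The constraints enter here: they make the multiplier integral depend on the
      competitor only through k2.\<close>
    have wint: "(w has_integral ((1 + mu) * \<tau> - 4 * k2 * sin \<tau> / 3)) {0..T}"
    proof -
      have "((\<lambda>t. (1 + mu) / 2 * ((r t)\<^sup>2 * \<phi>' t) + (2 * k1 * sin \<tau> / 3 * ((r t)^3 * sin (\<phi> t) * \<phi>' t)
         + (- 2 * k2 / 3) * ((r t)^3 * cos (\<phi> t) * \<phi>' t))) has_integral
         ((1 + mu) / 2 * (2 * \<tau>) + (2 * k1 * sin \<tau> / 3 * 0 + (- 2 * k2 / 3) * (2 * sin \<tau>)))) {0..T}"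
        by (intro has_integral_add has_integral_mult_right Ia Is Ic)
      then show ?thesis
      proof (rule has_integral_eq_rhs[OF has_integral_eq, rotated])
        show "(1 + mu) * \<tau> - 4 * k2 * sin \<tau> / 3 = (1 + mu) / 2 * (2 * \<tau>) + (2 * k1 * sin \<tau> / 3 * 0 + (- 2 * k2 / 3) * (2 * sin \<tau>))"
          by (simp add: field_simps)
      qed (simp add: w_def rho_def field_simps)
    qed
    define L where "L a b = integral {a..b} (\<lambda>t. sqrt ((r' t)\<^sup>2 + (r t * \<phi>' t)\<^sup>2))" for a b
    define W where "W a b = integral {a..b} w" for a b
    have piece: "A (\<phi> b) - A (\<phi> a) + W a b \<le> M * L a b"
      if ab: "0 \<le> a" "a \<le> b" "b \<le> T" and en: "r a = 1 + h (\<phi> a)" "r b = 1 + h (\<phi> b)"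
        and rng: "\<And>t. t \<in> {a..b} \<Longrightarrow> \<bar>\<phi> t - m\<bar> \<le> \<tau>/3 + 2 * \<delta>" for a b m
      unfolding L_def
    proof (rule calibration_piece[where A=A and \<phi>=\<phi> and a=a and b=b and h=h and hp=hp and mu=mu and rho=rho and K=K and m=m])
      show "ac_on a b r r'" "ac_on a b \<phi> \<phi>'" using r \<phi> ab by (auto intro: ac_on_subinterval)
      show "a \<le> b" "r a = 1 + h (\<phi> a)" "r b = 1 + h (\<phi> b)" "M \<ge> 0" by fact+
      show "continuous_on UNIV rho" unfolding rho_def by (intro continuous_intros)
      have "w integrable_on {a..b}" using wint ab by (meson has_integral_integrable integrable_on_subinterval atLeastatMost_subset_iff)
      then show "((\<lambda>t. (1 + mu) * ((r t)\<^sup>2 * \<phi>' t) / 2 + rho (\<phi> t) * ((r t)^3 * \<phi>' t) / 3) has_integral W a b) {a..b}"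
        by (simp add: W_def has_integral_integrable_integral w_def[abs_def])
      fix t assume t: "t \<in> {a..b}"
      have t': "t \<in> {0..T}" using t ab by auto
      show "r t > 0" using close[OF t'] \<delta> by linarith
      have tb: "cos (K * (\<phi> t - m)) > 0 \<and> \<bar>K * tan (K * (\<phi> t - m))\<bar> \<le> N0"
        by (rule tanb) (use rng[OF t] \<delta> in linarith)
      then show "cos (K * (\<phi> t - m)) > 0" by simp
      fix g s P assume g: "g = r t - 1 - h (\<phi> t)" and s: "s = hp (\<phi> t) - K * tan (K * (\<phi> t - m)) * g"
        and P: "P = r t - s\<^sup>2/2 - (K\<^sup>2 - 1) * g\<^sup>2/2 + mu * (r t - 1)\<^sup>2/2 + rho (\<phi> t) * (r t - 1)\<^sup>2 + rho (\<phi> t) * (r t - 1)^3/3"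
      have "0 \<le> \<kappa> * t" "\<kappa> * t \<le> \<kappa> * T" using t' \<kappa> by (auto intro: mult_left_mono)
      then have \<phi>6: "\<bar>\<phi> t\<bar> \<le> 6" using close[OF t'] \<kappa>T \<tau>5 \<delta> by (simp only: abs_le_iff) linarith
      note jb = jac_bounds[OF \<phi>6, of \<tau>]
      have N13: "13 * k \<le> N * k" using N k by (intro mult_right_mono) auto
      have "P\<^sup>2 + (1 + (r t - 1))\<^sup>2 * s\<^sup>2 \<le> (1 + (r t - 1))\<^sup>2 * (1 + \<theta> * k\<^sup>2)"
      proof (rule pw[where h="h (\<phi> t)" and hp="hp (\<phi> t)" and mu=mu and rho="rho (\<phi> t)" and c="- (K * tan (K * (\<phi> t - m)))" and g=g and s=s and P=P])
        show "\<bar>r t - 1\<bar> \<le> \<delta>0" using close[OF t'] \<delta>\<delta>0 by linarith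
        show "\<bar>h (\<phi> t)\<bar> \<le> N * k" "\<bar>hp (\<phi> t)\<bar> \<le> N * k"
          using jac_combination_bound[of "jac_odd \<tau> (\<phi> t)" "jac_even \<tau> (\<phi> t)" k1 k2]
            jac_combination_bound[of "jac_odd' \<tau> (\<phi> t)" "jac_even' (\<phi> t)" k1 k2] jb \<tau>0 \<tau>5 N13
          by (auto simp: h_def hp_def k_def)
        show "\<bar>mu\<bar> \<le> N * k"
          using jac_combination_bound[of 0 "\<tau> * sin \<tau>" k1 k2] jb \<tau>0 \<tau>5 N13 by (auto simp: mu_def k_def)
        have "\<bar>sin \<tau> * sin (\<phi> t)\<bar> \<le> 1 * 1" unfolding abs_mult by (intro mult_mono) auto
        then have "\<bar>2 * sin \<tau> * sin (\<phi> t)\<bar> \<le> 13" by (simp add: abs_mult)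
        moreover have "\<bar>- 2 * cos (\<phi> t)\<bar> \<le> 13" 
          using cos_le_one[of "\<phi> t"] cos_ge_minus_one[of "\<phi> t"] by (simp only: abs_le_iff) linarith
        ultimately show "\<bar>rho (\<phi> t)\<bar> \<le> N * k"
          using jac_combination_bound[of "2 * sin \<tau> * sin (\<phi> t)" "- 2 * cos (\<phi> t)" k1 k2] N13
          by (simp add: rho_def k_def)
        show "\<bar>- (K * tan (K * (\<phi> t - m)))\<bar> \<le> N" using tb N by simp
        show "0 \<le> k" "k \<le> \<delta>0" "g = r t - 1 - h (\<phi> t)" by fact+
        show "s = hp (\<phi> t) + - (K * tan (K * (\<phi> t - m))) * g" using s by simp
        show "P = 1 + (r t - 1) - s\<^sup>2/2 - (K\<^sup>2 - 1) * g\<^sup>2/2 + mu * (r t - 1)\<^sup>2/2 + rho (\<phi> t) * (r t - 1)\<^sup>2 + rho (\<phi> t) * (r t - 1)^3/3"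
          using P by simp
      qed
      then show "P\<^sup>2 + (r t)\<^sup>2 * s\<^sup>2 \<le> (r t)\<^sup>2 * M\<^sup>2" by (simp add: M2)
    qed (use hd hpd Ad in auto)
    have mono: "\<kappa> * s \<le> \<kappa> * t" if "s \<le> t" for s t using that \<kappa> by simp
    \<comment> \<open>Although the angle itself need not be monotone, that of the reference arc is,
      and the two differ by at most \<delta>. Hence the angle stays within 2 \<delta> of its third
      of the arc. The other two pieces are treated alike.\<close>
    have b1: "A (\<phi> t1) - A (\<phi> 0) + W 0 t1 \<le> M * L 0 t1"
    proof (rule piece[where m="- (2 * \<tau> / 3)"])
      fix t assume t: "t \<in> {0..t1}"
      have "\<bar>\<phi> t - (\<kappa> * t - \<tau>)\<bar> \<le> \<delta>" "\<bar>\<phi> t1 - (\<kappa> * t1 - \<tau>)\<bar> \<le> \<delta>"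
        by (rule close[THEN conjunct2]; use t t1 in simp)+
      moreover have "\<kappa> * 0 \<le> \<kappa> * t" "\<kappa> * t \<le> \<kappa> * t1" by (rule mono; use t in simp)+
      ultimately show "\<bar>\<phi> t - - (2 * \<tau> / 3)\<bar> \<le> \<tau>/3 + 2 * \<delta>"
        using t1(3) \<delta>(1) unfolding abs_le_iff by linarith
    qed (use t1 h1 hend ends in auto)
    have b2: "A (\<phi> t2) - A (\<phi> t1) + W t1 t2 \<le> M * L t1 t2"
    proof (rule piece[where m=0])
      fix t assume t: "t \<in> {t1..t2}"
      have "\<bar>\<phi> t - (\<kappa> * t - \<tau>)\<bar> \<le> \<delta>" "\<bar>\<phi> t1 - (\<kappa> * t1 - \<tau>)\<bar> \<le> \<delta>" "\<bar>\<phi> t2 - (\<kappa> * t2 - \<tau>)\<bar> \<le> \<delta>"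
        by (rule close[THEN conjunct2]; use t t1 t2 in simp)+
      moreover have "\<kappa> * t1 \<le> \<kappa> * t" "\<kappa> * t \<le> \<kappa> * t2" by (rule mono; use t in simp)+
      ultimately show "\<bar>\<phi> t - 0\<bar> \<le> \<tau>/3 + 2 * \<delta>"
        using t1(3) t2(3) \<delta>(1) unfolding abs_le_iff by linarith
    qed (use t1 t2 h1 h2 in auto)
    have b3: "A (\<phi> T) - A (\<phi> t2) + W t2 T \<le> M * L t2 T"
    proof (rule piece[where m="2 * \<tau> / 3"])
      fix t assume t: "t \<in> {t2..T}"
      have "\<bar>\<phi> t - (\<kappa> * t - \<tau>)\<bar> \<le> \<delta>" "\<bar>\<phi> t2 - (\<kappa> * t2 - \<tau>)\<bar> \<le> \<delta>"
        by (rule close[THEN conjunct2]; use t t1 t2 in simp)+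
      moreover have "\<kappa> * t2 \<le> \<kappa> * t" "\<kappa> * t \<le> \<kappa> * T" by (rule mono; use t in simp)+
      ultimately show "\<bar>\<phi> t - 2 * \<tau> / 3\<bar> \<le> \<tau>/3 + 2 * \<delta>"
        using t2(3) \<kappa>T \<delta>(1) unfolding abs_le_iff by linarith
    qed (use t1 t2 h2 hend ends in auto)
    have sum3: "integral {0..t1} u + integral {t1..t2} u + integral {t2..T} u = integral {0..T} u"
      if u: "u integrable_on {0..T}" for u :: "real \<Rightarrow> real"
    proof -
      have "u integrable_on {0..t2}" using u t1 t2 by (meson integrable_on_subinterval atLeastatMost_subset_iff order_refl)
      then have "integral {0..t1} u + integral {t1..t2} u = integral {0..t2} u"
        using t1 t2 by (intro Henstock_Kurzweil_Integration.integral_combine) auto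
      moreover have "integral {0..t2} u + integral {t2..T} u = integral {0..T} u"
        using t1 t2 u by (intro Henstock_Kurzweil_Integration.integral_combine) auto
      ultimately show ?thesis by simp
    qed
    have W3: "W 0 t1 + W t1 t2 + W t2 T = (1 + mu) * \<tau> - 4 * k2 * sin \<tau> / 3"
      unfolding W_def using sum3[of w] wint by (simp add: has_integral_integrable_integral)
    have L3: "L 0 t1 + L t1 t2 + L t2 T = L 0 T"
      unfolding L_def by (intro sum3 ac_on_speed_integrable[OF r \<phi>])
    have "A \<tau> - A (- \<tau>) + ((1 + mu) * \<tau> - 4 * k2 * sin \<tau> / 3) \<le> M * L 0 T"
    proof -
      have "A \<tau> - A (- \<tau>) + (W 0 t1 + W t1 t2 + W t2 T) \<le> M * L 0 t1 + M * L t1 t2 + M * L t2 T"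
        using b1 b2 b3 ends by simp
      also have "\<dots> = M * L 0 T" unfolding L3[symmetric] by (simp add: algebra_simps)
      finally show ?thesis unfolding W3 .
    qed
    \<comment> \<open>The terms of first order in k2 cancel against \<open>W3\<close>; those in k1
      and the cross term disappear by parity.\<close>
    moreover have "A \<tau> - A (- \<tau>) = \<tau> - mu * \<tau> + 4 * k2 * sin \<tau> / 3 - (k1\<^sup>2 * Qo + k2\<^sup>2 * Qe) / 2"
      unfolding A_def Qo_def Qe_def by (simp add: hend field_simps)
    ultimately have low: "2 * \<tau> - (k1\<^sup>2 * Qo + k2\<^sup>2 * Qe) / 2 \<le> M * L 0 T"
      by (simp add: algebra_simps)
    have Q: "k1\<^sup>2 * Qo + k2\<^sup>2 * Qe \<le> - (q0 * k\<^sup>2 / 2)"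
    proof -
      have "k1\<^sup>2 * Qo + k2\<^sup>2 * Qe \<le> k1\<^sup>2 * (- q0) + k2\<^sup>2 * (- q0)" using q0 by (intro add_mono mult_left_mono) auto
      also have "\<dots> = - (q0 * (k1\<^sup>2 + k2\<^sup>2))" by (simp add: algebra_simps)
      also have "\<dots> \<le> - (q0 * (k\<^sup>2 / 2))"
      proof -
        have "k\<^sup>2 \<le> 2 * (k1\<^sup>2 + k2\<^sup>2)"
          using zero_le_power2[of "\<bar>k1\<bar> - \<bar>k2\<bar>"] by (simp add: k_def power2_sum power2_diff)
        then have "q0 * (k\<^sup>2 / 2) \<le> q0 * (k1\<^sup>2 + k2\<^sup>2)" using q0 by (intro mult_left_mono) auto
        then show ?thesis by simp
      qed
      finally show ?thesis by simp
    qed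
    have M1: "M \<le> 1 + \<theta> * k\<^sup>2"
    proof -
      have "1 * (1 + \<theta> * k\<^sup>2) \<le> (1 + \<theta> * k\<^sup>2) * (1 + \<theta> * k\<^sup>2)" using \<theta> by (intro mult_right_mono) auto
      then show ?thesis unfolding M_def using \<theta> by (intro real_le_lsqrt) (auto simp: power2_eq_square)
    qed
    have L0: "L 0 T \<ge> 0" unfolding L_def by (intro integral_nonneg ac_on_speed_integrable[OF r \<phi>]) auto
    \<comment> \<open>Loss and gain are estimated by the same q0 k^2 / 4. The strict inequality
      comes from the assumed shorter length, so the argument also covers k = 0.\<close>
    show "2 * \<tau> \<le> integral {0..T} (\<lambda>t. sqrt ((r' t)\<^sup>2 + (r t * \<phi>' t)\<^sup>2))"
    proof (rule ccontr)
      assume "\<not> ?thesis"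
      then have less: "L 0 T < 2 * \<tau>" by (simp add: L_def)
      have "M * L 0 T \<le> (1 + \<theta> * k\<^sup>2) * L 0 T" using M1 L0 by (intro mult_right_mono)
      also have "\<dots> < (1 + \<theta> * k\<^sup>2) * (2 * \<tau>)" using less \<theta> by (intro mult_strict_left_mono) (auto intro: add_pos_nonneg)
      also have "\<dots> = 2 * \<tau> + q0 * k\<^sup>2 / 4" using \<tau>0 by (simp add: \<theta>_def field_simps)
      finally have up: "M * L 0 T < 2 * \<tau> + q0 * k\<^sup>2 / 4" .
      have contr: False if "m < t + y / 4" "t - x / 2 \<le> m" "x \<le> - (y / 2)" for m t x y :: real
        using that by linarith
      show False by (rule contr[OF up low Q])
    qed
  qed
  then show ?thesis using \<delta>(1) by blast
qed

section \<open>Shortening arcs beyond the conjugate angle\<close>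

lemma integral_odd_zero:
  fixes f :: "real \<Rightarrow> real"
  assumes "\<And>x. f (- x) = - f x"
  shows "integral {-a..a} f = 0"
proof -
  have "integral {-a..a} (\<lambda>x. f (- x)) = integral {-a..a} f"
    using Henstock_Kurzweil_Integration.integral_reflect_real[of a "-a" f] by simp
  then show ?thesis by (simp add: assms)
qed

lemma ftc_symmetric:
  fixes G g :: "real \<Rightarrow> real"
  assumes "\<And>s. (G has_real_derivative g s) (at s)" "0 \<le> a"
  shows "(g has_integral G a - G (- a)) {-a..a}"
  using assms by (intro fundamental_theorem_of_calculus)
    (auto simp: has_real_derivative_iff_has_vector_derivative intro: has_vector_derivative_at_within)

text \<open>The orthogonality to \<open>sin\<close> makes the second variation of the combination below equal to
  that of the cubic minus a positive term: an odd Jacobi field with vanishing end values is itself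
  orthogonal to \<open>sin\<close> only at the conjugate angle.\<close>

lemma negative_odd_variation:
  assumes \<tau>: "5 * pi / 4 \<le> \<tau>" "\<tau> < 3 * pi / 2" and pos: "conj_fun \<tau> > 0"
  shows "\<exists>F F'. (\<forall>s::real. (F has_real_derivative F' s) (at s)) \<and> continuous_on UNIV F' \<and>
    (\<forall>s. F (- s) = - F s) \<and> (\<forall>s. F' (- s) = F' s) \<and> F \<tau> = 0 \<and>
    integral {-\<tau>..\<tau>} (\<lambda>s. F s * sin s) = 0 \<and>
    integral {-\<tau>..\<tau>} (\<lambda>s. (F' s)\<^sup>2) < integral {-\<tau>..\<tau>} (\<lambda>s. (F s)\<^sup>2)"
proof -
  have \<tau>3: "\<tau> > 15/4" using \<tau> pi_approx by simp
  have S: "sin \<tau> < 0" using sin_cos_third_quadrant[OF \<tau>] by simp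
  \<comment> \<open>The odd cubic with zeros 0 and \<plusminus>\<tau>. Its second variation 8/5
    \<tau>^5 - 16/105 \<tau>^7 is negative as soon as \<tau>^2 > 21/2.\<close>
  define F0 where "F0 s = s * (\<tau>\<^sup>2 - s\<^sup>2)" for s
  define F0' where "F0' s = \<tau>\<^sup>2 - 3 * s\<^sup>2" for s
  define I0 where "I0 = integral {-\<tau>..\<tau>} (\<lambda>s. F0 s * sin s)"
  define J where "J = - conj_fun \<tau> / 2"
  \<comment> \<open>Chosen to cancel the sin moment of the cubic. The denominator J is the sin
    moment of the odd Jacobi field and is negative beyond the conjugate angle.\<close>
  define l where "l = I0 / J"
  have J: "J < 0" using pos by (simp add: J_def)
  have cj: "continuous_on A (jac_odd \<tau>)" "continuous_on A (jac_odd' \<tau>)" for A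
    unfolding jac_odd_def[abs_def] jac_odd'_def[abs_def] by (intro continuous_intros)+
  have c0: "continuous_on A F0" "continuous_on A F0'" for A
    unfolding F0_def[abs_def] F0'_def[abs_def] by (intro continuous_intros)+
  have d0: "(F0 has_real_derivative F0' s) (at s)" for s
    unfolding F0_def F0'_def by (auto intro!: derivative_eq_intros simp: power2_eq_square)
  have hI0: "((\<lambda>s. F0 s * sin s) has_integral I0) {-\<tau>..\<tau>}"
    unfolding I0_def by (intro integrable_integral integrable_continuous_real continuous_intros c0)
  have hJ: "((\<lambda>s. jac_odd \<tau> s * sin s) has_integral J) {-\<tau>..\<tau>}"
  proof -
    have "((\<lambda>s. 2 * sin \<tau> * sin s * jac_odd \<tau> s) has_integral (- sin \<tau> * conj_fun \<tau>)) {-\<tau>..\<tau>}"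
      using ftc_symmetric[OF odd_prim_deriv, of \<tau> \<tau>] \<tau>3 by (simp add: odd_prim_diff)
    from has_integral_mult_right[OF this, of "1 / (2 * sin \<tau>)"]
    show ?thesis using S by (simp add: J_def field_simps)
  qed
  define F where "F s = F0 s - l * jac_odd \<tau> s" for s
  define F' where "F' s = F0' s - l * jac_odd' \<tau> s" for s
  have dF: "(F has_real_derivative F' s) (at s)" for s
    unfolding F_def F'_def by (auto intro!: derivative_eq_intros d0 jac_odd_deriv)
  have cF: "continuous_on A F" "continuous_on A F'" for A
    unfolding F_def[abs_def] F'_def[abs_def] by (intro continuous_intros c0 cj)+
  have orth: "integral {-\<tau>..\<tau>} (\<lambda>s. F s * sin s) = 0"
  proof (rule integral_unique)
    have "((\<lambda>s. F0 s * sin s - l * (jac_odd \<tau> s * sin s)) has_integral (I0 - l * J)) {-\<tau>..\<tau>}"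
      by (intro has_integral_diff has_integral_mult_right hI0 hJ)
    then show "((\<lambda>s. F s * sin s) has_integral 0) {-\<tau>..\<tau>}"
      using J by (simp add: F_def l_def algebra_simps)
  qed
  have q0: "((\<lambda>s. (F0' s)\<^sup>2 - (F0 s)\<^sup>2) has_integral (8/5 * \<tau>^5 - 16/105 * \<tau>^7)) {-\<tau>..\<tau>}"
  proof -
    have "((\<lambda>s. \<tau>^4 * s - 2 * \<tau>\<^sup>2 * s^3 + 9/5 * s^5 - (\<tau>^4 * s^3 / 3 - 2/5 * \<tau>\<^sup>2 * s^5 + s^7/7))
       has_real_derivative ((F0' s)\<^sup>2 - (F0 s)\<^sup>2)) (at s)" for s
    proof -
      have "((\<lambda>s. \<tau>^4 * s - 2 * \<tau>\<^sup>2 * s^3 + 9/5 * s^5 - (\<tau>^4 * s^3 / 3 - 2/5 * \<tau>\<^sup>2 * s^5 + s^7/7))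
       has_real_derivative (\<tau>^4 - 6 * \<tau>\<^sup>2 * s^2 + 9 * s^4 - (\<tau>^4 * s^2 - 2 * \<tau>\<^sup>2 * s^4 + s^6))) (at s)"
        by (auto intro!: derivative_eq_intros)
      moreover have "\<tau>^4 - 6 * \<tau>\<^sup>2 * s^2 + 9 * s^4 - (\<tau>^4 * s^2 - 2 * \<tau>\<^sup>2 * s^4 + s^6) = (F0' s)\<^sup>2 - (F0 s)\<^sup>2"
        unfolding F0_def F0'_def by algebra
      ultimately show ?thesis by simp
    qed
    note ftc_symmetric[OF this, of \<tau>]
    from has_integral_eq_rhs[OF this] show ?thesis
      using \<tau>3 by (simp add: power_numeral_reduce field_simps)
  qed
  \<comment> \<open>The cubic vanishes at both ends and the odd field solves h'' + h = - 2 sin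
    \<tau> sin s, so the mixed form reduces to the sin moment of the cubic. \<open>q2\<close> is the
    same computation with the field in place of the cubic.\<close>
  have q1: "((\<lambda>s. F0' s * jac_odd' \<tau> s - F0 s * jac_odd \<tau> s) has_integral (2 * sin \<tau> * I0)) {-\<tau>..\<tau>}"
  proof -
    have "((\<lambda>s. F0 s * jac_odd' \<tau> s) has_real_derivative
        (F0' s * jac_odd' \<tau> s - F0 s * jac_odd \<tau> s - 2 * sin \<tau> * (F0 s * sin s))) (at s)" for s
      by (auto intro!: derivative_eq_intros d0 jac_odd'_deriv simp: algebra_simps)
    from has_integral_add[OF ftc_symmetric[OF this, of \<tau>] has_integral_mult_right[OF hI0, of "2 * sin \<tau>"]]
    show ?thesis using \<tau>3 by (simp add: F0_def)
  qed
  have q2: "((\<lambda>s. (jac_odd' \<tau> s)\<^sup>2 - (jac_odd \<tau> s)\<^sup>2) has_integral (2 * sin \<tau> * J)) {-\<tau>..\<tau>}"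
  proof -
    have "((\<lambda>s. jac_odd \<tau> s * jac_odd' \<tau> s) has_real_derivative
        ((jac_odd' \<tau> s)\<^sup>2 - (jac_odd \<tau> s)\<^sup>2 - 2 * sin \<tau> * (jac_odd \<tau> s * sin s))) (at s)" for s
      by (auto intro!: derivative_eq_intros jac_odd_deriv jac_odd'_deriv simp: algebra_simps power2_eq_square)
    from has_integral_add[OF ftc_symmetric[OF this, of \<tau>] has_integral_mult_right[OF hJ, of "2 * sin \<tau>"]]
    show ?thesis using \<tau>3 by simp
  qed
  have "((\<lambda>s. ((F0' s)\<^sup>2 - (F0 s)\<^sup>2) - 2 * l * (F0' s * jac_odd' \<tau> s - F0 s * jac_odd \<tau> s)
       + l\<^sup>2 * ((jac_odd' \<tau> s)\<^sup>2 - (jac_odd \<tau> s)\<^sup>2)) has_integral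
       ((8/5 * \<tau>^5 - 16/105 * \<tau>^7) - 2 * l * (2 * sin \<tau> * I0) + l\<^sup>2 * (2 * sin \<tau> * J))) {-\<tau>..\<tau>}"
    by (intro has_integral_add has_integral_diff has_integral_mult_right q0 q1 q2)
  moreover have "((F0' s)\<^sup>2 - (F0 s)\<^sup>2) - 2 * l * (F0' s * jac_odd' \<tau> s - F0 s * jac_odd \<tau> s)
       + l\<^sup>2 * ((jac_odd' \<tau> s)\<^sup>2 - (jac_odd \<tau> s)\<^sup>2) = (F' s)\<^sup>2 - (F s)\<^sup>2" for s
    unfolding F_def F'_def by algebra
  ultimately have Q: "integral {-\<tau>..\<tau>} (\<lambda>s. (F' s)\<^sup>2 - (F s)\<^sup>2)
      = (8/5 * \<tau>^5 - 16/105 * \<tau>^7) - 2 * l * (2 * sin \<tau> * I0) + l\<^sup>2 * (2 * sin \<tau> * J)"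
    by (simp add: integral_unique)
  have "I0 = l * J" using J by (simp add: l_def)
  \<comment> \<open>Substituting I0 = l J leaves - 2 l^2 sin \<tau> J, and sin \<tau> and J are both
    negative.\<close>
  then have "- 2 * l * (2 * sin \<tau> * I0) + l\<^sup>2 * (2 * sin \<tau> * J) = - (2 * l\<^sup>2 * (sin \<tau> * J))"
    by (simp add: power2_eq_square)
  also have "\<dots> \<le> 0" using S J by (simp add: mult_nonneg_nonneg mult_nonpos_nonpos)
  finally have "- 2 * l * (2 * sin \<tau> * I0) + l\<^sup>2 * (2 * sin \<tau> * J) \<le> 0" .
  moreover have "8/5 * \<tau>^5 - 16/105 * \<tau>^7 < 0"
  proof -
    have "(15/4)\<^sup>2 < \<tau>\<^sup>2" using \<tau>3 by (intro power_strict_mono) auto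
    then have "8/5 - 16/105 * \<tau>\<^sup>2 < 0" by (simp add: power2_eq_square)
    then have "\<tau>^5 * (8/5 - 16/105 * \<tau>\<^sup>2) < 0" using \<tau>3 by (intro mult_pos_neg) auto
    then show ?thesis by (simp add: algebra_simps power_numeral_reduce)
  qed
  ultimately have "integral {-\<tau>..\<tau>} (\<lambda>s. (F' s)\<^sup>2 - (F s)\<^sup>2) < 0" using Q by linarith
  then have lt: "integral {-\<tau>..\<tau>} (\<lambda>s. (F' s)\<^sup>2) < integral {-\<tau>..\<tau>} (\<lambda>s. (F s)\<^sup>2)"
    by (subst (asm) integral_diff) (auto intro!: integrable_continuous_real continuous_intros cF)
  have par: "F (- s) = - F s" "F' (- s) = F' s" for s
    by (auto simp: F_def F'_def F0_def F0'_def jac_odd'_def algebra_simps)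
  have "F \<tau> = 0" by (simp add: F_def F0_def)
  then show ?thesis using dF cF(2) par orth lt by blast
qed

text \<open>The odd perturbation changes the area at second order only, and the repair has to move
  the area without disturbing the moments. For an even function the sin moment vanishes by parity;
  the cos moment is killed by mixing two even functions that vanish at \<plusminus>\<tau>.\<close>

lemma area_correction:
  assumes \<tau>: "5 * pi / 4 \<le> \<tau>" "\<tau> < 3 * pi / 2"
  shows "\<exists>\<psi> \<psi>'. (\<forall>s::real. (\<psi> has_real_derivative \<psi>' s) (at s)) \<and> continuous_on UNIV \<psi>' \<and>
    (\<forall>s. \<psi> (- s) = \<psi> s) \<and> (\<forall>s. \<psi>' (- s) = - \<psi>' s) \<and> \<psi> \<tau> = 0 \<and>
    integral {-\<tau>..\<tau>} (\<lambda>s. \<psi> s * cos s) = 0 \<and> integral {-\<tau>..\<tau>} \<psi> > 0"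
proof -
  define S C where "S = sin \<tau>" and "C = cos \<tau>"
  have SC: "S < 0" "C < 0" "S\<^sup>2 \<ge> 1/2" unfolding S_def C_def using sin_cos_third_quadrant[OF \<tau>] by auto
  have S1: "S\<^sup>2 \<le> 1" "S * C \<ge> 0" "S * C \<le> 1"
  proof -
    show "S\<^sup>2 \<le> 1" by (simp add: S_def abs_square_le_1)
    show "S * C \<ge> 0" using SC by (simp add: mult_nonpos_nonpos)
    have "\<bar>S\<bar> * \<bar>C\<bar> \<le> 1 * 1" unfolding S_def C_def by (intro mult_mono) auto
    then show "S * C \<le> 1" using SC by simp
  qed
  have \<tau>3: "\<tau> > 3" using \<tau> pi_gt3 by linarith
  \<comment> \<open>The cos moments of \<open>jac_even\<close> and of cos s - C are -b and a. With a
    and b as the coefficients of these two functions they cancel.\<close>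
  define a where "a = \<tau> - S * C"
  define b where "b = \<tau> / 2 + \<tau> * S\<^sup>2 - S * C / 2"
  have ab: "a \<ge> \<tau> - 1" "b \<le> 3/2 * \<tau>" "b > 0"
  proof -
    show "a \<ge> \<tau> - 1" using S1 by (simp add: a_def)
    have "\<tau> * S\<^sup>2 \<le> \<tau> * 1" using S1 \<tau>3 by (intro mult_left_mono) auto
    then show "b \<le> 3/2 * \<tau>" using S1 unfolding b_def by linarith
    have "\<tau> * S\<^sup>2 \<ge> 0" using \<tau>3 by simp
    then show "b > 0" using S1 \<tau>3 unfolding b_def by linarith
  qed
  define \<psi> where "\<psi> s = a * jac_even \<tau> s + b * (cos s - C)" for s
  define \<psi>' where "\<psi>' s = a * jac_even' s - b * sin s" for s
  have d: "(\<psi> has_real_derivative \<psi>' s) (at s)" for s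
    unfolding \<psi>_def \<psi>'_def by (auto intro!: derivative_eq_intros jac_even_deriv)
  have c: "continuous_on UNIV \<psi>'"
    unfolding \<psi>'_def[abs_def] jac_even'_def by (intro continuous_intros)
  have sq: "cos s * cos s = 1 - sin s * sin s" for s :: real
    using cos_squared_eq[of s] by (simp add: power2_eq_square)
  have "((\<lambda>s. a * (s * (sin s)\<^sup>2 / 2 - s / 4 + sin s * cos s / 4 - \<tau> * S * sin s) + b * (s / 2 + sin s * cos s / 2 - C * sin s))
      has_real_derivative \<psi> s * cos s) (at s)" for s
  proof -
    have "((\<lambda>s. a * (s * (sin s)\<^sup>2 / 2 - s / 4 + sin s * cos s / 4 - \<tau> * S * sin s) + b * (s / 2 + sin s * cos s / 2 - C * sin s))
      has_real_derivative (a * ((sin s)\<^sup>2 / 2 + s * sin s * cos s - 1/4 + (cos s * cos s - sin s * sin s) / 4 - \<tau> * S * cos s)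
        + b * (1/2 + (cos s * cos s - sin s * sin s) / 2 - C * cos s))) (at s)"
      by (auto intro!: derivative_eq_intros simp: power2_eq_square field_simps)
    moreover have "a * ((sin s)\<^sup>2 / 2 + s * sin s * cos s - 1/4 + (cos s * cos s - sin s * sin s) / 4 - \<tau> * S * cos s)
        + b * (1/2 + (cos s * cos s - sin s * sin s) / 2 - C * cos s) = \<psi> s * cos s"
    proof -
      have "\<psi> s * cos s = a * (s * sin s * cos s - \<tau> * S * cos s) + b * (cos s * cos s - C * cos s)"
        by (simp add: \<psi>_def jac_even_def S_def algebra_simps)
      then show ?thesis unfolding power2_eq_square sq by (simp add: field_simps)
    qed
    ultimately show ?thesis by simp
  qed
  from ftc_symmetric[OF this, of \<tau>]
  have "integral {-\<tau>..\<tau>} (\<lambda>s. \<psi> s * cos s) = a * (\<tau> * S\<^sup>2 - \<tau> / 2 + S * C / 2 - 2 * \<tau> * S * S) + b * (\<tau> + S * C - 2 * C * S)"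
    using \<tau>3 by (subst integral_unique) (auto simp: S_def C_def field_simps)
  also have "\<dots> = 0" unfolding a_def b_def by (simp add: field_simps power2_eq_square)
  finally have o: "integral {-\<tau>..\<tau>} (\<lambda>s. \<psi> s * cos s) = 0" .
  have "((\<lambda>s. a * (sin s - s * cos s - \<tau> * S * s) + b * (sin s - C * s)) has_real_derivative \<psi> s) (at s)" for s
    unfolding \<psi>_def jac_even_def by (auto intro!: derivative_eq_intros simp: S_def algebra_simps)
  from ftc_symmetric[OF this, of \<tau>]
  have "integral {-\<tau>..\<tau>} \<psi> = a * (2 * S - 2 * \<tau> * C - 2 * \<tau>\<^sup>2 * S) + b * (2 * S - 2 * \<tau> * C)"
    using \<tau>3 by (subst integral_unique) (auto simp: S_def C_def algebra_simps power2_eq_square)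
  also have "\<dots> = 2 * (- S) * (a * (\<tau>\<^sup>2 - 1) - b) + 2 * \<tau> * (- C) * (a + b)"
    by (simp add: algebra_simps)
  also have "\<dots> > 0"
  proof -
    have "\<tau>\<^sup>2 > 9" using power_strict_mono[of 3 \<tau> 2] \<tau>3 by simp
    then have "(\<tau> - 1) * 8 \<le> a * (\<tau>\<^sup>2 - 1)" using ab \<tau>3 by (intro mult_mono) auto
    moreover have "x - b > 0" if "(\<tau> - 1) * 8 \<le> x" for x using that ab(2) \<tau>3 by simp
    ultimately have "a * (\<tau>\<^sup>2 - 1) - b > 0" by blast
    then have "2 * (- S) * (a * (\<tau>\<^sup>2 - 1) - b) > 0" using SC by (intro mult_pos_pos) auto
    moreover have "2 * \<tau> * (- C) * (a + b) > 0" using SC ab \<tau>3 by (intro mult_pos_pos) auto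
    ultimately show ?thesis by linarith
  qed
  finally have p: "integral {-\<tau>..\<tau>} \<psi> > 0" .
  have par: "\<psi> (- s) = \<psi> s" "\<psi>' (- s) = - \<psi>' s" for s
    by (auto simp: \<psi>_def \<psi>'_def jac_even'_def algebra_simps)
  have "\<psi> \<tau> = 0" by (simp add: \<psi>_def C_def)
  then show ?thesis using d c par o p by blast
qed

text \<open>Put D = r^3 - 1. Then r^2 = (1 + D)^(2/3) is concave in D and lies below its tangent 1 +
  2 D / 3, and it falls short of the tangent by at most D^2. The two bounds provide the two sides of
  the intermediate value argument for the area.\<close>

lemma cube_bounds:
  fixes r :: real
  assumes "r > 0"
  shows "\<bar>r - 1\<bar> \<le> \<bar>r^3 - 1\<bar>" "r\<^sup>2 \<le> 1 + 2/3 * (r^3 - 1)" "1 + 2/3 * (r^3 - 1) - (r^3 - 1)\<^sup>2 \<le> r\<^sup>2"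
proof -
  define f where "f = r - 1"
  have r: "r = 1 + f" and f: "f > -1" using assms by (auto simp: f_def)
  have e: "r^3 - 1 = f * (3 + 3 * f + f\<^sup>2)" unfolding r by (simp add: algebra_simps power2_eq_square power3_eq_cube)
  have "3 + 3 * f + f\<^sup>2 = (f + 1) * (f + 2) + 1" by (simp add: algebra_simps power2_eq_square)
  moreover have "(f + 1) * (f + 2) > 0" using f by (intro mult_pos_pos) auto
  ultimately have g1: "3 + 3 * f + f\<^sup>2 \<ge> 1" by linarith
  have "\<bar>f\<bar> * 1 \<le> \<bar>f\<bar> * \<bar>3 + 3 * f + f\<^sup>2\<bar>" using g1 by (intro mult_left_mono) auto
  then show "\<bar>r - 1\<bar> \<le> \<bar>r^3 - 1\<bar>" unfolding e by (simp add: r abs_mult)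
  have "1 + 2/3 * (r^3 - 1) - r\<^sup>2 = f\<^sup>2 * (1 + 2/3 * f)"
    unfolding r by (simp add: field_simps power2_eq_square power3_eq_cube)
  note e2 = this
  have "f\<^sup>2 * (1 + 2/3 * f) \<ge> 0" using f by (intro mult_nonneg_nonneg) auto
  then show "r\<^sup>2 \<le> 1 + 2/3 * (r^3 - 1)" using e2 by linarith
  have "1 + 2/3 * f \<le> (3 + 3 * f + f\<^sup>2)\<^sup>2"
  proof (cases "f \<le> 0")
    case True
    have "1\<^sup>2 \<le> (3 + 3 * f + f\<^sup>2)\<^sup>2" using g1 by (intro power_mono) auto
    then show ?thesis using True by simp
  next
    case False
    have "3 + 3 * f + f\<^sup>2 \<le> (3 + 3 * f + f\<^sup>2) * (3 + 3 * f + f\<^sup>2)"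
      using mult_left_mono[OF g1, of "3 + 3 * f + f\<^sup>2"] g1 by simp
    moreover have "1 + 2/3 * f \<le> 3 + 3 * f + f\<^sup>2" using False by simp
    ultimately show ?thesis by (simp add: power2_eq_square)
  qed
  then have "f\<^sup>2 * (1 + 2/3 * f) \<le> f\<^sup>2 * (3 + 3 * f + f\<^sup>2)\<^sup>2" by (intro mult_left_mono) auto
  also have "\<dots> = (r^3 - 1)\<^sup>2" unfolding e by (simp add: power_mult_distrib)
  finally show "1 + 2/3 * (r^3 - 1) - (r^3 - 1)\<^sup>2 \<le> r\<^sup>2" using e2 by linarith
qed

text \<open>The cube of r is 1 + \<epsilon> F + \<epsilon>^2 k \<psi>. Both moments are right for
  every k, and continuity in k yields one with the right area. At fixed area the length differs from
  2 \<tau> to leading order by half the integral of r'^2 - (r - 1)^2, that is by \<epsilon>^2 / 18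
  times the second variation of F.\<close>

lemma shorter_arc:
  assumes \<tau>: "5 * pi / 4 \<le> \<tau>" "\<tau> < 3 * pi / 2" and pos: "conj_fun \<tau> > 0" and e0: "e > 0"
  shows "\<exists>r r'. (\<forall>s\<in>{-\<tau>..\<tau>}. (r has_real_derivative r' s) (at s) \<and> r s > 0 \<and> \<bar>r s - 1\<bar> < e \<and> \<bar>r' s\<bar> < e) \<and>
    continuous_on {-\<tau>..\<tau>} r' \<and> r \<tau> = 1 \<and> r (- \<tau>) = 1 \<and>
    integral {-\<tau>..\<tau>} (\<lambda>s. (r s)\<^sup>2) = 2 * \<tau> \<and>
    integral {-\<tau>..\<tau>} (\<lambda>s. (r s)^3 * cos s) = 2 * sin \<tau> \<and>
    integral {-\<tau>..\<tau>} (\<lambda>s. (r s)^3 * sin s) = 0 \<and>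
    integral {-\<tau>..\<tau>} (\<lambda>s. sqrt ((r' s)\<^sup>2 + (r s)\<^sup>2)) < 2 * \<tau>"
proof -
  have \<tau>0: "\<tau> > 0" using \<tau> pi_gt3 by linarith
  obtain F F' where dF: "\<And>s. (F has_real_derivative F' s) (at s)" and cF': "continuous_on UNIV F'"
    and parF: "\<And>s. F (- s) = - F s" "\<And>s. F' (- s) = F' s" and F\<tau>: "F \<tau> = 0"
    and Fsin: "integral {-\<tau>..\<tau>} (\<lambda>s. F s * sin s) = 0"
    and Flt: "integral {-\<tau>..\<tau>} (\<lambda>s. (F' s)\<^sup>2) < integral {-\<tau>..\<tau>} (\<lambda>s. (F s)\<^sup>2)"
    using negative_odd_variation[OF \<tau> pos] by blast
  obtain \<psi> \<psi>' where d\<psi>: "\<And>s. (\<psi> has_real_derivative \<psi>' s) (at s)" and c\<psi>': "continuous_on UNIV \<psi>'"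
    and par\<psi>: "\<And>s. \<psi> (- s) = \<psi> s" "\<And>s. \<psi>' (- s) = - \<psi>' s" and \<psi>\<tau>: "\<psi> \<tau> = 0"
    and \<psi>cos: "integral {-\<tau>..\<tau>} (\<lambda>s. \<psi> s * cos s) = 0" and \<psi>pos: "integral {-\<tau>..\<tau>} \<psi> > 0"
    using area_correction[OF \<tau>] by blast
  let ?I = "\<lambda>f. integral {-\<tau>..\<tau>} f :: real"
  have cF: "continuous_on A F" and c\<psi>: "continuous_on A \<psi>" for A
    using dF d\<psi> by (meson DERIV_isCont continuous_at_imp_continuous_on)+
  have cF'A: "continuous_on A F'" and c\<psi>'A: "continuous_on A \<psi>'" for A
    using cF' c\<psi>' continuous_on_subset by blast+
  note cont = cF c\<psi> cF'A c\<psi>'A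
  define a b a1 b1 p where "a = ?I (\<lambda>s. (F' s)\<^sup>2)" and "b = ?I (\<lambda>s. (F s)\<^sup>2)"
    and "a1 = ?I (\<lambda>s. (\<psi>' s)\<^sup>2)" and "b1 = ?I (\<lambda>s. (\<psi> s)\<^sup>2)" and "p = ?I \<psi>"
  have nn: "a \<ge> 0" "b \<ge> 0" "a1 \<ge> 0" "b1 \<ge> 0" and ab: "a < b" and p: "p > 0"
    unfolding a_def b_def a1_def b1_def p_def using Flt \<psi>pos
    by (auto intro!: integral_nonneg integrable_continuous_real continuous_intros cont)
  have hi: "(f has_integral ?I f) {-\<tau>..\<tau>}" if "continuous_on {-\<tau>..\<tau>} f" for f
    using that by (intro integrable_integral integrable_continuous_real)
  have hF2: "((\<lambda>s. (F s)\<^sup>2) has_integral b) {-\<tau>..\<tau>}" and hF'2: "((\<lambda>s. (F' s)\<^sup>2) has_integral a) {-\<tau>..\<tau>}"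
    and h\<psi>2: "((\<lambda>s. (\<psi> s)\<^sup>2) has_integral b1) {-\<tau>..\<tau>}" and h\<psi>'2: "((\<lambda>s. (\<psi>' s)\<^sup>2) has_integral a1) {-\<tau>..\<tau>}"
    and h\<psi>: "(\<psi> has_integral p) {-\<tau>..\<tau>}"
    unfolding a_def b_def a1_def b1_def p_def by (intro hi continuous_intros cont)+
  have hodd: "(f has_integral 0) {-\<tau>..\<tau>}" if "continuous_on {-\<tau>..\<tau>} f" "\<And>x. f (- x) = - f x" for f :: "real \<Rightarrow> real"
    using hi[OF that(1)] integral_odd_zero[of f \<tau>] that(2) by simp
  have hF: "(F has_integral 0) {-\<tau>..\<tau>}" and hFc: "((\<lambda>s. F s * cos s) has_integral 0) {-\<tau>..\<tau>}"
    and hF\<psi>: "((\<lambda>s. F s * \<psi> s) has_integral 0) {-\<tau>..\<tau>}" and hF'\<psi>': "((\<lambda>s. F' s * \<psi>' s) has_integral 0) {-\<tau>..\<tau>}"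
    and h\<psi>s: "((\<lambda>s. \<psi> s * sin s) has_integral 0) {-\<tau>..\<tau>}" and hs: "((\<lambda>s::real. sin s) has_integral 0) {-\<tau>..\<tau>}"
    by (intro hodd continuous_intros cont; simp add: parF par\<psi>)+
  have hFs: "((\<lambda>s. F s * sin s) has_integral 0) {-\<tau>..\<tau>}"
    using hi[of "\<lambda>s. F s * sin s"] Fsin by (simp add: continuous_intros cont)
  have h\<psi>c: "((\<lambda>s. \<psi> s * cos s) has_integral 0) {-\<tau>..\<tau>}"
    using hi[of "\<lambda>s. \<psi> s * cos s"] \<psi>cos by (simp add: continuous_intros cont)
  have hc: "((\<lambda>s::real. cos s) has_integral 2 * sin \<tau>) {-\<tau>..\<tau>}"
    using ftc_symmetric[of sin cos \<tau>] \<tau>0 by simp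
  have h1: "((\<lambda>s::real. 1) has_integral 2 * \<tau>) {-\<tau>..\<tau>}"
    using has_integral_const_real[of "1::real" "-\<tau>" \<tau>] \<tau>0 by simp
  obtain M1 where M1: "\<And>s. s \<in> {-\<tau>..\<tau>} \<Longrightarrow> norm (F s) \<le> M1"
    using compact_imp_bounded[OF compact_continuous_image[OF cF compact_Icc]] unfolding bounded_iff by blast
  obtain M2 where M2: "\<And>s. s \<in> {-\<tau>..\<tau>} \<Longrightarrow> norm (\<psi> s) \<le> M2"
    using compact_imp_bounded[OF compact_continuous_image[OF c\<psi> compact_Icc]] unfolding bounded_iff by blast
  obtain M3 where M3: "\<And>s. s \<in> {-\<tau>..\<tau>} \<Longrightarrow> norm (F' s) \<le> M3"
    using compact_imp_bounded[OF compact_continuous_image[OF cF'A compact_Icc]] unfolding bounded_iff by blast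
  obtain M4 where M4: "\<And>s. s \<in> {-\<tau>..\<tau>} \<Longrightarrow> norm (\<psi>' s) \<le> M4"
    using compact_imp_bounded[OF compact_continuous_image[OF c\<psi>'A compact_Icc]] unfolding bounded_iff by blast
  note M1 = M1[unfolded real_norm_def] and M2 = M2[unfolded real_norm_def]
    and M3 = M3[unfolded real_norm_def] and M4 = M4[unfolded real_norm_def]
  have M: "M1 \<ge> 0" "M2 \<ge> 0" "M3 \<ge> 0" "M4 \<ge> 0" using M1[of 0] M2[of 0] M3[of 0] M4[of 0] \<tau>0 by auto
  \<comment> \<open>Tolerance for setting r = 1 in the coefficients of the second variation: (1 +
    \<eta>) a - (1 - \<eta>) b is still at most -(b - a)/2.\<close>
  define \<eta> where "\<eta> = min (1/2) ((b - a) / (2 * (a + b)))"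
  have \<eta>: "\<eta> > 0" "\<eta> \<le> 1/2" using ab nn by (auto simp: \<eta>_def)
  have \<eta>ab: "\<eta> * (a + b) \<le> (b - a) / 2"
  proof -
    have "\<eta> \<le> (b - a) / (2 * (a + b))" by (simp add: \<eta>_def)
    moreover have "2 * (a + b) > 0" using ab nn by simp
    ultimately have "\<eta> * (2 * (a + b)) \<le> b - a" by (simp only: pos_le_divide_eq)
    then show ?thesis by (simp add: algebra_simps)
  qed
  \<comment> \<open>In terms of D = r^3 - 1 the exact coefficients of D'^2 and D^2 in the length
    estimate are these two functions of r, divided by 18.\<close>
  have "((\<lambda>x::real. 1 / x^5) \<longlongrightarrow> 1) (at 1)" and "((\<lambda>x::real. 9 / (x\<^sup>2 + x + 1)\<^sup>2) \<longlongrightarrow> 1) (at 1)"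
    by (rule tendsto_eq_intros refl | simp)+
  from order_tendstoD(2)[OF this(1), of "1 + \<eta>"] order_tendstoD(1)[OF this(2), of "1 - \<eta>"]
  have "\<forall>\<^sub>F x in at (1::real). 1 / x^5 < 1 + \<eta> \<and> 1 - \<eta> < 9 / (x\<^sup>2 + x + 1)\<^sup>2"
    using \<eta> by (simp add: eventually_conj)
  then obtain \<rho> where \<rho>: "\<rho> > 0" "\<And>x. x \<noteq> 1 \<Longrightarrow> \<bar>x - 1\<bar> < \<rho> \<Longrightarrow> 1 / x^5 < 1 + \<eta> \<and> 1 - \<eta> < 9 / (x\<^sup>2 + x + 1)\<^sup>2"
    unfolding eventually_at dist_real_def by auto
  have near1: "1 / x^5 \<le> 1 + \<eta> \<and> 1 - \<eta> \<le> 9 / (x\<^sup>2 + x + 1)\<^sup>2" if "\<bar>x - 1\<bar> < \<rho>" for x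
    using \<rho>(2)[OF _ that] \<eta> by (cases "x = 1") auto
  \<comment> \<open>The odd part costs area of order \<epsilon>^2 b. With k0 the tangent bound gains
    \<epsilon>^2 (b + 1), and the extra 1 covers the term of order \<epsilon>^4.\<close>
  define k0 where "k0 = 3 * (b + 1) / (2 * p)"
  have k0: "k0 > 0" "2/3 * (k0 * p) = b + 1" using nn p by (auto simp: k0_def field_simps)
  define m where "m = min (min (1/2) (e/2)) (min \<rho> ((b - a) / 4))"
  have m: "m > 0" "m \<le> 1/2" "m \<le> e/2" "m \<le> \<rho>" "m \<le> (b - a) / 4"
  proof -
    show "m > 0" using e0 \<rho>(1) ab by (simp add: m_def)
    show "m \<le> 1/2" "m \<le> e/2" "m \<le> \<rho>" "m \<le> (b - a) / 4" unfolding m_def by linarith+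
  qed
  \<comment> \<open>A common bound for all quantities that have to become small after multiplication
    by \<epsilon> or \<epsilon>^2.\<close>
  define Z where "Z = 1 + (M1 + k0 * M2) + (M3 + k0 * M4) + k0\<^sup>2 * b1 + 2 * k0\<^sup>2 * a1"
  have Zt: "M1 + k0 * M2 \<ge> 0" "M3 + k0 * M4 \<ge> 0" "k0\<^sup>2 * b1 \<ge> 0" "k0\<^sup>2 * a1 \<ge> 0" using M k0 nn by auto
  have Zt3: "2 * k0\<^sup>2 * a1 \<ge> 0" using nn by simp
  have Z: "Z \<ge> 1" "M1 + k0 * M2 \<le> Z" "k0\<^sup>2 * b1 \<le> Z" "2 * k0\<^sup>2 * a1 \<le> Z" "M3 + k0 * M4 \<le> Z"
    unfolding Z_def using Zt Zt3 by linarith+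
  define \<epsilon> where "\<epsilon> = m / (2 * Z)"
  have \<epsilon>: "\<epsilon> > 0" "\<epsilon> \<le> 1" "\<epsilon> * Z < m" using m Z by (auto simp: \<epsilon>_def field_simps)
  have \<epsilon>2: "\<epsilon>\<^sup>2 \<le> \<epsilon>" using \<epsilon> by (simp add: power2_eq_square mult_left_le)
  have small: "\<epsilon> * x < m" if "x \<le> Z" for x
    using mult_left_mono[OF that, of \<epsilon>] \<epsilon> by linarith
  have small2: "\<epsilon>\<^sup>2 * x < m" if "x \<le> Z" "x \<ge> 0" for x
    using mult_right_mono[OF \<epsilon>2 that(2)] small[OF that(1)] by linarith
  define D where "D k s = \<epsilon> * F s + \<epsilon>\<^sup>2 * k * \<psi> s" for k s
  define D' where "D' k s = \<epsilon> * F' s + \<epsilon>\<^sup>2 * k * \<psi>' s" for k s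
  define r where "r k s = root 3 (1 + D k s)" for k s
  define r' where "r' k s = D' k s / (3 * (r k s)\<^sup>2)" for k s
  have r3: "(r k s)^3 = 1 + D k s" for k s by (simp add: r_def odd_real_root_pow)
  have Dsmall: "\<bar>D k s\<bar> < m" if "k \<in> {0..k0}" "s \<in> {-\<tau>..\<tau>}" for k s
  proof -
    have "\<bar>D k s\<bar> \<le> \<epsilon> * \<bar>F s\<bar> + \<epsilon>\<^sup>2 * (k * \<bar>\<psi> s\<bar>)"
      unfolding D_def using \<epsilon> that by (intro order_trans[OF abs_triangle_ineq]) (simp add: abs_mult)
    also have "\<dots> \<le> \<epsilon> * M1 + \<epsilon> * (k0 * M2)"
      using \<epsilon> \<epsilon>2 that k0 M M1[OF that(2)] M2[OF that(2)] by (intro add_mono mult_mono) auto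
    also have "\<dots> = \<epsilon> * (M1 + k0 * M2)" by (simp add: algebra_simps)
    also have "\<dots> < m" by (rule small[OF Z(2)])
    finally show ?thesis .
  qed
  have D'small: "\<bar>D' k s\<bar> < m" if "k \<in> {0..k0}" "s \<in> {-\<tau>..\<tau>}" for k s
  proof -
    have "\<bar>D' k s\<bar> \<le> \<epsilon> * \<bar>F' s\<bar> + \<epsilon>\<^sup>2 * (k * \<bar>\<psi>' s\<bar>)"
      unfolding D'_def using \<epsilon> that by (intro order_trans[OF abs_triangle_ineq]) (simp add: abs_mult)
    also have "\<dots> \<le> \<epsilon> * M3 + \<epsilon> * (k0 * M4)"
      using \<epsilon> \<epsilon>2 that k0 M M3[OF that(2)] M4[OF that(2)] by (intro add_mono mult_mono) auto
    also have "\<dots> = \<epsilon> * (M3 + k0 * M4)" by (simp add: algebra_simps)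
    also have "\<dots> < m" by (rule small[OF Z(5)])
    finally show ?thesis .
  qed
  have rpos: "r k s > 0" if "k \<in> {0..k0}" "s \<in> {-\<tau>..\<tau>}" for k s
    using Dsmall[OF that] m by (simp add: r_def)
  have r1: "\<bar>r k s - 1\<bar> < m" if "k \<in> {0..k0}" "s \<in> {-\<tau>..\<tau>}" for k s
    using cube_bounds(1)[OF rpos[OF that]] Dsmall[OF that] by (simp add: r3)
  have r'small: "\<bar>r' k s\<bar> < e" if "k \<in> {0..k0}" "s \<in> {-\<tau>..\<tau>}" for k s
  proof -
    have "r k s > 1/2" using r1[OF that] m(2) by linarith
    then have "(1/2)\<^sup>2 \<le> (r k s)\<^sup>2" by (intro power_mono) auto
    then have q: "3 * (r k s)\<^sup>2 \<ge> 3/4" by (simp add: power2_eq_square)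
    have "\<bar>r' k s\<bar> = \<bar>D' k s\<bar> / (3 * (r k s)\<^sup>2)" by (simp add: r'_def)
    also have "\<dots> \<le> \<bar>D' k s\<bar> / (3/4)" using q by (intro divide_left_mono) auto
    also have "\<dots> < e" using D'small[OF that] m by simp
    finally show ?thesis .
  qed
  have dr: "(r k has_real_derivative r' k s) (at s)" if "k \<in> {0..k0}" "s \<in> {-\<tau>..\<tau>}" for k s
  proof -
    have u: "1 + D k s \<noteq> 0" using Dsmall[OF that] m by linarith
    have dD: "((\<lambda>s. 1 + D k s) has_real_derivative D' k s) (at s)"
      unfolding D_def D'_def by (auto intro!: derivative_eq_intros dF d\<psi>)
    have "DERIV (root 3) (1 + D k s) :> inverse (real 3 * root 3 (1 + D k s) ^ (3 - Suc 0))"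
      using u by (intro DERIV_odd_real_root) auto
    from DERIV_chain2[OF this dD] show ?thesis
      unfolding r_def r'_def by (simp add: field_simps power2_eq_square)
  qed
  have cD: "continuous_on A (D k)" "continuous_on A (D' k)" for k A
    unfolding D_def[abs_def] D'_def[abs_def] by (intro continuous_intros cont)+
  have cr: "continuous_on A (r k)" for k A
    unfolding r_def[abs_def] by (intro continuous_intros cD)
  have cr': "continuous_on {-\<tau>..\<tau>} (r' k)" if "k \<in> {0..k0}" for k
  proof -
    have "3 * (r k s)\<^sup>2 \<noteq> 0" if "s \<in> {-\<tau>..\<tau>}" for s using rpos[OF \<open>k \<in> _\<close> that] by simp
    then show ?thesis unfolding r'_def[abs_def] by (intro continuous_intros cD cr) auto
  qed
  have hD: "(D k has_integral \<epsilon>\<^sup>2 * k * p) {-\<tau>..\<tau>}" for k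
    using has_integral_add[OF has_integral_mult_right[OF hF, of \<epsilon>] has_integral_mult_right[OF h\<psi>, of "\<epsilon>\<^sup>2 * k"]]
    by (simp add: D_def[abs_def])
  have hD2: "((\<lambda>s. (D k s)\<^sup>2) has_integral \<epsilon>\<^sup>2 * (b + \<epsilon>\<^sup>2 * k\<^sup>2 * b1)) {-\<tau>..\<tau>}" for k
  proof -
    have "((\<lambda>s. \<epsilon>\<^sup>2 * (F s)\<^sup>2 + (2 * \<epsilon>^3 * k * (F s * \<psi> s) + \<epsilon>^4 * k\<^sup>2 * (\<psi> s)\<^sup>2)) has_integral
       (\<epsilon>\<^sup>2 * b + (2 * \<epsilon>^3 * k * 0 + \<epsilon>^4 * k\<^sup>2 * b1))) {-\<tau>..\<tau>}"
      by (intro has_integral_add has_integral_mult_right hF2 hF\<psi> h\<psi>2)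
    moreover have "\<epsilon>\<^sup>2 * (F s)\<^sup>2 + (2 * \<epsilon>^3 * k * (F s * \<psi> s) + \<epsilon>^4 * k\<^sup>2 * (\<psi> s)\<^sup>2) = (D k s)\<^sup>2" for s
      unfolding D_def by algebra
    moreover have "\<epsilon>\<^sup>2 * b + (2 * \<epsilon>^3 * k * 0 + \<epsilon>^4 * k\<^sup>2 * b1) = \<epsilon>\<^sup>2 * (b + \<epsilon>\<^sup>2 * k\<^sup>2 * b1)" by algebra
    ultimately show ?thesis by simp
  qed
  have hD'2: "((\<lambda>s. (D' k s)\<^sup>2) has_integral \<epsilon>\<^sup>2 * (a + \<epsilon>\<^sup>2 * k\<^sup>2 * a1)) {-\<tau>..\<tau>}" for k
  proof -
    have "((\<lambda>s. \<epsilon>\<^sup>2 * (F' s)\<^sup>2 + (2 * \<epsilon>^3 * k * (F' s * \<psi>' s) + \<epsilon>^4 * k\<^sup>2 * (\<psi>' s)\<^sup>2)) has_integral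
       (\<epsilon>\<^sup>2 * a + (2 * \<epsilon>^3 * k * 0 + \<epsilon>^4 * k\<^sup>2 * a1))) {-\<tau>..\<tau>}"
      by (intro has_integral_add has_integral_mult_right hF'2 hF'\<psi>' h\<psi>'2)
    moreover have "\<epsilon>\<^sup>2 * (F' s)\<^sup>2 + (2 * \<epsilon>^3 * k * (F' s * \<psi>' s) + \<epsilon>^4 * k\<^sup>2 * (\<psi>' s)\<^sup>2) = (D' k s)\<^sup>2" for s
      unfolding D'_def by algebra
    moreover have "\<epsilon>\<^sup>2 * a + (2 * \<epsilon>^3 * k * 0 + \<epsilon>^4 * k\<^sup>2 * a1) = \<epsilon>\<^sup>2 * (a + \<epsilon>\<^sup>2 * k\<^sup>2 * a1)" by algebra
    ultimately show ?thesis by simp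
  qed
  have hr2: "((\<lambda>s. (r k s)\<^sup>2) has_integral ?I (\<lambda>s. (r k s)\<^sup>2)) {-\<tau>..\<tau>}" for k
    by (intro hi continuous_intros cr)
  \<comment> \<open>For k = 0 the perturbation of the cube has integral 0, and concavity can only
    lose area.\<close>
  have low: "?I (\<lambda>s. (r 0 s)\<^sup>2) \<le> 2 * \<tau>"
  proof (rule has_integral_le[OF hr2])
    show "((\<lambda>s. 1 + 2/3 * D 0 s) has_integral 2 * \<tau>) {-\<tau>..\<tau>}"
      using has_integral_add[OF h1 has_integral_mult_right[OF hD[of 0], of "2/3"]] by simp
    show "(r 0 s)\<^sup>2 \<le> 1 + 2/3 * D 0 s" if "s \<in> {-\<tau>..\<tau>}" for s
      using cube_bounds(2)[OF rpos[OF _ that, of 0]] k0 by (simp add: r3)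
  qed
  have high: "2 * \<tau> \<le> ?I (\<lambda>s. (r k0 s)\<^sup>2)"
  proof -
    have "2 * \<tau> + 2/3 * (\<epsilon>\<^sup>2 * k0 * p) - \<epsilon>\<^sup>2 * (b + \<epsilon>\<^sup>2 * k0\<^sup>2 * b1) \<le> ?I (\<lambda>s. (r k0 s)\<^sup>2)"
    proof (rule has_integral_le[OF _ hr2])
      show "((\<lambda>s. 1 + 2/3 * D k0 s - (D k0 s)\<^sup>2) has_integral 2 * \<tau> + 2/3 * (\<epsilon>\<^sup>2 * k0 * p) - \<epsilon>\<^sup>2 * (b + \<epsilon>\<^sup>2 * k0\<^sup>2 * b1)) {-\<tau>..\<tau>}"
        by (intro has_integral_add has_integral_diff has_integral_mult_right h1 hD hD2)
      show "1 + 2/3 * D k0 s - (D k0 s)\<^sup>2 \<le> (r k0 s)\<^sup>2" if "s \<in> {-\<tau>..\<tau>}" for s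
        using cube_bounds(3)[OF rpos[OF _ that, of k0]] k0 by (simp add: r3)
    qed
    moreover have "2/3 * (\<epsilon>\<^sup>2 * k0 * p) - \<epsilon>\<^sup>2 * (b + \<epsilon>\<^sup>2 * k0\<^sup>2 * b1) = \<epsilon>\<^sup>2 * (1 - \<epsilon>\<^sup>2 * (k0\<^sup>2 * b1))"
    proof -
      have "2/3 * (\<epsilon>\<^sup>2 * k0 * p) = \<epsilon>\<^sup>2 * (b + 1)" unfolding k0(2)[symmetric] by simp
      then show ?thesis by (simp add: algebra_simps)
    qed
    moreover have "\<epsilon>\<^sup>2 * (1 - \<epsilon>\<^sup>2 * (k0\<^sup>2 * b1)) \<ge> 0"
    proof -
      have "\<epsilon>\<^sup>2 * (k0\<^sup>2 * b1) < m" by (rule small2[OF Z(3) Zt(3)])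
      then show ?thesis using m by simp
    qed
    ultimately show ?thesis by linarith
  qed
  have contk: "continuous_on {0..k0} (\<lambda>k. ?I (\<lambda>s. (r k s)\<^sup>2))"
  proof -
    have "continuous_on ({0..k0} \<times> cbox (-\<tau>) \<tau>) (\<lambda>(k, s). (r k s)\<^sup>2)"
      unfolding r_def D_def split_beta
      by (intro continuous_intros continuous_on_compose2[OF cF[of UNIV]] continuous_on_compose2[OF c\<psi>[of UNIV]]) auto
    from integral_continuous_on_param[OF this] show ?thesis by simp
  qed
  obtain k where k: "0 \<le> k" "k \<le> k0" and area: "?I (\<lambda>s. (r k s)\<^sup>2) = 2 * \<tau>"
    using IVT'[of "\<lambda>k. ?I (\<lambda>s. (r k s)\<^sup>2)" 0 "2 * \<tau>" k0, OF low high _ contk] k0 by auto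
  have kk: "k \<in> {0..k0}" using k by simp
  have mc: "?I (\<lambda>s. (r k s)^3 * cos s) = 2 * sin \<tau>"
    using has_integral_add[OF hc has_integral_add[OF has_integral_mult_right[OF hFc, of \<epsilon>] has_integral_mult_right[OF h\<psi>c, of "\<epsilon>\<^sup>2 * k"]]]
    by (intro integral_unique) (simp add: r3 D_def algebra_simps)
  have ms: "?I (\<lambda>s. (r k s)^3 * sin s) = 0"
    using has_integral_add[OF hs has_integral_add[OF has_integral_mult_right[OF hFs, of \<epsilon>] has_integral_mult_right[OF h\<psi>s, of "\<epsilon>\<^sup>2 * k"]]]
    by (intro integral_unique) (simp add: r3 D_def algebra_simps)
  have ends: "r k \<tau> = 1" "r k (- \<tau>) = 1"
    by (simp_all add: r_def D_def parF par\<psi> F\<tau> \<psi>\<tau>)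
  have len: "?I (\<lambda>s. sqrt ((r' k s)\<^sup>2 + (r k s)\<^sup>2)) < 2 * \<tau>"
  proof -
    have hL: "((\<lambda>s. sqrt ((r' k s)\<^sup>2 + (r k s)\<^sup>2)) has_integral ?I (\<lambda>s. sqrt ((r' k s)\<^sup>2 + (r k s)\<^sup>2))) {-\<tau>..\<tau>}"
      by (intro hi continuous_intros cr cr'[OF kk])
    have hU: "((\<lambda>s. 1/2 * 1 + 1/2 * (r k s)\<^sup>2 + ((1 + \<eta>) / 18 * (D' k s)\<^sup>2 - (1 - \<eta>) / 18 * (D k s)\<^sup>2)) has_integral
       (1/2 * (2 * \<tau>) + 1/2 * (2 * \<tau>) + ((1 + \<eta>) / 18 * (\<epsilon>\<^sup>2 * (a + \<epsilon>\<^sup>2 * k\<^sup>2 * a1)) - (1 - \<eta>) / 18 * (\<epsilon>\<^sup>2 * (b + \<epsilon>\<^sup>2 * k\<^sup>2 * b1))))) {-\<tau>..\<tau>}"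
      using hr2[of k] unfolding area by (intro has_integral_add has_integral_diff has_integral_mult_right h1 hD2 hD'2)
    have "?I (\<lambda>s. sqrt ((r' k s)\<^sup>2 + (r k s)\<^sup>2)) \<le>
        1/2 * (2 * \<tau>) + 1/2 * (2 * \<tau>) + ((1 + \<eta>) / 18 * (\<epsilon>\<^sup>2 * (a + \<epsilon>\<^sup>2 * k\<^sup>2 * a1)) - (1 - \<eta>) / 18 * (\<epsilon>\<^sup>2 * (b + \<epsilon>\<^sup>2 * k\<^sup>2 * b1)))"
    proof (rule has_integral_le[OF hL hU])
      fix s assume s: "s \<in> {-\<tau>..\<tau>}"
      define R where "R = r k s"
      have R: "R > 0" "\<bar>R - 1\<bar> < \<rho>" using rpos[OF kk s] r1[OF kk s] m by (auto simp: R_def)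
      note n = near1[OF R(2)]
      have DR: "D k s = (R - 1) * (R\<^sup>2 + R + 1)"
        using r3[of k s] unfolding R_def by (simp add: algebra_simps power2_eq_square power3_eq_cube)
      have q: "R\<^sup>2 + R + 1 > 0" using R by (simp add: add_pos_pos)
      have t1: "(r' k s)\<^sup>2 / (2 * R) \<le> (1 + \<eta>) / 18 * (D' k s)\<^sup>2"
      proof -
        have "(r' k s)\<^sup>2 / (2 * R) = (D' k s)\<^sup>2 / 18 * (1 / R^5)"
          unfolding r'_def R_def[symmetric] using R by (simp add: power_divide power_mult_distrib power_numeral_reduce field_simps)
        also have "\<dots> \<le> (D' k s)\<^sup>2 / 18 * (1 + \<eta>)" using n by (intro mult_left_mono) auto
        finally show ?thesis by (simp add: mult.commute)
      qed
      have t2: "(1 - \<eta>) / 18 * (D k s)\<^sup>2 \<le> (R - 1)\<^sup>2 / 2"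
      proof -
        have "(1 - \<eta>) * (D k s)\<^sup>2 \<le> 9 / (R\<^sup>2 + R + 1)\<^sup>2 * (D k s)\<^sup>2" using n by (intro mult_right_mono) auto
        also have "\<dots> = 9 * (R - 1)\<^sup>2" unfolding DR using q by (simp add: power_mult_distrib)
        finally show ?thesis by simp
      qed
      \<comment> \<open>Combined with R = 1/2 + R^2/2 - (R - 1)^2/2, this trades the integral of R
        for the fixed area and a negative square.\<close>
      have "sqrt ((r' k s)\<^sup>2 + R\<^sup>2) \<le> R + (r' k s)\<^sup>2 / (2 * R)"
      proof (rule real_le_lsqrt)
        have "(R + (r' k s)\<^sup>2 / (2 * R))\<^sup>2 = R\<^sup>2 + (r' k s)\<^sup>2 + ((r' k s)\<^sup>2 / (2 * R))\<^sup>2"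
          using R by (simp add: power2_sum)
        then show "(r' k s)\<^sup>2 + R\<^sup>2 \<le> (R + (r' k s)\<^sup>2 / (2 * R))\<^sup>2" by simp
      qed (use R in auto)
      moreover have "R = 1/2 * 1 + 1/2 * R\<^sup>2 - (R - 1)\<^sup>2 / 2" by (simp add: power2_eq_square field_simps)
      ultimately show "sqrt ((r' k s)\<^sup>2 + (r k s)\<^sup>2) \<le> 1/2 * 1 + 1/2 * (r k s)\<^sup>2 + ((1 + \<eta>) / 18 * (D' k s)\<^sup>2 - (1 - \<eta>) / 18 * (D k s)\<^sup>2)"
        using t1 t2 unfolding R_def[symmetric] by linarith
    qed
    also have "\<dots> = 2 * \<tau> + \<epsilon>\<^sup>2 / 18 * ((1 + \<eta>) * (a + \<epsilon>\<^sup>2 * k\<^sup>2 * a1) - (1 - \<eta>) * (b + \<epsilon>\<^sup>2 * k\<^sup>2 * b1))"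
      by (simp add: field_simps)
    also have "\<dots> < 2 * \<tau>"
    proof -
      have x: "(1 + \<eta>) * (\<epsilon>\<^sup>2 * k\<^sup>2 * a1) \<le> 2 * (\<epsilon>\<^sup>2 * k0\<^sup>2 * a1)"
        using \<eta> k nn \<epsilon>(1) by (intro mult_mono power_mono mult_nonneg_nonneg) auto
      have y: "\<epsilon>\<^sup>2 * (2 * k0\<^sup>2 * a1) < m" by (rule small2[OF Z(4) Zt3])
      have z: "(1 - \<eta>) * (\<epsilon>\<^sup>2 * k\<^sup>2 * b1) \<ge> 0" using \<eta> nn by simp
      have "(1 + \<eta>) * (a + \<epsilon>\<^sup>2 * k\<^sup>2 * a1) - (1 - \<eta>) * (b + \<epsilon>\<^sup>2 * k\<^sup>2 * b1)
         = (a - b) + \<eta> * (a + b) + (1 + \<eta>) * (\<epsilon>\<^sup>2 * k\<^sup>2 * a1) - (1 - \<eta>) * (\<epsilon>\<^sup>2 * k\<^sup>2 * b1)"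
        by (simp add: algebra_simps)
      also have "\<dots> < 0"
      proof -
        have "2 * (\<epsilon>\<^sup>2 * k0\<^sup>2 * a1) < m" using y by (simp add: mult_ac)
        moreover have "a - b + E + X - Y < 0"
          if "P < m" "X \<le> P" "0 \<le> Y" "E \<le> (b - a) / 2" for P X Y E using that m(5) ab by (simp add: field_simps)
        ultimately show ?thesis using x z \<eta>ab by blast
      qed
      finally have "\<epsilon>\<^sup>2 / 18 * ((1 + \<eta>) * (a + \<epsilon>\<^sup>2 * k\<^sup>2 * a1) - (1 - \<eta>) * (b + \<epsilon>\<^sup>2 * k\<^sup>2 * b1)) < 0"
        using \<epsilon> by (intro mult_pos_neg) auto
      then show ?thesis by linarith
    qed
    finally show ?thesis .
  qed
  have "\<forall>s\<in>{-\<tau>..\<tau>}. (r k has_real_derivative r' k s) (at s) \<and> r k s > 0 \<and> \<bar>r k s - 1\<bar> < e \<and> \<bar>r' k s\<bar> < e"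
  proof
    fix s assume s: "s \<in> {-\<tau>..\<tau>}"
    have "\<bar>r k s - 1\<bar> < e" using r1[OF kk s] m(3) e0 by linarith
    then show "(r k has_real_derivative r' k s) (at s) \<and> r k s > 0 \<and> \<bar>r k s - 1\<bar> < e \<and> \<bar>r' k s\<bar> < e"
      using dr[OF kk s] rpos[OF kk s] r'small[OF kk s] by blast
  qed
  with cr'[OF kk] ends area mc ms len show ?thesis by blast
qed

section \<open>Planar curves and their lifts\<close>

text \<open>With the end points of the planar curve these determine the coordinates \<open>z\<close>, \<open>w\<close>, \<open>v\<close> of the
  end point of its lift to the Cartan group.\<close>

definition planar_moments ::
  "real \<Rightarrow> (real \<Rightarrow> real) \<Rightarrow> (real \<Rightarrow> real) \<Rightarrow> (real \<Rightarrow> real) \<Rightarrow> (real \<Rightarrow> real) \<Rightarrow> real \<times> real \<times> real" where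
  "planar_moments T x x' y y' =
    (integral {0..T} (\<lambda>t. x t * y' t - y t * x' t),
     integral {0..T} (\<lambda>t. ((x t)\<^sup>2 + (y t)\<^sup>2) * x' t),
     integral {0..T} (\<lambda>t. ((x t)\<^sup>2 + (y t)\<^sup>2) * y' t))"

text \<open>The squared norm of the image is N times the old one plus an affine function. Hence the
  new integrands are combinations of the three old ones, of exact differentials and of x y' and y
  x', and the integrals of the last two follow from A and the boundary values. So the new moments
  depend on the old ones and the end points alone; \<sigma> = -1 allows a reflection.\<close>

lemma similar_moments:
  fixes x y x' y' :: "real \<Rightarrow> real"
  assumes T: "0 \<le> T" and x: "ac_on 0 T x x'" and y: "ac_on 0 T y y'" and \<sigma>: "\<sigma>\<^sup>2 = 1"
    and ends: "x 0 = x0" "y 0 = y0" "x T = x1" "y T = y1"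
    and mom: "planar_moments T x x' y y' = (A, W, V)"
    and N_def: "N = a\<^sup>2 + b\<^sup>2" and l1_def: "l1 = 2 * (a * e - \<sigma> * b * f)" and l2_def: "l2 = 2 * (b * e + \<sigma> * a * f)"
    and l0_def: "l0 = e\<^sup>2 + f\<^sup>2"
  shows "planar_moments T (\<lambda>t. a * x t + b * y t + e) (\<lambda>t. a * x' t + b * y' t)
      (\<lambda>t. \<sigma> * (a * y t - b * x t) + f) (\<lambda>t. \<sigma> * (a * y' t - b * x' t)) =
    (\<sigma> * N * A + e * \<sigma> * (a * (y1 - y0) - b * (x1 - x0)) - f * (a * (x1 - x0) + b * (y1 - y0)),
     a * (N * W + l1 * ((x1\<^sup>2 - x0\<^sup>2) / 2) + l2 * ((x1 * y1 - x0 * y0 - A) / 2) + l0 * (x1 - x0))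
       + b * (N * V + l1 * ((x1 * y1 - x0 * y0 + A) / 2) + l2 * ((y1\<^sup>2 - y0\<^sup>2) / 2) + l0 * (y1 - y0)),
     \<sigma> * a * (N * V + l1 * ((x1 * y1 - x0 * y0 + A) / 2) + l2 * ((y1\<^sup>2 - y0\<^sup>2) / 2) + l0 * (y1 - y0))
       - \<sigma> * b * (N * W + l1 * ((x1\<^sup>2 - x0\<^sup>2) / 2) + l2 * ((x1 * y1 - x0 * y0 - A) / 2) + l0 * (x1 - x0)))"
proof -
  have cx: "continuous_on {0..T} x" and cy: "continuous_on {0..T} y" using x y ac_on_continuous by auto
  have full: "(g' has_integral g T - g 0) {0..T}" if "ac_on 0 T g g'" for g g' :: "real \<Rightarrow> real"
    using ac_on_has_integral[OF that order_refl T order_refl] .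
  have ix: "(x' has_integral x1 - x0) {0..T}" and iy: "(y' has_integral y1 - y0) {0..T}"
    using full[OF x] full[OF y] ends by auto
  have ixx: "((\<lambda>t. x t * x' t) has_integral (x1\<^sup>2 - x0\<^sup>2) / 2) {0..T}"
    using has_integral_mult_right[OF full[OF ac_on_mult[OF x x]], of "1/2"] ends
    by (simp add: power2_eq_square diff_divide_distrib)
  have iyy: "((\<lambda>t. y t * y' t) has_integral (y1\<^sup>2 - y0\<^sup>2) / 2) {0..T}"
    using has_integral_mult_right[OF full[OF ac_on_mult[OF y y]], of "1/2"] ends
    by (simp add: power2_eq_square diff_divide_distrib)
  have int: "(\<lambda>t. x t * y' t - y t * x' t) integrable_on {0..T}"
    by (intro integrable_diff ac_on_times_integrable[OF cx y] ac_on_times_integrable[OF cy x])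
  have iA: "((\<lambda>t. x t * y' t - y t * x' t) has_integral A) {0..T}"
    using int mom by (auto simp: planar_moments_def has_integral_integrable_integral)
  have c2: "continuous_on {0..T} (\<lambda>t. (x t)\<^sup>2 + (y t)\<^sup>2)" by (intro continuous_intros cx cy)
  have iW: "((\<lambda>t. ((x t)\<^sup>2 + (y t)\<^sup>2) * x' t) has_integral W) {0..T}"
    using ac_on_times_integrable[OF c2 x] mom by (auto simp: planar_moments_def has_integral_integrable_integral)
  have iV: "((\<lambda>t. ((x t)\<^sup>2 + (y t)\<^sup>2) * y' t) has_integral V) {0..T}"
    using ac_on_times_integrable[OF c2 y] mom by (auto simp: planar_moments_def has_integral_integrable_integral)
  have iB: "((\<lambda>t. y t * x' t + x t * y' t) has_integral x1 * y1 - x0 * y0) {0..T}"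
    using full[OF ac_on_mult[OF x y]] ends by simp
  have ixy: "((\<lambda>t. x t * y' t) has_integral (x1 * y1 - x0 * y0 + A) / 2) {0..T}"
    using has_integral_mult_right[OF has_integral_add[OF iB iA], of "1/2"] by simp
  have iyx: "((\<lambda>t. y t * x' t) has_integral (x1 * y1 - x0 * y0 - A) / 2) {0..T}"
    using has_integral_mult_right[OF has_integral_diff[OF iB iA], of "1/2"] by (simp add: mult.commute)
  let ?P = "N * W + l1 * ((x1\<^sup>2 - x0\<^sup>2) / 2) + l2 * ((x1 * y1 - x0 * y0 - A) / 2) + l0 * (x1 - x0)"
  let ?Q = "N * V + l1 * ((x1 * y1 - x0 * y0 + A) / 2) + l2 * ((y1\<^sup>2 - y0\<^sup>2) / 2) + l0 * (y1 - y0)"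
  have iP: "((\<lambda>t. N * (((x t)\<^sup>2 + (y t)\<^sup>2) * x' t) + l1 * (x t * x' t) + l2 * (y t * x' t) + l0 * x' t) has_integral ?P) {0..T}"
    by (intro has_integral_add has_integral_mult_right iW ixx iyx ix)
  have iQ: "((\<lambda>t. N * (((x t)\<^sup>2 + (y t)\<^sup>2) * y' t) + l1 * (x t * y' t) + l2 * (y t * y' t) + l0 * y' t) has_integral ?Q) {0..T}"
    by (intro has_integral_add has_integral_mult_right iV ixy iyy iy)
  have R: "(a * x t + b * y t + e)\<^sup>2 + (\<sigma> * (a * y t - b * x t) + f)\<^sup>2
      = N * ((x t)\<^sup>2 + (y t)\<^sup>2) + l1 * x t + l2 * y t + l0" for t
    using \<sigma> unfolding N_def l1_def l2_def l0_def by algebra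
  have "((\<lambda>t. \<sigma> * N * (x t * y' t - y t * x' t) + e * \<sigma> * (a * y' t - b * x' t) - f * (a * x' t + b * y' t)) has_integral
     (\<sigma> * N * A + e * \<sigma> * (a * (y1 - y0) - b * (x1 - x0)) - f * (a * (x1 - x0) + b * (y1 - y0)))) {0..T}"
    by (intro has_integral_add has_integral_diff has_integral_mult_right iA ix iy)
  moreover have "(a * x t + b * y t + e) * (\<sigma> * (a * y' t - b * x' t)) - (\<sigma> * (a * y t - b * x t) + f) * (a * x' t + b * y' t)
     = \<sigma> * N * (x t * y' t - y t * x' t) + e * \<sigma> * (a * y' t - b * x' t) - f * (a * x' t + b * y' t)" for t
    unfolding N_def by algebra
  ultimately have m1: "integral {0..T} (\<lambda>t. (a * x t + b * y t + e) * (\<sigma> * (a * y' t - b * x' t)) - (\<sigma> * (a * y t - b * x t) + f) * (a * x' t + b * y' t))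
     = \<sigma> * N * A + e * \<sigma> * (a * (y1 - y0) - b * (x1 - x0)) - f * (a * (x1 - x0) + b * (y1 - y0))"
    by (simp add: integral_unique)
  have m2: "integral {0..T} (\<lambda>t. (N * ((x t)\<^sup>2 + (y t)\<^sup>2) + l1 * x t + l2 * y t + l0) * (a * x' t + b * y' t)) = a * ?P + b * ?Q"
    using has_integral_add[OF has_integral_mult_right[OF iP, of a] has_integral_mult_right[OF iQ, of b]]
    by (intro integral_unique) (elim has_integral_eq[rotated], simp add: algebra_simps)
  have m3: "integral {0..T} (\<lambda>t. (N * ((x t)\<^sup>2 + (y t)\<^sup>2) + l1 * x t + l2 * y t + l0) * (\<sigma> * (a * y' t - b * x' t))) = \<sigma> * a * ?Q - \<sigma> * b * ?P"
    using has_integral_diff[OF has_integral_mult_right[OF iQ, of "\<sigma> * a"] has_integral_mult_right[OF iP, of "\<sigma> * b"]]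
    by (intro integral_unique) (elim has_integral_eq[rotated], simp add: algebra_simps)
  show ?thesis unfolding planar_moments_def R m1 m2 m3 ..
qed

text \<open>Serves both directions: carrying a competitor of the trajectory to the unit circle, and
  carrying the shortened arc back to the trajectory.\<close>

corollary similar_moments_eq:
  fixes x y x' y' :: "real \<Rightarrow> real"
  assumes "0 \<le> T" "ac_on 0 T x x'" "ac_on 0 T y y'" "ac_on 0 T u u'" "ac_on 0 T v v'" "\<sigma>\<^sup>2 = 1"
    and "x 0 = u 0" "y 0 = v 0" "x T = u T" "y T = v T"
    and mom: "planar_moments T x x' y y' = planar_moments T u u' v v'"
  shows "planar_moments T (\<lambda>t. a * x t + b * y t + e) (\<lambda>t. a * x' t + b * y' t)
      (\<lambda>t. \<sigma> * (a * y t - b * x t) + f) (\<lambda>t. \<sigma> * (a * y' t - b * x' t)) =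
    planar_moments T (\<lambda>t. a * u t + b * v t + e) (\<lambda>t. a * u' t + b * v' t)
      (\<lambda>t. \<sigma> * (a * v t - b * u t) + f) (\<lambda>t. \<sigma> * (a * v' t - b * u' t))"
proof -
  obtain A W V where m: "planar_moments T u u' v v' = (A, W, V)" by (cases "planar_moments T u u' v v'")
  show ?thesis
    unfolding similar_moments[OF assms(1-3,6-10) mom[unfolded m] refl refl refl refl]
      similar_moments[OF assms(1,4,5,6) refl refl refl refl m refl refl refl refl] ..
qed

section \<open>Lifts of planar curves to the Cartan group\<close>

lemma sr_velocity:
  "u1 *\<^sub>R X1 (x, y, z, v, w) + u2 *\<^sub>R X2 (x, y, z, v, w) =
    (u1, u2, (x * u2 - y * u1) / 2, (x\<^sup>2 + y\<^sup>2) * u2 / 2, - ((x\<^sup>2 + y\<^sup>2) * u1 / 2))"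
  by (simp add: X1_def X2_def field_simps)

text \<open>The velocity depends on the point through x and y only, so the other three coordinates
  are integrals of planar data. Two admissible curves from the origin therefore have the same end
  point exactly when their planar end points and their moments agree.\<close>

lemma admissible_planar:
  assumes adm: "admissible T \<gamma> u1 u2" and T: "T \<ge> 0" and z: "\<gamma> 0 = 0"
  defines "x \<equiv> \<lambda>t. fst (\<gamma> t)" and "y \<equiv> \<lambda>t. fst (snd (\<gamma> t))"
  shows "ac_on 0 T x u1" "ac_on 0 T y u2"
    "\<exists>A W V. planar_moments T x u1 y u2 = (A, W, V) \<and> \<gamma> T = (x T, y T, A / 2, V / 2, - (W / 2))"
proof -
  have u: "u1 \<in> borel_measurable (lebesgue_on {0..T})" "bounded (u1 ` {0..T})"
    "u2 \<in> borel_measurable (lebesgue_on {0..T})" "bounded (u2 ` {0..T})"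
    and I: "\<And>t. t \<in> {0..T} \<Longrightarrow> ((\<lambda>s. u1 s *\<^sub>R X1 (\<gamma> s) + u2 s *\<^sub>R X2 (\<gamma> s)) has_integral (\<gamma> t - \<gamma> 0)) {0..t}"
    using adm by (auto simp: admissible_def)
  have g: "\<gamma> s = (x s, y s, snd (snd (\<gamma> s)))" for s by (simp add: x_def y_def)
  have e: "u1 s *\<^sub>R X1 (\<gamma> s) + u2 s *\<^sub>R X2 (\<gamma> s) =
      (u1 s, u2 s, (x s * u2 s - y s * u1 s) / 2, ((x s)\<^sup>2 + (y s)\<^sup>2) * u2 s / 2, - (((x s)\<^sup>2 + (y s)\<^sup>2) * u1 s / 2))" for s
    using sr_velocity[of "u1 s" "x s" "y s" "fst (snd (snd (\<gamma> s)))" "fst (snd (snd (snd (\<gamma> s))))" "snd (snd (snd (snd (\<gamma> s))))" "u2 s"]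
    by (simp add: x_def y_def)
  note fs = has_integral_linear[OF _ bounded_linear_fst] has_integral_linear[OF _ bounded_linear_snd]
  have J: "((\<lambda>s. (u1 s, u2 s, (x s * u2 s - y s * u1 s) / 2, ((x s)\<^sup>2 + (y s)\<^sup>2) * u2 s / 2, - (((x s)\<^sup>2 + (y s)\<^sup>2) * u1 s / 2)))
     has_integral (\<gamma> t)) {0..t}" if "t \<in> {0..T}" for t
    using I[OF that] by (simp add: e z)
  have J1: "(u1 has_integral (x t)) {0..t}" if "t \<in> {0..T}" for t
    using fs(1)[OF J[OF that]] by (simp add: o_def x_def)
  have J2: "(u2 has_integral (y t)) {0..t}" if "t \<in> {0..T}" for t
    using fs(1)[OF fs(2)[OF J[OF that]]] by (simp add: o_def y_def)
  have z0: "x 0 = 0" "y 0 = 0" by (simp_all add: x_def y_def z)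
  show "ac_on 0 T x u1" "ac_on 0 T y u2" unfolding ac_on_def using u J1 J2 by (auto simp: z0)
  have TT: "T \<in> {0..T}" using T by simp
  note J5 = fs(2)[OF fs(2)[OF J[OF TT]]]
  have J3: "((\<lambda>s. (x s * u2 s - y s * u1 s) / 2) has_integral fst (snd (snd (\<gamma> T)))) {0..T}"
    using fs(1)[OF J5] by (simp add: o_def)
  have J4: "((\<lambda>s. ((x s)\<^sup>2 + (y s)\<^sup>2) * u2 s / 2) has_integral fst (snd (snd (snd (\<gamma> T))))) {0..T}"
    using fs(1)[OF fs(2)[OF J5]] by (simp add: o_def)
  have J6: "((\<lambda>s. - (((x s)\<^sup>2 + (y s)\<^sup>2) * u1 s / 2)) has_integral snd (snd (snd (snd (\<gamma> T))))) {0..T}"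
    using fs(2)[OF fs(2)[OF J5]] by (simp add: o_def)
  have "planar_moments T x u1 y u2 = (2 * fst (snd (snd (\<gamma> T))), - 2 * snd (snd (snd (snd (\<gamma> T)))), 2 * fst (snd (snd (snd (\<gamma> T)))))"
    unfolding planar_moments_def prod.inject
  proof (intro conjI integral_unique)
    show "((\<lambda>t. x t * u2 t - y t * u1 t) has_integral 2 * fst (snd (snd (\<gamma> T)))) {0..T}"
      using has_integral_mult_right[OF J3, of 2] by (rule has_integral_eq[rotated]) (simp add: field_simps)
    show "((\<lambda>t. ((x t)\<^sup>2 + (y t)\<^sup>2) * u2 t) has_integral 2 * fst (snd (snd (snd (\<gamma> T))))) {0..T}"
      using has_integral_mult_right[OF J4, of 2] by (rule has_integral_eq[rotated]) (simp add: field_simps)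
    show "((\<lambda>t. ((x t)\<^sup>2 + (y t)\<^sup>2) * u1 t) has_integral - 2 * snd (snd (snd (snd (\<gamma> T))))) {0..T}"
      using has_integral_mult_right[OF J6, of "-2"] by (rule has_integral_eq[rotated]) (simp add: field_simps)
  qed
  moreover have "\<gamma> T = (x T, y T, 2 * fst (snd (snd (\<gamma> T))) / 2, 2 * fst (snd (snd (snd (\<gamma> T)))) / 2,
      - (- 2 * snd (snd (snd (snd (\<gamma> T)))) / 2))"
    by (simp add: x_def y_def)
  ultimately show "\<exists>A W V. planar_moments T x u1 y u2 = (A, W, V) \<and> \<gamma> T = (x T, y T, A / 2, V / 2, - (W / 2))"
    by blast
qed

lemma planar_admissible:
  assumes x: "ac_on 0 T x x'" and y: "ac_on 0 T y y'" and T: "T \<ge> 0" and z: "x 0 = 0" "y 0 = 0"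
  shows "\<exists>\<gamma>. admissible T \<gamma> x' y' \<and> \<gamma> 0 = 0 \<and> (\<forall>t. fst (\<gamma> t) = x t \<and> fst (snd (\<gamma> t)) = y t)
    \<and> (\<forall>t. snd (snd (\<gamma> t)) = (integral {0..t} (\<lambda>s. (x s * y' s - y s * x' s) / 2),
      integral {0..t} (\<lambda>s. ((x s)\<^sup>2 + (y s)\<^sup>2) * y' s / 2), integral {0..t} (\<lambda>s. - (((x s)\<^sup>2 + (y s)\<^sup>2) * x' s / 2))))"
proof -
  define \<gamma> where "\<gamma> t = (x t, y t, integral {0..t} (\<lambda>s. (x s * y' s - y s * x' s) / 2),
      integral {0..t} (\<lambda>s. ((x s)\<^sup>2 + (y s)\<^sup>2) * y' s / 2), integral {0..t} (\<lambda>s. - (((x s)\<^sup>2 + (y s)\<^sup>2) * x' s / 2)))" for t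
  have cx: "continuous_on {0..T} x" and cy: "continuous_on {0..T} y" using x y ac_on_continuous by auto
  have g0: "\<gamma> 0 = 0" by (simp add: \<gamma>_def z zero_prod_def)
  have "admissible T \<gamma> x' y'"
    unfolding admissible_def
  proof (intro conjI ballI)
    show "x' \<in> borel_measurable (lebesgue_on {0..T})" "bounded (x' ` {0..T})"
      "y' \<in> borel_measurable (lebesgue_on {0..T})" "bounded (y' ` {0..T})"
      using x y by (auto simp: ac_on_def)
    fix t assume t: "t \<in> {0..T}"
    have xt: "ac_on 0 t x x'" "ac_on 0 t y y'" using t x y by (auto intro: ac_on_subinterval)
    have ct: "continuous_on {0..t} x" "continuous_on {0..t} y" using xt ac_on_continuous by auto
    have i1: "(\<lambda>s. (x s * y' s - y s * x' s) / 2) integrable_on {0..t}"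
      by (intro integrable_on_divide integrable_diff ac_on_times_integrable[OF ct(1) xt(2)] ac_on_times_integrable[OF ct(2) xt(1)])
    have i2: "(\<lambda>s. ((x s)\<^sup>2 + (y s)\<^sup>2) * y' s / 2) integrable_on {0..t}"
      by (intro integrable_on_divide ac_on_times_integrable[OF _ xt(2)] continuous_intros ct)
    have i3: "(\<lambda>s. - (((x s)\<^sup>2 + (y s)\<^sup>2) * x' s / 2)) integrable_on {0..t}"
      by (intro integrable_neg integrable_on_divide ac_on_times_integrable[OF _ xt(1)] continuous_intros ct)
    have x1: "(x' has_integral x t) {0..t}" "(y' has_integral y t) {0..t}"
      using x y t z by (auto simp: ac_on_def)
    have "((\<lambda>s. (x' s, y' s, (x s * y' s - y s * x' s) / 2, ((x s)\<^sup>2 + (y s)\<^sup>2) * y' s / 2, - (((x s)\<^sup>2 + (y s)\<^sup>2) * x' s / 2)))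
      has_integral \<gamma> t) {0..t}"
      unfolding \<gamma>_def by (intro has_integral_Pair x1 integrable_integral i1 i2 i3)
    then show "((\<lambda>s. x' s *\<^sub>R X1 (\<gamma> s) + y' s *\<^sub>R X2 (\<gamma> s)) has_integral (\<gamma> t - \<gamma> 0)) {0..t}"
      unfolding g0 by (simp add: \<gamma>_def sr_velocity)
  qed
  with g0 show ?thesis by (intro exI[of _ \<gamma>]) (auto simp: \<gamma>_def)
qed

text \<open>In the frame that rotates with the reference point the curve stays near (1, 0), where
  arctan (q / p) is a smooth angle. Adding the reference angle gives a continuous polar angle even
  when the arc winds around the origin more than once, where no fixed branch of the angle would
  do.\<close>

lemma polar_coordinates:
  fixes X Y X' Y' :: "real \<Rightarrow> real" and \<kappa> \<tau> d T :: real
  assumes X: "ac_on 0 T X X'" and Y: "ac_on 0 T Y Y'" and d: "0 \<le> d" "d \<le> 1/4"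
    and close: "\<And>t. t \<in> {0..T} \<Longrightarrow> \<bar>X t - cos (\<kappa> * t - \<tau>)\<bar> \<le> d \<and> \<bar>Y t - sin (\<kappa> * t - \<tau>)\<bar> \<le> d"
  shows "\<exists>r r' \<phi> \<phi>'. ac_on 0 T r r' \<and> ac_on 0 T \<phi> \<phi>' \<and>
    (\<forall>t\<in>{0..T}. r t > 0 \<and> X t = r t * cos (\<phi> t) \<and> Y t = r t * sin (\<phi> t) \<and>
      X' t = r' t * cos (\<phi> t) - r t * \<phi>' t * sin (\<phi> t) \<and> Y' t = r' t * sin (\<phi> t) + r t * \<phi>' t * cos (\<phi> t) \<and>
      \<bar>r t - 1\<bar> \<le> 4 * d \<and> \<bar>\<phi> t - (\<kappa> * t - \<tau>)\<bar> \<le> 4 * d \<and>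
      (X t = cos (\<kappa> * t - \<tau>) \<and> Y t = sin (\<kappa> * t - \<tau>) \<longrightarrow> r t = 1 \<and> \<phi> t = \<kappa> * t - \<tau>))"
proof -
  define ca where "ca t = cos (\<kappa> * t - \<tau>)" for t
  define sa where "sa t = sin (\<kappa> * t - \<tau>)" for t
  have cs: "(ca t)\<^sup>2 + (sa t)\<^sup>2 = 1" for t by (simp add: ca_def sa_def)
  have ac_ca: "ac_on 0 T ca (\<lambda>t. - (\<kappa> * sa t))" and ac_sa: "ac_on 0 T sa (\<lambda>t. \<kappa> * ca t)"
    unfolding ca_def[abs_def] sa_def[abs_def]
    by (rule ac_on_C1_real; auto intro!: derivative_eq_intros continuous_intros)+
  define p where "p t = X t * ca t + Y t * sa t" for t
  define q where "q t = Y t * ca t - X t * sa t" for t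
  define p' where "p' t = X' t * ca t + Y' t * sa t + \<kappa> * q t" for t
  define q' where "q' t = Y' t * ca t - X' t * sa t - \<kappa> * p t" for t
  have ac_p: "ac_on 0 T p p'"
    by (rule ac_on_cong[OF ac_on_add[OF ac_on_mult[OF X ac_ca] ac_on_mult[OF Y ac_sa]]])
      (simp_all add: p_def p'_def q_def algebra_simps)
  have ac_q: "ac_on 0 T q q'"
    by (rule ac_on_cong[OF ac_on_add[OF ac_on_mult[OF Y ac_ca] ac_on_cmult[OF ac_on_mult[OF X ac_sa], of "-1"]]])
      (simp_all add: q_def q'_def p_def algebra_simps)
  have pq: "\<bar>p t - 1\<bar> \<le> 2 * d" "\<bar>q t\<bar> \<le> 2 * d" if t: "t \<in> {0..T}" for t
  proof -
    have c1: "\<bar>X t - ca t\<bar> \<le> d" "\<bar>Y t - sa t\<bar> \<le> d" using close[OF t] by (auto simp: ca_def sa_def)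
    have b: "\<bar>u * v\<bar> \<le> d" if "\<bar>u\<bar> \<le> d" "\<bar>v\<bar> \<le> 1" for u v :: real
      unfolding abs_mult using mult_mono[OF that] d by simp
    have t1: "\<bar>(X t - ca t) * ca t\<bar> \<le> d" "\<bar>(Y t - sa t) * sa t\<bar> \<le> d" "\<bar>(Y t - sa t) * ca t\<bar> \<le> d" "\<bar>(X t - ca t) * sa t\<bar> \<le> d"
      by (intro b c1; simp add: ca_def sa_def)+
    have "p t - 1 = (X t - ca t) * ca t + (Y t - sa t) * sa t"
      using cs[of t] by (simp add: p_def algebra_simps power2_eq_square)
    then show "\<bar>p t - 1\<bar> \<le> 2 * d" using t1 unfolding abs_le_iff by linarith
    have "q t = (Y t - sa t) * ca t - (X t - ca t) * sa t" by (simp add: q_def algebra_simps)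
    then show "\<bar>q t\<bar> \<le> 2 * d" using t1 unfolding abs_le_iff by linarith
  qed
  \<comment> \<open>This keeps the curve away from the origin and turns the bound 2 d for q into the
    bound 4 d for the angle.\<close>
  have p2: "p t \<ge> 1/2" if "t \<in> {0..T}" for t using pq(1)[OF that] d unfolding abs_le_iff by linarith
  define R where "R t = (p t)\<^sup>2 + (q t)\<^sup>2" for t
  have R: "R t > 0" if "t \<in> {0..T}" for t
    using p2[OF that] unfolding R_def by (intro add_pos_nonneg) auto
  define r where "r t = sqrt (R t)" for t
  define r' where "r' t = (p t * p' t + q t * q' t) / r t" for t
  define \<phi> where "\<phi> t = \<kappa> * t - \<tau> + arctan (q t / p t)" for t
  define \<phi>' where "\<phi>' t = \<kappa> + (p t * q' t - q t * p' t) / R t" for t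
  have rp: "r t > 0" "(r t)\<^sup>2 = R t" if "t \<in> {0..T}" for t using R[OF that] by (auto simp: r_def)
  have cp: "continuous_on {0..T} p" and cq: "continuous_on {0..T} q" using ac_p ac_q ac_on_continuous by auto
  have cR: "continuous_on {0..T} R" unfolding R_def[abs_def] by (intro continuous_intros cp cq)
  have ac_R: "ac_on 0 T R (\<lambda>t. 2 * (p t * p' t + q t * q' t))"
    by (rule ac_on_cong[OF ac_on_add[OF ac_on_mult[OF ac_p ac_p] ac_on_mult[OF ac_q ac_q]]])
      (simp_all add: R_def power2_eq_square)
  have "ac_on 0 T (\<lambda>t. sqrt (R t)) (\<lambda>t. inverse (sqrt (R t)) / 2 * (2 * (p t * p' t + q t * q' t)))"
  proof (rule ac_on_C1_comp[OF ac_R])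
    show "(sqrt has_real_derivative inverse (sqrt (R t)) / 2) (at (R t))" if "t \<in> {0..T}" for t
      using R[OF that] by (intro DERIV_real_sqrt)
    show "continuous_on {0..T} (\<lambda>t. inverse (sqrt (R t)) / 2)"
    proof -
      have "sqrt (R t) \<noteq> 0" if "t \<in> {0..T}" for t using R[OF that] by simp
      then show ?thesis by (intro continuous_intros cR) auto
    qed
  qed
  note ac_sqrt = this
  have halve: "inverse u / 2 * (2 * A) = A / u" for u A :: real by (cases "u = 0") (simp_all add: field_simps)
  have ac_r: "ac_on 0 T r r'"
    by (rule ac_on_cong[OF ac_sqrt]) (simp_all only: r_def r'_def halve)
  have "ac_on 0 T (\<lambda>t. arctan (q t / p t)) (\<lambda>t. (- (q t / R t)) * p' t + (p t / R t) * q' t)"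
  proof (rule ac_on_chain2[OF ac_p ac_q, where F="\<lambda>p q. arctan (q / p)"])
    fix t assume t: "t \<in> {0..T}"
    have pt: "p t > 0" using p2[OF t] by simp
    have "((\<lambda>z. snd z / fst z) has_derivative (\<lambda>h. (snd h * p t - q t * fst h) / (p t * p t))) (at (p t, q t))"
      using pt by (auto intro!: derivative_eq_intros)
    moreover have "(arctan has_derivative (*) (inverse (1 + (q t / p t)\<^sup>2))) (at (snd (p t, q t) / fst (p t, q t)))"
      using DERIV_arctan[of "q t / p t"] by (simp add: has_field_derivative_def)
    ultimately have "((\<lambda>z. arctan (snd z / fst z)) has_derivative
        (\<lambda>h. inverse (1 + (q t / p t)\<^sup>2) * ((snd h * p t - q t * fst h) / (p t * p t)))) (at (p t, q t))"
      by (rule has_derivative_compose)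
    moreover have "inverse (1 + (q t / p t)\<^sup>2) * ((y * p t - q t * x) / (p t * p t)) = - (q t / R t) * x + p t / R t * y" for x y
    proof -
      have inv: "inverse (1 + (q t / p t)\<^sup>2) = (p t * p t) / R t"
        using pt R[OF t] by (simp add: R_def field_simps power2_eq_square)
      show ?thesis unfolding inv using pt R[OF t] by (simp add: field_simps)
    qed
    ultimately show "((\<lambda>z. arctan (snd z / fst z)) has_derivative (\<lambda>h. - (q t / R t) * fst h + p t / R t * snd h)) (at (p t, q t))"
      by simp
  next
    have "R t \<noteq> 0" if "t \<in> {0..T}" for t using R[OF that] by simp
    then show "continuous_on {0..T} (\<lambda>t. - (q t / R t))" "continuous_on {0..T} (\<lambda>t. p t / R t)"
      by (intro continuous_intros cp cq cR; blast)+
  qed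
  note ac_atan = this
  have ac_lin: "ac_on 0 T (\<lambda>t. \<kappa> * t - \<tau>) (\<lambda>t. \<kappa>)"
    by (rule ac_on_C1_real) (auto intro!: derivative_eq_intros)
  have ac_\<phi>: "ac_on 0 T \<phi> \<phi>'"
    by (rule ac_on_cong[OF ac_on_add[OF ac_lin ac_atan]]) (simp_all add: \<phi>_def \<phi>'_def diff_divide_distrib)
  have main: "r t > 0 \<and> X t = r t * cos (\<phi> t) \<and> Y t = r t * sin (\<phi> t) \<and>
      X' t = r' t * cos (\<phi> t) - r t * \<phi>' t * sin (\<phi> t) \<and> Y' t = r' t * sin (\<phi> t) + r t * \<phi>' t * cos (\<phi> t) \<and>
      \<bar>r t - 1\<bar> \<le> 4 * d \<and> \<bar>\<phi> t - (\<kappa> * t - \<tau>)\<bar> \<le> 4 * d \<and>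
      (X t = cos (\<kappa> * t - \<tau>) \<and> Y t = sin (\<kappa> * t - \<tau>) \<longrightarrow> r t = 1 \<and> \<phi> t = \<kappa> * t - \<tau>)"
    if t: "t \<in> {0..T}" for t
  proof -
    have pt: "p t > 0" and Rt: "R t > 0" and rt: "r t > 0" and r2: "r t * r t = R t"
      using p2[OF t] R[OF t] rp[OF t] by (auto simp: power2_eq_square)
    have sq: "sqrt (1 + (q t / p t)\<^sup>2) = r t / p t"
    proof -
      have "1 + (q t / p t)\<^sup>2 = R t / (p t)\<^sup>2" using pt by (simp add: R_def field_simps)
      then show ?thesis using pt by (simp add: r_def real_sqrt_divide)
    qed
    have ct: "cos (arctan (q t / p t)) = p t / r t" by (simp add: cos_arctan sq)
    have st: "sin (arctan (q t / p t)) = q t / r t" using pt by (simp add: sin_arctan sq)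
    have c\<phi>: "r t * cos (\<phi> t) = p t * ca t - q t * sa t"
      unfolding \<phi>_def cos_add ct st ca_def[symmetric] sa_def[symmetric] using rt by (simp add: field_simps)
    have s\<phi>: "r t * sin (\<phi> t) = p t * sa t + q t * ca t"
      unfolding \<phi>_def sin_add ct st ca_def[symmetric] sa_def[symmetric] using rt by (simp add: field_simps)
    have XX: "X t = p t * ca t - q t * sa t" and YY: "Y t = p t * sa t + q t * ca t"
      unfolding p_def q_def using cs[of t] by algebra+
    have XX': "X' t = (p' t - \<kappa> * q t) * ca t - (q' t + \<kappa> * p t) * sa t"
      and YY': "Y' t = (p' t - \<kappa> * q t) * sa t + (q' t + \<kappa> * p t) * ca t"
      unfolding p'_def q'_def using cs[of t] by algebra+
    have rr': "r' t * r t = p t * p' t + q t * q' t" and R\<phi>': "\<phi>' t * R t = \<kappa> * R t + (p t * q' t - q t * p' t)"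
      using rt Rt by (simp_all add: r'_def \<phi>'_def field_simps)
    have e1: "R t * X' t = (r' t * r t) * (r t * cos (\<phi> t)) - (\<phi>' t * R t) * (r t * sin (\<phi> t))"
      unfolding rr' R\<phi>' c\<phi> s\<phi> XX' unfolding R_def by (simp add: algebra_simps power2_eq_square)
    have e2: "R t * Y' t = (r' t * r t) * (r t * sin (\<phi> t)) + (\<phi>' t * R t) * (r t * cos (\<phi> t))"
      unfolding rr' R\<phi>' c\<phi> s\<phi> YY' unfolding R_def by (simp add: algebra_simps power2_eq_square)
    have "R t * X' t = R t * (r' t * cos (\<phi> t) - r t * \<phi>' t * sin (\<phi> t))"
      using e1 unfolding r2[symmetric] by (simp add: algebra_simps)
    then have f1: "X' t = r' t * cos (\<phi> t) - r t * \<phi>' t * sin (\<phi> t)" using Rt by simp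
    have "R t * Y' t = R t * (r' t * sin (\<phi> t) + r t * \<phi>' t * cos (\<phi> t))"
      using e2 unfolding r2[symmetric] by (simp add: algebra_simps)
    then have f2: "Y' t = r' t * sin (\<phi> t) + r t * \<phi>' t * cos (\<phi> t)" using Rt by simp
    have g1: "\<bar>r t - 1\<bar> \<le> 4 * d"
    proof -
      have "r t \<le> \<bar>p t\<bar> + \<bar>q t\<bar>" unfolding r_def R_def by (rule sqrt_sum_squares_le_sum_abs)
      moreover have "p t \<le> r t"
        unfolding r_def R_def by (rule real_le_rsqrt) simp
      ultimately show ?thesis using pq[OF t] pt unfolding abs_le_iff by linarith
    qed
    have g2: "\<bar>\<phi> t - (\<kappa> * t - \<tau>)\<bar> \<le> 4 * d"
    proof -
      have "\<bar>q t / p t\<bar> \<le> 2 * d / (1/2)"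
        unfolding abs_divide using pq[OF t] p2[OF t] d by (intro frac_le) auto
      then have "\<bar>q t / p t\<bar> \<le> 4 * d" by simp
      moreover have "\<bar>arctan x\<bar> \<le> \<bar>x\<bar>" for x :: real
        using arctan_le_self[of x] arctan_le_self[of "- x"] by (cases "x \<ge> 0") (auto simp: arctan_minus abs_if)
      then have "\<bar>arctan (q t / p t)\<bar> \<le> \<bar>q t / p t\<bar>" .
      ultimately show ?thesis by (simp add: \<phi>_def)
    qed
    \<comment> \<open>Where the curve meets the reference point, the values are exact and not merely
      close; this transfers the end conditions.\<close>
    have "r t = 1 \<and> \<phi> t = \<kappa> * t - \<tau>" if "X t = ca t" "Y t = sa t"
    proof -
      have "p t = 1" "q t = 0" using that cs[of t] by (simp_all add: p_def q_def power2_eq_square)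
      then show ?thesis by (simp add: r_def R_def \<phi>_def)
    qed
    then show ?thesis using rt f1 f2 g1 g2 XX YY c\<phi> s\<phi> by (simp add: ca_def sa_def)
  qed
  with ac_r ac_\<phi> show ?thesis by blast
qed

section \<open>The trajectory as a normalized circular arc\<close>

lemma normalized_circle:
  fixes c \<theta>0 \<tau> t :: real
  assumes c: "c \<noteq> 0"
  defines "w \<equiv> \<theta>0 + sgn c * \<tau>"
  shows "c * sin w * ((sin (\<theta>0 + c * t) - sin \<theta>0) / c) + (- c * cos w) * ((cos \<theta>0 - cos (\<theta>0 + c * t)) / c) + cos \<tau> = cos (\<bar>c\<bar> * t - \<tau>)"
    and "sgn c * (c * sin w * ((cos \<theta>0 - cos (\<theta>0 + c * t)) / c) - (- c * cos w) * ((sin (\<theta>0 + c * t) - sin \<theta>0) / c)) + - sin \<tau> = sin (\<bar>c\<bar> * t - \<tau>)"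
    and "c * sin w * cos (\<theta>0 + c * t) + (- c * cos w) * sin (\<theta>0 + c * t) = - (\<bar>c\<bar> * sin (\<bar>c\<bar> * t - \<tau>))"
    and "sgn c * (c * sin w * sin (\<theta>0 + c * t) - (- c * cos w) * cos (\<theta>0 + c * t)) = \<bar>c\<bar> * cos (\<bar>c\<bar> * t - \<tau>)"
proof -
  define A where "A = \<theta>0 + c * t"
  have s: "sgn c = 1 \<and> \<bar>c\<bar> = c \<or> sgn c = -1 \<and> \<bar>c\<bar> = - c" using c by (auto simp: sgn_if)
  have cA: "cos (A - w) = cos (\<bar>c\<bar> * t - \<tau>)" and sA: "sgn c * sin (A - w) = sin (\<bar>c\<bar> * t - \<tau>)"
    using s by (auto simp: A_def w_def cos_diff sin_diff sin_add cos_add algebra_simps)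
  have c0: "cos (\<theta>0 - w) = cos \<tau>" and s0: "sgn c * sin (\<theta>0 - w) = - sin \<tau>"
    using s by (auto simp: w_def)
  note cA' = cA[unfolded cos_diff[of A w]] and sA' = sA[unfolded sin_diff[of A w]]
    and c0' = c0[unfolded cos_diff[of \<theta>0 w]] and s0' = s0[unfolded sin_diff[of \<theta>0 w]]
  show "c * sin w * ((sin (\<theta>0 + c * t) - sin \<theta>0) / c) + (- c * cos w) * ((cos \<theta>0 - cos (\<theta>0 + c * t)) / c) + cos \<tau> = cos (\<bar>c\<bar> * t - \<tau>)"
    unfolding A_def[symmetric] cA'[symmetric] c0'[symmetric] using c by (simp add: field_simps)
  show "sgn c * (c * sin w * ((cos \<theta>0 - cos (\<theta>0 + c * t)) / c) - (- c * cos w) * ((sin (\<theta>0 + c * t) - sin \<theta>0) / c)) + - sin \<tau> = sin (\<bar>c\<bar> * t - \<tau>)"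
    unfolding A_def[symmetric] sA'[symmetric] s0'[symmetric] using c by (simp add: field_simps)
  show "c * sin w * cos (\<theta>0 + c * t) + (- c * cos w) * sin (\<theta>0 + c * t) = - (\<bar>c\<bar> * sin (\<bar>c\<bar> * t - \<tau>))"
  proof -
    have "\<bar>c\<bar> * sin (\<bar>c\<bar> * t - \<tau>) = c * sin (A - w)" unfolding sA[symmetric] using s by auto
    then show ?thesis by (simp add: A_def[symmetric] sin_diff algebra_simps)
  qed
  show "sgn c * (c * sin w * sin (\<theta>0 + c * t) - (- c * cos w) * cos (\<theta>0 + c * t)) = \<bar>c\<bar> * cos (\<bar>c\<bar> * t - \<tau>)"
  proof -
    have "\<bar>c\<bar> = sgn c * c" using s by auto
    then show ?thesis unfolding cA'[symmetric] A_def[symmetric] by (simp add: algebra_simps)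
  qed
qed

lemma circle_moments:
  fixes \<kappa> \<tau> :: real
  assumes "\<kappa> > 0" "\<tau> > 0" "T = 2 * \<tau> / \<kappa>"
  shows "planar_moments T (\<lambda>t. cos (\<kappa> * t - \<tau>)) (\<lambda>t. - (\<kappa> * sin (\<kappa> * t - \<tau>))) (\<lambda>t. sin (\<kappa> * t - \<tau>)) (\<lambda>t. \<kappa> * cos (\<kappa> * t - \<tau>))
    = (2 * \<tau>, 0, 2 * sin \<tau>)"
proof -
  have T: "0 \<le> T" "\<kappa> * T - \<tau> = \<tau>" "\<kappa> * T = 2 * \<tau>" using assms by auto
  have full: "integral {0..T} g' = g T - g 0" if "\<And>t. (g has_real_derivative g' t) (at t)" for g g' :: "real \<Rightarrow> real"
    using that T(1) by (intro integral_unique fundamental_theorem_of_calculus)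
      (auto simp: has_real_derivative_iff_has_vector_derivative intro: has_vector_derivative_at_within)
  have e: "cos u * (\<kappa> * cos u) - sin u * - (\<kappa> * sin u) = \<kappa>" for u
    using sin_cos_squared_add[of u] by algebra
  have "integral {0..T} (\<lambda>t. - (\<kappa> * sin (\<kappa> * t - \<tau>))) = cos (\<kappa> * T - \<tau>) - cos (\<kappa> * 0 - \<tau>)"
    by (rule full) (auto intro!: derivative_eq_intros)
  moreover have "integral {0..T} (\<lambda>t. \<kappa> * cos (\<kappa> * t - \<tau>)) = sin (\<kappa> * T - \<tau>) - sin (\<kappa> * 0 - \<tau>)"
    by (rule full) (auto intro!: derivative_eq_intros)
  ultimately show ?thesis
    unfolding planar_moments_def e using T by (simp add: mult.commute)
qed

lemma ac_on_unique:
  assumes "ac_on a b f f'" "ac_on a b g f'" "f a = g a" "t \<in> {a..b}"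
  shows "f t = g t"
proof -
  have "f t - f a = g t - g a"
    using assms by (intro has_integral_unique[of f' _ "{a..t}"]) (auto simp: ac_on_def)
  then show ?thesis using assms(3) by simp
qed

lemma circle_admissible_position:
  assumes adm: "admissible T g (\<lambda>s. cos (\<theta>0 + c * s)) (\<lambda>s. sin (\<theta>0 + c * s))" and z: "g 0 = 0" and c: "c \<noteq> 0"
    and t: "t \<in> {0..T}"
  shows "fst (g t) = (sin (\<theta>0 + c * t) - sin \<theta>0) / c" "fst (snd (g t)) = (cos \<theta>0 - cos (\<theta>0 + c * t)) / c"
proof -
  have T: "T \<ge> 0" using t by auto
  note ap = admissible_planar(1,2)[OF adm T z]
  show "fst (g t) = (sin (\<theta>0 + c * t) - sin \<theta>0) / c"
  proof (rule ac_on_unique[OF ap(1) _ _ t])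
    show "ac_on 0 T (\<lambda>t. (sin (\<theta>0 + c * t) - sin \<theta>0) / c) (\<lambda>s. cos (\<theta>0 + c * s))"
      using c by (intro ac_on_C1_real) (auto intro!: derivative_eq_intros continuous_intros)
  qed (simp add: z)
  show "fst (snd (g t)) = (cos \<theta>0 - cos (\<theta>0 + c * t)) / c"
  proof (rule ac_on_unique[OF ap(2) _ _ t])
    show "ac_on 0 T (\<lambda>t. (cos \<theta>0 - cos (\<theta>0 + c * t)) / c) (\<lambda>s. sin (\<theta>0 + c * s))"
      using c by (intro ac_on_C1_real) (auto intro!: derivative_eq_intros continuous_intros)
  qed (simp add: z)
qed

lemma planar_moments_cong:
  assumes "\<And>t. t \<in> {0..T} \<Longrightarrow> x t = u t" "\<And>t. t \<in> {0..T} \<Longrightarrow> x' t = u' t"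
    "\<And>t. t \<in> {0..T} \<Longrightarrow> y t = v t" "\<And>t. t \<in> {0..T} \<Longrightarrow> y' t = v' t"
  shows "planar_moments T x x' y y' = planar_moments T u u' v v'"
  unfolding planar_moments_def using assms by (auto intro!: integral_cong)

text \<open>The similarity that maps the centre of the trajectory to the origin and the middle of the arc to angle 0.\<close>

lemma normalizing_similarity:
  fixes c \<theta>0 \<tau> :: real
  assumes c: "c \<noteq> 0" and adm: "admissible T g (\<lambda>s. cos (\<theta>0 + c * s)) (\<lambda>s. sin (\<theta>0 + c * s))" and z: "g 0 = 0"
    and \<kappa>: "\<kappa> = \<bar>c\<bar>"
  shows "\<exists>a b. \<bar>a\<bar> \<le> \<kappa> \<and> \<bar>b\<bar> \<le> \<kappa> \<and> a\<^sup>2 + b\<^sup>2 = \<kappa>\<^sup>2 \<and>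
    (\<forall>t\<in>{0..T}. a * fst (g t) + b * fst (snd (g t)) + cos \<tau> = cos (\<kappa> * t - \<tau>) \<and>
      sgn c * (a * fst (snd (g t)) - b * fst (g t)) + - sin \<tau> = sin (\<kappa> * t - \<tau>) \<and>
      a * cos (\<theta>0 + c * t) + b * sin (\<theta>0 + c * t) = - (\<kappa> * sin (\<kappa> * t - \<tau>)) \<and>
      sgn c * (a * sin (\<theta>0 + c * t) - b * cos (\<theta>0 + c * t)) = \<kappa> * cos (\<kappa> * t - \<tau>))"
proof -
  \<comment> \<open>The direction of the velocity at time \<tau> / |c|, the middle of the arc. The
    sign of c enters the similarity as a reflection, so the normalized arc runs counterclockwise in
    either case.\<close>
  define w where "w = \<theta>0 + sgn c * \<tau>"
  define a b where "a = c * sin w" and "b = - c * cos w"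
  have "\<bar>a\<bar> \<le> \<kappa>" "\<bar>b\<bar> \<le> \<kappa>" by (auto simp: a_def b_def \<kappa> abs_mult mult_left_le)
  moreover have "a\<^sup>2 + b\<^sup>2 = \<kappa>\<^sup>2"
  proof -
    have "a\<^sup>2 + b\<^sup>2 = c\<^sup>2 * ((sin w)\<^sup>2 + (cos w)\<^sup>2)" unfolding a_def b_def by algebra
    then show ?thesis by (simp add: \<kappa>)
  qed
  moreover have "a * fst (g t) + b * fst (snd (g t)) + cos \<tau> = cos (\<kappa> * t - \<tau>) \<and>
      sgn c * (a * fst (snd (g t)) - b * fst (g t)) + - sin \<tau> = sin (\<kappa> * t - \<tau>) \<and>
      a * cos (\<theta>0 + c * t) + b * sin (\<theta>0 + c * t) = - (\<kappa> * sin (\<kappa> * t - \<tau>)) \<and>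
      sgn c * (a * sin (\<theta>0 + c * t) - b * cos (\<theta>0 + c * t)) = \<kappa> * cos (\<kappa> * t - \<tau>)"
    if "t \<in> {0..T}" for t
    unfolding circle_admissible_position[OF adm z c that] a_def b_def w_def \<kappa>
    by (intro conjI normalized_circle[OF c])
  ultimately show ?thesis by blast
qed

text \<open>The similarity multiplies lengths by \<kappa> = |c| and turns equality of end points in
  the group into the constraints of \<open>arc_competitor\<close>, so minimality in polar
  coordinates is inherited by the lifted curve.\<close>

lemma arc_locally_optimal:
  fixes c \<theta>0 \<tau> T :: real
  assumes c: "c \<noteq> 0" and adm: "admissible T g (\<lambda>s. cos (\<theta>0 + c * s)) (\<lambda>s. sin (\<theta>0 + c * s))" and z: "g 0 = 0"
    and \<tau>: "5 * pi / 4 \<le> \<tau>" "\<tau> < 3 * pi / 2" and neg: "conj_fun \<tau> < 0" and T: "T = 2 * \<tau> / \<bar>c\<bar>"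
  shows "locally_optimal T g"
proof -
  define \<kappa> where "\<kappa> = \<bar>c\<bar>"
  have \<kappa>: "\<kappa> > 0" "T = 2 * \<tau> / \<kappa>" using c T by (auto simp: \<kappa>_def)
  have \<tau>0: "\<tau> > 0" using \<tau> pi_gt3 by linarith
  have T0: "T \<ge> 0" and \<kappa>T: "\<kappa> * T - \<tau> = \<tau>" using \<kappa> \<tau>0 by auto
  obtain \<delta> where \<delta>: "\<delta> > 0" and min: "\<And>T \<kappa> r r' \<phi> \<phi>'. arc_competitor \<tau> \<delta> \<kappa> T r r' \<phi> \<phi>' \<Longrightarrow>
    2 * \<tau> \<le> integral {0..T} (\<lambda>t. sqrt ((r' t)\<^sup>2 + (r t * \<phi>' t)\<^sup>2))"
    using arc_minimal_polar[OF \<tau> neg] by blast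
  \<comment> \<open>The passage to polar coordinates demands d <= 1/4 and loses a factor 4.\<close>
  define d where "d = min (1/4) (\<delta>/4)"
  have d: "0 < d" "d \<le> 1/4" "4 * d \<le> \<delta>"
  proof -
    show "0 < d" using \<delta> by (simp add: d_def)
    show "d \<le> 1/4" "4 * d \<le> \<delta>" unfolding d_def by linarith+
  qed
  \<comment> \<open>A normalized coordinate combines two deviations with coefficients of size at
    most \<kappa>, hence moves by at most 2 \<kappa> \<epsilon> = d.\<close>
  define \<epsilon> where "\<epsilon> = d / (2 * \<kappa>)"
  have \<epsilon>: "\<epsilon> > 0" "2 * (\<kappa> * \<epsilon>) = d" using d \<kappa> by (auto simp: \<epsilon>_def)
  have \<sigma>: "(sgn c)\<^sup>2 = 1" using c by (simp add: sgn_if)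
  obtain a b where ab: "\<bar>a\<bar> \<le> \<kappa>" "\<bar>b\<bar> \<le> \<kappa>" "a\<^sup>2 + b\<^sup>2 = \<kappa>\<^sup>2"
    and sim: "\<And>t. t \<in> {0..T} \<Longrightarrow> a * fst (g t) + b * fst (snd (g t)) + cos \<tau> = cos (\<kappa> * t - \<tau>) \<and>
      sgn c * (a * fst (snd (g t)) - b * fst (g t)) + - sin \<tau> = sin (\<kappa> * t - \<tau>) \<and>
      a * cos (\<theta>0 + c * t) + b * sin (\<theta>0 + c * t) = - (\<kappa> * sin (\<kappa> * t - \<tau>)) \<and>
      sgn c * (a * sin (\<theta>0 + c * t) - b * cos (\<theta>0 + c * t)) = \<kappa> * cos (\<kappa> * t - \<tau>)"
    using normalizing_similarity[OF c adm z \<kappa>_def, of \<tau>] by blast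
  let ?u1 = "\<lambda>s. cos (\<theta>0 + c * s)" and ?u2 = "\<lambda>s. sin (\<theta>0 + c * s)"
  let ?x = "\<lambda>t. fst (g t)" and ?y = "\<lambda>t. fst (snd (g t))"
  have circ: "a * ?x t + b * ?y t + cos \<tau> = cos (\<kappa> * t - \<tau>)" "sgn c * (a * ?y t - b * ?x t) + - sin \<tau> = sin (\<kappa> * t - \<tau>)"
    "a * ?u1 t + b * ?u2 t = - (\<kappa> * sin (\<kappa> * t - \<tau>))" "sgn c * (a * ?u2 t - b * ?u1 t) = \<kappa> * cos (\<kappa> * t - \<tau>)"
    if "t \<in> {0..T}" for t
    using sim[OF that] by blast+
  note gp = admissible_planar[OF adm T0 z]
  have main: "T \<le> sr_length T v1 v2"
    if ad: "admissible T \<eta> v1 v2" and e0: "\<eta> 0 = g 0" and eT: "\<eta> T = g T" and cl: "\<forall>s\<in>{0..T}. dist (\<eta> s) (g s) < \<epsilon>"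
    for \<eta> v1 v2
  proof -
    have z': "\<eta> 0 = 0" using e0 z by simp
    note hp = admissible_planar[OF ad T0 z']
    let ?p = "\<lambda>t. fst (\<eta> t)" and ?q = "\<lambda>t. fst (snd (\<eta> t))"
    have momeq: "planar_moments T ?p v1 ?q v2 = planar_moments T ?x ?u1 ?y ?u2"
    proof -
      obtain A W V A2 W2 V2 where m: "planar_moments T ?p v1 ?q v2 = (A, W, V)" "planar_moments T ?x ?u1 ?y ?u2 = (A2, W2, V2)"
        and e: "\<eta> T = (?p T, ?q T, A / 2, V / 2, - (W / 2))" "g T = (?x T, ?y T, A2 / 2, V2 / 2, - (W2 / 2))"
        using hp(3) gp(3) by blast
      show ?thesis using e eT unfolding m by (simp add: prod_eq_iff)
    qed
    define X where "X t = a * ?p t + b * ?q t + cos \<tau>" for t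
    define Y where "Y t = sgn c * (a * ?q t - b * ?p t) + - sin \<tau>" for t
    define X' where "X' t = a * v1 t + b * v2 t" for t
    define Y' where "Y' t = sgn c * (a * v2 t - b * v1 t)" for t
    have "planar_moments T X X' Y Y' = planar_moments T (\<lambda>t. a * ?x t + b * ?y t + cos \<tau>) (\<lambda>t. a * ?u1 t + b * ?u2 t)
        (\<lambda>t. sgn c * (a * ?y t - b * ?x t) + - sin \<tau>) (\<lambda>t. sgn c * (a * ?u2 t - b * ?u1 t))"
      unfolding X_def[abs_def] Y_def[abs_def] X'_def[abs_def] Y'_def[abs_def]
      by (rule similar_moments_eq[OF T0 hp(1,2) gp(1,2) \<sigma> _ _ _ _ momeq]) (simp_all add: e0 eT)
    also have "\<dots> = planar_moments T (\<lambda>t. cos (\<kappa> * t - \<tau>)) (\<lambda>t. - (\<kappa> * sin (\<kappa> * t - \<tau>))) (\<lambda>t. sin (\<kappa> * t - \<tau>)) (\<lambda>t. \<kappa> * cos (\<kappa> * t - \<tau>))"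
      by (rule planar_moments_cong) (rule circ, assumption)+
    also have "\<dots> = (2 * \<tau>, 0, 2 * sin \<tau>)" by (rule circle_moments[OF \<kappa>(1) \<tau>0 \<kappa>(2)])
    finally have mom: "planar_moments T X X' Y Y' = (2 * \<tau>, 0, 2 * sin \<tau>)" .
    have acX: "ac_on 0 T X X'"
      by (rule ac_on_cong[OF ac_on_add[OF ac_on_add[OF ac_on_cmult[OF hp(1), of a] ac_on_cmult[OF hp(2), of b]] ac_on_const[of 0 T "cos \<tau>"]]])
        (simp_all add: X_def X'_def)
    have acY: "ac_on 0 T Y Y'"
      by (rule ac_on_cong[OF ac_on_add[OF ac_on_cmult[OF ac_on_add[OF ac_on_cmult[OF hp(2), of a] ac_on_cmult[OF hp(1), of "- b"]], of "sgn c"] ac_on_const[of 0 T "- sin \<tau>"]]])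
        (simp_all add: Y_def Y'_def)
    have close: "\<bar>X t - cos (\<kappa> * t - \<tau>)\<bar> \<le> d \<and> \<bar>Y t - sin (\<kappa> * t - \<tau>)\<bar> \<le> d" if t: "t \<in> {0..T}" for t
    proof -
      have n: "norm (\<eta> t - g t) < \<epsilon>" using cl t by (simp add: dist_norm)
      have "norm (fst (\<eta> t - g t)) \<le> norm (\<eta> t - g t)" "norm (fst (snd (\<eta> t - g t))) \<le> norm (snd (\<eta> t - g t))"
        "norm (snd (\<eta> t - g t)) \<le> norm (\<eta> t - g t)" by (metis norm_fst_le norm_snd_le prod.collapse)+
      then have x1: "\<bar>?p t - ?x t\<bar> \<le> \<epsilon>" and y1: "\<bar>?q t - ?y t\<bar> \<le> \<epsilon>" using n by auto
      have m: "\<bar>u * v\<bar> \<le> \<kappa> * \<epsilon>" if "\<bar>u\<bar> \<le> \<kappa>" "\<bar>v\<bar> \<le> \<epsilon>" for u v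
        unfolding abs_mult using that \<kappa> by (intro mult_mono) auto
      have "X t - cos (\<kappa> * t - \<tau>) = a * (?p t - ?x t) + b * (?q t - ?y t)"
        unfolding X_def circ(1)[OF t, symmetric] by (simp add: algebra_simps)
      also have "\<bar>\<dots>\<bar> \<le> \<kappa> * \<epsilon> + \<kappa> * \<epsilon>"
        by (rule order_trans[OF abs_triangle_ineq add_mono[OF m[OF ab(1) x1] m[OF ab(2) y1]]])
      finally have A: "\<bar>X t - cos (\<kappa> * t - \<tau>)\<bar> \<le> d" using \<epsilon>(2) by linarith
      have "Y t - sin (\<kappa> * t - \<tau>) = sgn c * (a * (?q t - ?y t) + - b * (?p t - ?x t))"
        unfolding Y_def circ(2)[OF t, symmetric] by (simp add: algebra_simps)
      also have "\<bar>\<dots>\<bar> = \<bar>a * (?q t - ?y t) + - b * (?p t - ?x t)\<bar>" using c by (simp add: abs_mult sgn_if)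
      also have "\<dots> \<le> \<kappa> * \<epsilon> + \<kappa> * \<epsilon>"
        using m[OF ab(1) y1] m[OF _ x1, of "- b"] ab(2) by (intro order_trans[OF abs_triangle_ineq add_mono]) auto
      finally have "\<bar>Y t - sin (\<kappa> * t - \<tau>)\<bar> \<le> d" using \<epsilon>(2) by linarith
      with A show ?thesis by simp
    qed
    obtain r r' \<phi> \<phi>' where ac: "ac_on 0 T r r'" "ac_on 0 T \<phi> \<phi>'"
      and pol0: "\<forall>t\<in>{0..T}. r t > 0 \<and> X t = r t * cos (\<phi> t) \<and> Y t = r t * sin (\<phi> t) \<and>
      X' t = r' t * cos (\<phi> t) - r t * \<phi>' t * sin (\<phi> t) \<and> Y' t = r' t * sin (\<phi> t) + r t * \<phi>' t * cos (\<phi> t) \<and>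
      \<bar>r t - 1\<bar> \<le> 4 * d \<and> \<bar>\<phi> t - (\<kappa> * t - \<tau>)\<bar> \<le> 4 * d \<and>
      (X t = cos (\<kappa> * t - \<tau>) \<and> Y t = sin (\<kappa> * t - \<tau>) \<longrightarrow> r t = 1 \<and> \<phi> t = \<kappa> * t - \<tau>)"
      using polar_coordinates[OF acX acY less_imp_le[OF d(1)] d(2) close] by blast
    note pol = bspec[OF pol0]
    have zT: "0 \<in> {0..T}" "T \<in> {0..T}" using T0 by auto
    have end0: "r 0 = 1" "\<phi> 0 = - \<tau>"
      using pol[OF zT(1)] circ(1,2)[OF zT(1)] by (auto simp: X_def Y_def e0)
    have endT: "r T = 1" "\<phi> T = \<tau>"
      using pol[OF zT(2)] circ(1,2)[OF zT(2)] \<kappa>T by (auto simp: X_def Y_def eT)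
    have cX: "continuous_on {0..T} X" and cY: "continuous_on {0..T} Y" and cr: "continuous_on {0..T} r" and c\<phi>: "continuous_on {0..T} \<phi>"
      using acX acY ac ac_on_continuous by auto
    have c2: "continuous_on {0..T} (\<lambda>t. (X t)\<^sup>2 + (Y t)\<^sup>2)" by (intro continuous_intros cX cY)
    have "(\<lambda>t. X t * Y' t - Y t * X' t) integrable_on {0..T}"
      by (intro integrable_diff ac_on_times_integrable[OF cX acY] ac_on_times_integrable[OF cY acX])
    then have i1: "((\<lambda>t. X t * Y' t - Y t * X' t) has_integral 2 * \<tau>) {0..T}"
      using mom by (auto simp: planar_moments_def has_integral_integrable_integral)
    have i2: "((\<lambda>t. ((X t)\<^sup>2 + (Y t)\<^sup>2) * X' t) has_integral 0) {0..T}"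
      using ac_on_times_integrable[OF c2 acX] mom by (auto simp: planar_moments_def has_integral_integrable_integral)
    have i3: "((\<lambda>t. ((X t)\<^sup>2 + (Y t)\<^sup>2) * Y' t) has_integral 2 * sin \<tau>) {0..T}"
      using ac_on_times_integrable[OF c2 acY] mom by (auto simp: planar_moments_def has_integral_integrable_integral)
    have R2: "(X t)\<^sup>2 + (Y t)\<^sup>2 = (r t)\<^sup>2" if "t \<in> {0..T}" for t
    proof -
      have "(X t)\<^sup>2 + (Y t)\<^sup>2 = (r t)\<^sup>2 * ((cos (\<phi> t))\<^sup>2 + (sin (\<phi> t))\<^sup>2)" using pol[OF that] by algebra
      then show ?thesis by simp
    qed
    have area: "((\<lambda>t. (r t)\<^sup>2 * \<phi>' t) has_integral 2 * \<tau>) {0..T}"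
    proof (rule has_integral_eq[OF _ i1])
      fix t assume "t \<in> {0..T}"
      note p = pol[OF this]
      have "X t * Y' t - Y t * X' t = (r t)\<^sup>2 * \<phi>' t * ((sin (\<phi> t))\<^sup>2 + (cos (\<phi> t))\<^sup>2)" using p by algebra
      then show "X t * Y' t - Y t * X' t = (r t)\<^sup>2 * \<phi>' t" by simp
    qed
    \<comment> \<open>The group prescribes the integrals of r^2 dX and r^2 dY, the calibration uses
      those of r^3 cos \<phi> d\<phi> and r^3 sin \<phi> d\<phi>. They are related through the exact
      differentials of r^3 cos \<phi> and r^3 sin \<phi>, whose boundary values are known.\<close>
    have ps: "ac_on 0 T (\<lambda>t. (r t)^3 * sin (\<phi> t)) (\<lambda>t. (3 * (r t)\<^sup>2 * sin (\<phi> t)) * r' t + ((r t)^3 * cos (\<phi> t)) * \<phi>' t)"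
      by (rule ac_on_chain2[OF ac, where F="\<lambda>r \<phi>. r^3 * sin \<phi>"])
        (auto intro!: derivative_eq_intros continuous_intros cr c\<phi> simp: algebra_simps)
    have pc: "ac_on 0 T (\<lambda>t. (r t)^3 * cos (\<phi> t)) (\<lambda>t. (3 * (r t)\<^sup>2 * cos (\<phi> t)) * r' t + (- ((r t)^3 * sin (\<phi> t))) * \<phi>' t)"
      by (rule ac_on_chain2[OF ac, where F="\<lambda>r \<phi>. r^3 * cos \<phi>"])
        (auto intro!: derivative_eq_intros continuous_intros cr c\<phi> simp: algebra_simps)
    have isn: "((\<lambda>t. (3 * (r t)\<^sup>2 * sin (\<phi> t)) * r' t + ((r t)^3 * cos (\<phi> t)) * \<phi>' t) has_integral 2 * sin \<tau>) {0..T}"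
      using ac_on_has_integral[OF ps order_refl T0 order_refl] by (simp add: end0 endT)
    have ics: "((\<lambda>t. (3 * (r t)\<^sup>2 * cos (\<phi> t)) * r' t + (- ((r t)^3 * sin (\<phi> t))) * \<phi>' t) has_integral 0) {0..T}"
      using ac_on_has_integral[OF pc order_refl T0 order_refl] by (simp add: end0 endT)
    \<comment> \<open>The relation is 3 r^2 dY - d(r^3 sin \<phi>) = 2 r^3 cos \<phi> d\<phi>; for
      \<open>ms\<close> it is d(r^3 cos \<phi>) - 3 r^2 dX = 2 r^3 sin \<phi> d\<phi>.\<close>
    have mc: "((\<lambda>t. (r t)^3 * cos (\<phi> t) * \<phi>' t) has_integral 2 * sin \<tau>) {0..T}"
    proof -
      have "((\<lambda>t. 1/2 * (3 * (((X t)\<^sup>2 + (Y t)\<^sup>2) * Y' t) - ((3 * (r t)\<^sup>2 * sin (\<phi> t)) * r' t + ((r t)^3 * cos (\<phi> t)) * \<phi>' t)))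
          has_integral 1/2 * (3 * (2 * sin \<tau>) - 2 * sin \<tau>)) {0..T}"
        by (intro has_integral_mult_right has_integral_diff i3 isn)
      then have "((\<lambda>t. (r t)^3 * cos (\<phi> t) * \<phi>' t) has_integral 1/2 * (3 * (2 * sin \<tau>) - 2 * sin \<tau>)) {0..T}"
      proof (rule has_integral_eq[rotated])
        fix t assume t: "t \<in> {0..T}"
        have e: "Y' t = r' t * sin (\<phi> t) + r t * \<phi>' t * cos (\<phi> t)" using pol[OF t] by blast
        show "1/2 * (3 * (((X t)\<^sup>2 + (Y t)\<^sup>2) * Y' t) - ((3 * (r t)\<^sup>2 * sin (\<phi> t)) * r' t + ((r t)^3 * cos (\<phi> t)) * \<phi>' t)) = (r t)^3 * cos (\<phi> t) * \<phi>' t"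
          unfolding R2[OF t] e by (simp add: field_simps power2_eq_square power3_eq_cube)
      qed
      then show ?thesis by simp
    qed
    have ms: "((\<lambda>t. (r t)^3 * sin (\<phi> t) * \<phi>' t) has_integral 0) {0..T}"
    proof -
      have "((\<lambda>t. 1/2 * (((3 * (r t)\<^sup>2 * cos (\<phi> t)) * r' t + (- ((r t)^3 * sin (\<phi> t))) * \<phi>' t) - 3 * (((X t)\<^sup>2 + (Y t)\<^sup>2) * X' t)))
          has_integral 1/2 * (0 - 3 * 0)) {0..T}"
        by (intro has_integral_mult_right has_integral_diff i2 ics)
      then have "((\<lambda>t. (r t)^3 * sin (\<phi> t) * \<phi>' t) has_integral 1/2 * (0 - 3 * 0)) {0..T}"
      proof (rule has_integral_eq[rotated])
        fix t assume t: "t \<in> {0..T}"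
        have e: "X' t = r' t * cos (\<phi> t) - r t * \<phi>' t * sin (\<phi> t)" using pol[OF t] by blast
        show "1/2 * (((3 * (r t)\<^sup>2 * cos (\<phi> t)) * r' t + (- ((r t)^3 * sin (\<phi> t))) * \<phi>' t) - 3 * (((X t)\<^sup>2 + (Y t)\<^sup>2) * X' t)) = (r t)^3 * sin (\<phi> t) * \<phi>' t"
          unfolding R2[OF t] e by (simp add: field_simps power2_eq_square power3_eq_cube)
      qed
      then show ?thesis by simp
    qed
    have "2 * \<tau> \<le> integral {0..T} (\<lambda>t. sqrt ((r' t)\<^sup>2 + (r t * \<phi>' t)\<^sup>2))"
    proof (rule min[where \<kappa>=\<kappa> and \<phi>=\<phi>])
      have "\<forall>t\<in>{0..T}. \<bar>r t - 1\<bar> \<le> \<delta> \<and> \<bar>\<phi> t - (\<kappa> * t - \<tau>)\<bar> \<le> \<delta>"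
      proof
        fix t assume t: "t \<in> {0..T}"
        have "\<bar>r t - 1\<bar> \<le> 4 * d" "\<bar>\<phi> t - (\<kappa> * t - \<tau>)\<bar> \<le> 4 * d" using pol[OF t] by blast+
        then show "\<bar>r t - 1\<bar> \<le> \<delta> \<and> \<bar>\<phi> t - (\<kappa> * t - \<tau>)\<bar> \<le> \<delta>" using d(3) by linarith
      qed
      then show "arc_competitor \<tau> \<delta> \<kappa> T r r' \<phi> \<phi>'"
        unfolding arc_competitor_def
        by (intro conjI \<kappa> ac end0 endT area mc ms)
    qed
    also have "\<dots> = integral {0..T} (\<lambda>t. \<kappa> * sqrt ((v1 t)\<^sup>2 + (v2 t)\<^sup>2))"
    proof (rule integral_cong)
      fix t assume t: "t \<in> {0..T}"
      note p = pol[OF t]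
      have "(X' t)\<^sup>2 + (Y' t)\<^sup>2 = ((r' t)\<^sup>2 + (r t * \<phi>' t)\<^sup>2) * ((sin (\<phi> t))\<^sup>2 + (cos (\<phi> t))\<^sup>2)" using p by algebra
      then have "(r' t)\<^sup>2 + (r t * \<phi>' t)\<^sup>2 = (X' t)\<^sup>2 + (Y' t)\<^sup>2" by simp
      also have "\<dots> = \<kappa>\<^sup>2 * ((v1 t)\<^sup>2 + (v2 t)\<^sup>2)"
        unfolding X'_def Y'_def ab(3)[symmetric] using \<sigma> by algebra
      finally show "sqrt ((r' t)\<^sup>2 + (r t * \<phi>' t)\<^sup>2) = \<kappa> * sqrt ((v1 t)\<^sup>2 + (v2 t)\<^sup>2)"
        using \<kappa> by (simp add: real_sqrt_mult)
    qed
    also have "\<dots> = \<kappa> * sr_length T v1 v2" by (simp add: sr_length_def)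
    finally have "\<kappa> * T \<le> \<kappa> * sr_length T v1 v2" using \<kappa>T by linarith
    then show "T \<le> sr_length T v1 v2" using \<kappa>(1) by simp
  qed
  have len: "sr_length T ?u1 ?u2 = T"
    unfolding sr_length_def using T0 by simp
  show ?thesis
    unfolding locally_optimal_def
    by (rule exI[of _ ?u1], rule exI[of _ ?u2]) (use adm \<epsilon>(1) main len in auto)
qed

section \<open>Local optimality in the Cartan group\<close>

text \<open>The zero extensions of the two parts to the line are measurable, and their sum is the
  zero extension of the spliced function; the half-open second interval keeps the supports
  disjoint.\<close>

lemma splice_measurable:
  fixes v u :: "real \<Rightarrow> real"
  assumes v: "v \<in> borel_measurable (lebesgue_on {0..S})" and u: "u \<in> borel_measurable (lebesgue_on {0..T})"
    and S: "0 < S" "S \<le> T"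
  shows "(\<lambda>s. if s \<le> S then v s else u s) \<in> borel_measurable (lebesgue_on {0..T})"
proof (rule borel_measurable_if_D)
  have "u \<in> borel_measurable (lebesgue_on {S<..T})"
    by (rule measurable_restrict_mono[OF u]) (use S in auto)
  then have "(\<lambda>x. (if x \<in> {0..S} then v x else 0) + (if x \<in> {S<..T} then u x else 0)) \<in> borel_measurable lebesgue"
    using v by (intro borel_measurable_add borel_measurable_if_I) auto
  moreover have "(if x \<in> {0..S} then v x else 0) + (if x \<in> {S<..T} then u x else 0) =
      (if x \<in> {0..T} then (if x \<le> S then v x else u x) else 0)" for x
    using S by auto
  ultimately show "(\<lambda>x. if x \<in> {0..T} then (if x \<le> S then v x else u x) else 0) \<in> borel_measurable lebesgue"
    by simp
qed

lemma splice_bounded: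
  fixes v u :: "real \<Rightarrow> real"
  assumes "bounded (v ` {0..S})" "bounded (u ` {0..T})"
  shows "bounded ((\<lambda>s. if s \<le> S then v s else u s) ` {0..T})"
proof (rule bounded_subset)
  show "bounded (v ` {0..S} \<union> u ` {0..T})" using assms by simp
qed auto

lemma admissible_restrict:
  assumes "admissible T \<gamma> u1 u2" "S \<le> T"
  shows "admissible S \<gamma> u1 u2"
proof -
  have sub: "{0..S} \<subseteq> {0..T}" using assms(2) by auto
  show ?thesis
    using assms(1) sub measurable_restrict_mono[OF _ sub] bounded_subset[OF _ image_mono[OF sub]]
    unfolding admissible_def by blast
qed

lemma admissible_splice:
  assumes \<eta>: "admissible S \<eta> v1 v2" and \<gamma>: "admissible T \<gamma> u1 u2" and S: "0 < S" "S \<le> T"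
    and e: "\<eta> 0 = \<gamma> 0" "\<eta> S = \<gamma> S"
  shows "admissible T (\<lambda>s. if s \<le> S then \<eta> s else \<gamma> s) (\<lambda>s. if s \<le> S then v1 s else u1 s) (\<lambda>s. if s \<le> S then v2 s else u2 s)"
    (is "admissible T ?n ?w1 ?w2")
  unfolding admissible_def
proof (intro conjI ballI)
  show "?w1 \<in> borel_measurable (lebesgue_on {0..T})" "?w2 \<in> borel_measurable (lebesgue_on {0..T})"
    using \<eta> \<gamma> S unfolding admissible_def by (blast intro: splice_measurable)+
  show "bounded (?w1 ` {0..T})" "bounded (?w2 ` {0..T})"
    using \<eta> \<gamma> unfolding admissible_def by (blast intro: splice_bounded)+
  let ?f = "\<lambda>s. ?w1 s *\<^sub>R X1 (?n s) + ?w2 s *\<^sub>R X2 (?n s)"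
  have I1: "(?f has_integral (\<eta> t - \<eta> 0)) {0..t}" if "t \<in> {0..S}" for t
  proof (rule has_integral_eq)
    show "((\<lambda>s. v1 s *\<^sub>R X1 (\<eta> s) + v2 s *\<^sub>R X2 (\<eta> s)) has_integral (\<eta> t - \<eta> 0)) {0..t}"
      using \<eta> that by (auto simp: admissible_def)
  qed (use that in auto)
  fix t assume t: "t \<in> {0..T}"
  show "(?f has_integral (?n t - ?n 0)) {0..t}"
  proof (cases "t \<le> S")
    case True
    then show ?thesis using I1[of t] t S by simp
  next
    case False
    let ?h = "\<lambda>s. u1 s *\<^sub>R X1 (\<gamma> s) + u2 s *\<^sub>R X2 (\<gamma> s)"
    have A: "(?h has_integral (\<gamma> S - \<gamma> 0)) {0..S}" and B: "(?h has_integral (\<gamma> t - \<gamma> 0)) {0..t}"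
      using \<gamma> t S by (auto simp: admissible_def)
    have "?h integrable_on {S..t}"
      using B S False by (meson has_integral_integrable integrable_on_subinterval atLeastatMost_subset_iff less_imp_le order_refl)
    then obtain j where j: "(?h has_integral j) {S..t}" by blast
    have "(\<gamma> S - \<gamma> 0) + j = \<gamma> t - \<gamma> 0"
      using has_integral_unique[OF has_integral_combine[OF _ _ A j] B] S False by simp
    then have j': "j = \<gamma> t - \<gamma> S" by (simp add: algebra_simps)
    \<comment> \<open>On this interval the integrands differ at most at S, where the spliced curve
      still takes the first branch.\<close>
    have "(?f has_integral j) {S..t}"
      by (rule has_integral_spike_finite[OF _ _ j, of "{S}"]) auto
    moreover have "(?f has_integral (\<eta> S - \<eta> 0)) {0..S}" using I1[of S] S by simp
    ultimately have "(?f has_integral ((\<eta> S - \<eta> 0) + j)) {0..t}"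
      using S False by (intro has_integral_combine[of 0 S t]) auto
    then show ?thesis using S False e by (simp add: j')
  qed
qed

text \<open>A shorter competitor on [0, S], continued by the trajectory, would be a shorter
  competitor on [0, T]. The tail does not move, so the same radius of the neighbourhood
  works.\<close>

lemma locally_optimal_shorter:
  assumes opt: "locally_optimal T \<gamma>" and S: "0 < S" "S \<le> T"
  shows "locally_optimal S \<gamma>"
proof -
  obtain u1 u2 \<epsilon> where u: "admissible T \<gamma> u1 u2" and \<epsilon>: "\<epsilon> > 0"
    and min: "\<And>\<eta> v1 v2. admissible T \<eta> v1 v2 \<Longrightarrow> \<eta> 0 = \<gamma> 0 \<Longrightarrow> \<eta> T = \<gamma> T \<Longrightarrow>
        (\<forall>s\<in>{0..T}. dist (\<eta> s) (\<gamma> s) < \<epsilon>) \<Longrightarrow> sr_length T u1 u2 \<le> sr_length T v1 v2"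
    using opt unfolding locally_optimal_def by metis
  have spd: "(\<lambda>s. sqrt ((w1 s)\<^sup>2 + (w2 s)\<^sup>2)) integrable_on {0..R}" if "admissible R \<zeta> w1 w2" for R \<zeta> w1 w2
    using that by (intro speed_integrable) (auto simp: admissible_def)
  have split: "sr_length T w1 w2 = sr_length S w1 w2 + integral {S..T} (\<lambda>s. sqrt ((w1 s)\<^sup>2 + (w2 s)\<^sup>2))"
    if "admissible T \<zeta> w1 w2" for \<zeta> w1 w2
    unfolding sr_length_def using spd[OF that] S by (intro Henstock_Kurzweil_Integration.integral_combine[symmetric]) auto
  have "sr_length S u1 u2 \<le> sr_length S v1 v2"
    if \<eta>: "admissible S \<eta> v1 v2" "\<eta> 0 = \<gamma> 0" "\<eta> S = \<gamma> S" "\<forall>s\<in>{0..S}. dist (\<eta> s) (\<gamma> s) < \<epsilon>" for \<eta> v1 v2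
  proof -
    let ?n = "\<lambda>s. if s \<le> S then \<eta> s else \<gamma> s"
    let ?w1 = "\<lambda>s. if s \<le> S then v1 s else u1 s"
    let ?w2 = "\<lambda>s. if s \<le> S then v2 s else u2 s"
    have ad: "admissible T ?n ?w1 ?w2" by (rule admissible_splice[OF \<eta>(1) u S \<eta>(2,3)])
    have "sr_length T u1 u2 \<le> sr_length T ?w1 ?w2"
      using \<eta> S \<epsilon> by (intro min[OF ad]) auto
    moreover have "sr_length S ?w1 ?w2 = sr_length S v1 v2"
      unfolding sr_length_def by (rule integral_cong) simp
    moreover have "integral {S..T} (\<lambda>s. sqrt ((?w1 s)\<^sup>2 + (?w2 s)\<^sup>2)) = integral {S..T} (\<lambda>s. sqrt ((u1 s)\<^sup>2 + (u2 s)\<^sup>2))"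
      by (rule integral_spike[of "{S}"]) auto
    ultimately show ?thesis using split[OF ad] split[OF u] by simp
  qed
  then show ?thesis
    unfolding locally_optimal_def using admissible_restrict[OF u S(2)] \<epsilon> by blast
qed

section \<open>Lifting the shorter arc to a competitor near the trajectory\<close>

lemma close_controls:
  assumes \<eta>: "admissible T \<eta> v1 v2" "\<eta> 0 = 0" and \<gamma>: "admissible T \<gamma> u1 u2" "\<gamma> 0 = 0" and T: "T > 0"
    and d: "0 \<le> d" "d \<le> 1"
    and cl: "\<And>s. s \<in> {0..T} \<Longrightarrow> \<bar>v1 s - u1 s\<bar> \<le> d \<and> \<bar>v2 s - u2 s\<bar> \<le> d \<and> \<bar>u1 s\<bar> \<le> 1 \<and> \<bar>u2 s\<bar> \<le> 1"
    and t: "t \<in> {0..T}"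
  shows "dist (\<eta> t) (\<gamma> t) \<le> T * (2 + 3 * T + 14 * T\<^sup>2) * d"
proof -
  have T0: "T \<ge> 0" using T by simp
  note pe = admissible_planar(1,2)[OF \<eta>(1) T0 \<eta>(2)] and pg = admissible_planar(1,2)[OF \<gamma>(1) T0 \<gamma>(2)]
  let ?p = "\<lambda>t. fst (\<eta> t)" and ?q = "\<lambda>t. fst (snd (\<eta> t))" and ?x = "\<lambda>t. fst (\<gamma> t)" and ?y = "\<lambda>t. fst (snd (\<gamma> t))"
  have bnd: "\<bar>h s\<bar> \<le> T * B" if h: "ac_on 0 T h h'" "h 0 = 0" and B: "\<And>s. s \<in> {0..T} \<Longrightarrow> \<bar>h' s\<bar> \<le> B" "B \<ge> 0"
    and s: "s \<in> {0..T}" for h h' :: "real \<Rightarrow> real" and B s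
  proof -
    have "(h' has_integral h s) {0..s}" using h s by (auto simp: ac_on_def)
    then have "norm (h s) \<le> B * measure lborel {0..s}"
      by (rule has_integral_bound_real[OF B(2) finite.emptyI]) (use B s in auto)
    also have "\<dots> \<le> T * B" using s B(2) by (simp add: mult.commute[of T] mult_left_mono)
    finally show ?thesis by simp
  qed
  have v2: "\<bar>v1 s\<bar> \<le> 2" "\<bar>v2 s\<bar> \<le> 2" if "s \<in> {0..T}" for s using cl[OF that] d unfolding abs_le_iff by linarith+
  have x: "\<bar>?x s\<bar> \<le> T" "\<bar>?y s\<bar> \<le> T" if "s \<in> {0..T}" for s
    using bnd[OF pg(1) _ _ _ that, of 1] bnd[OF pg(2) _ _ _ that, of 1] cl \<gamma>(2) by auto
  have p: "\<bar>?p s\<bar> \<le> 2 * T" "\<bar>?q s\<bar> \<le> 2 * T" if "s \<in> {0..T}" for s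
    using bnd[OF pe(1) _ _ _ that, of 2] bnd[OF pe(2) _ _ _ that, of 2] v2 \<eta>(2) by auto
  have D: "\<bar>?p s - ?x s\<bar> \<le> T * d" "\<bar>?q s - ?y s\<bar> \<le> T * d" if s: "s \<in> {0..T}" for s
  proof -
    have "ac_on 0 T (\<lambda>t. ?p t + (- 1) * ?x t) (\<lambda>t. v1 t + (- 1) * u1 t)" "ac_on 0 T (\<lambda>t. ?q t + (- 1) * ?y t) (\<lambda>t. v2 t + (- 1) * u2 t)"
      by (intro ac_on_add ac_on_cmult pe pg)+
    from bnd[OF this(1) _ _ d(1) s] bnd[OF this(2) _ _ d(1) s] show "\<bar>?p s - ?x s\<bar> \<le> T * d" "\<bar>?q s - ?y s\<bar> \<le> T * d"
      using cl \<eta>(2) \<gamma>(2) by auto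
  qed
  let ?f = "\<lambda>s. v1 s *\<^sub>R X1 (\<eta> s) + v2 s *\<^sub>R X2 (\<eta> s)" and ?h = "\<lambda>s. u1 s *\<^sub>R X1 (\<gamma> s) + u2 s *\<^sub>R X2 (\<gamma> s)"
  \<comment> \<open>The first two coordinates contribute d each, the third 3 T d and the last two 7
    T^2 d each. This uses |x| <= T, |p| <= 2 T, |p - x| <= T d, the same for y and q, and competing
    controls of size at most 2.\<close>
  have vel: "norm (?f s - ?h s) \<le> (2 + 3 * T + 14 * T\<^sup>2) * d" if s: "s \<in> {0..T}" for s
  proof -
    have m: "\<bar>a * b\<bar> \<le> A * B" if "\<bar>a\<bar> \<le> A" "\<bar>b\<bar> \<le> B" for a b A B :: real
      unfolding abs_mult using that by (intro mult_mono) auto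
    have prd: "\<bar>a * v - a' * u\<bar> \<le> A * 2 + B * d" if "\<bar>a - a'\<bar> \<le> A" "\<bar>a'\<bar> \<le> B" "\<bar>v\<bar> \<le> 2" "\<bar>v - u\<bar> \<le> d" for a a' v u A B
    proof -
      have "a * v - a' * u = (a - a') * v + a' * (v - u)" by (simp add: algebra_simps)
      then show ?thesis using m[OF that(1,3)] m[OF that(2,4)] by linarith
    qed
    note c = cl[OF s]
    have z: "\<bar>(?p s * v2 s - ?q s * v1 s) / 2 - (?x s * u2 s - ?y s * u1 s) / 2\<bar> \<le> 3 * T * d"
    proof -
      have "\<bar>?p s * v2 s - ?x s * u2 s\<bar> \<le> T * d * 2 + T * d" "\<bar>?q s * v1 s - ?y s * u1 s\<bar> \<le> T * d * 2 + T * d"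
        using D[OF s] x[OF s] v2[OF s] c by (intro prd; blast)+
      then show ?thesis unfolding abs_le_iff diff_divide_distrib by linarith
    qed
    have sq: "\<bar>((?p s)\<^sup>2 + (?q s)\<^sup>2) - ((?x s)\<^sup>2 + (?y s)\<^sup>2)\<bar> \<le> 6 * T\<^sup>2 * d"
    proof -
      have "\<bar>(?p s - ?x s) * (?p s + ?x s)\<bar> \<le> (T * d) * (3 * T)" "\<bar>(?q s - ?y s) * (?q s + ?y s)\<bar> \<le> (T * d) * (3 * T)"
        using D[OF s] x[OF s] p[OF s] by (intro m; linarith)+
      moreover have "((?p s)\<^sup>2 + (?q s)\<^sup>2) - ((?x s)\<^sup>2 + (?y s)\<^sup>2) = (?p s - ?x s) * (?p s + ?x s) + (?q s - ?y s) * (?q s + ?y s)"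
        by algebra
      moreover have "(T * d) * (3 * T) + (T * d) * (3 * T) = 6 * T\<^sup>2 * d" by algebra
      ultimately show ?thesis by linarith
    qed
    have sx: "\<bar>(?x s)\<^sup>2 + (?y s)\<^sup>2\<bar> \<le> 2 * T\<^sup>2"
      using m[OF x(1)[OF s] x(1)[OF s]] m[OF x(2)[OF s] x(2)[OF s]] by (simp add: power2_eq_square)
    have vw: "\<bar>((?p s)\<^sup>2 + (?q s)\<^sup>2) * v - ((?x s)\<^sup>2 + (?y s)\<^sup>2) * u\<bar> \<le> 14 * T\<^sup>2 * d" if "\<bar>v\<bar> \<le> 2" "\<bar>v - u\<bar> \<le> d" for v u
      using prd[OF sq sx that] by (simp add: algebra_simps)
    have vv: "\<bar>((?p s)\<^sup>2 + (?q s)\<^sup>2) * v2 s / 2 - ((?x s)\<^sup>2 + (?y s)\<^sup>2) * u2 s / 2\<bar> \<le> 7 * T\<^sup>2 * d"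
      "\<bar>- (((?p s)\<^sup>2 + (?q s)\<^sup>2) * v1 s / 2) - - (((?x s)\<^sup>2 + (?y s)\<^sup>2) * u1 s / 2)\<bar> \<le> 7 * T\<^sup>2 * d"
      using vw[of "v2 s" "u2 s"] vw[of "v1 s" "u1 s"] v2[OF s] c unfolding abs_le_iff by linarith+
    have e: "w1 *\<^sub>R X1 \<xi> + w2 *\<^sub>R X2 \<xi> = (w1, w2, (fst \<xi> * w2 - fst (snd \<xi>) * w1) / 2, ((fst \<xi>)\<^sup>2 + (fst (snd \<xi>))\<^sup>2) * w2 / 2, - (((fst \<xi>)\<^sup>2 + (fst (snd \<xi>))\<^sup>2) * w1 / 2))" for w1 w2 \<xi>
      using sr_velocity[of w1 "fst \<xi>" "fst (snd \<xi>)" "fst (snd (snd \<xi>))" "fst (snd (snd (snd \<xi>)))" "snd (snd (snd (snd \<xi>)))" w2] by simp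
    have n5: "norm (a1, a2, a3, a4, a5) \<le> \<bar>a1\<bar> + (\<bar>a2\<bar> + (\<bar>a3\<bar> + (\<bar>a4\<bar> + \<bar>a5\<bar>)))" for a1 a2 a3 a4 a5 :: real
      by (intro order_trans[OF norm_Pair_le] add_mono) (simp_all)
    have "norm (?f s - ?h s) \<le> d + (d + (3 * T * d + (7 * T\<^sup>2 * d + 7 * T\<^sup>2 * d)))"
      unfolding e diff_Pair using c z vv by (intro order_trans[OF n5] add_mono) auto
    then show ?thesis by (simp add: algebra_simps)
  qed
  have "((\<lambda>s. ?f s - ?h s) has_integral (\<eta> t - \<gamma> t)) {0..t}"
    using has_integral_diff[of ?f "\<eta> t" "{0..t}" ?h "\<gamma> t"] \<eta> \<gamma> t by (auto simp: admissible_def)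
  moreover have B0: "0 \<le> (2 + 3 * T + 14 * T\<^sup>2) * d" using T d by simp
  ultimately have "norm (\<eta> t - \<gamma> t) \<le> ((2 + 3 * T + 14 * T\<^sup>2) * d) * measure lborel {0..t}"
    by (intro has_integral_bound_real[OF B0 finite.emptyI]) (use vel t in auto)
  also have "\<dots> \<le> ((2 + 3 * T + 14 * T\<^sup>2) * d) * T" using t T d by (intro mult_left_mono) auto
  finally show ?thesis by (simp add: dist_norm mult_ac)
qed

text \<open>The controls that witness local optimality are only known to produce the same curve.
  Both pairs of controls have the same planar primitives, so integration by parts against the smooth
  unit field (cos, sin) makes the difference of the controls integrate to 0. The integral of the
  component of (u1, u2) along the field is then T, and Cauchy-Schwarz bounds it by the
  length.\<close>

lemma sr_length_ge_time:
  assumes u: "admissible T g u1 u2" and g: "admissible T g (\<lambda>s. cos (\<theta>0 + c * s)) (\<lambda>s. sin (\<theta>0 + c * s))"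
    and z: "g 0 = 0" and T: "T \<ge> 0"
  shows "T \<le> sr_length T u1 u2"
proof -
  note pu = admissible_planar(1,2)[OF u T z] and pg = admissible_planar(1,2)[OF g T z]
  have F: "ac_on 0 T (\<lambda>s. cos (\<theta>0 + c * s)) (\<lambda>s. - (c * sin (\<theta>0 + c * s)))" "ac_on 0 T (\<lambda>s. sin (\<theta>0 + c * s)) (\<lambda>s. c * cos (\<theta>0 + c * s))"
    by (rule ac_on_C1_real; auto intro!: derivative_eq_intros continuous_intros)+
  have orth: "((\<lambda>t. f t * (h1 t - h2 t)) has_integral 0) {0..T}"
    if "ac_on 0 T f f'" "ac_on 0 T x h1" "ac_on 0 T x h2" for f f' x h1 h2 :: "real \<Rightarrow> real"
    using has_integral_diff[OF ac_on_has_integral[OF ac_on_mult[OF that(1,2)] order_refl T order_refl]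
        ac_on_has_integral[OF ac_on_mult[OF that(1,3)] order_refl T order_refl]]
    by (simp add: algebra_simps)
  have one: "((\<lambda>t::real. 1) has_integral T) {0..T}" using has_integral_const_real[of "1::real" 0 T] T by simp
  have "((\<lambda>t. cos (\<theta>0 + c * t) * (u1 t - cos (\<theta>0 + c * t)) + sin (\<theta>0 + c * t) * (u2 t - sin (\<theta>0 + c * t)) + 1) has_integral (0 + 0 + T)) {0..T}"
    by (intro has_integral_add orth[OF F(1) pu(1) pg(1)] orth[OF F(2) pu(2) pg(2)] one)
  moreover have "cos A * (a - cos A) + sin A * (b - sin A) + 1 = cos A * a + sin A * b" for A a b :: real
    using sin_cos_squared_add[of A] by algebra
  ultimately have "((\<lambda>t. cos (\<theta>0 + c * t) * u1 t + sin (\<theta>0 + c * t) * u2 t) has_integral T) {0..T}" by simp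
  moreover have "((\<lambda>t. sqrt ((u1 t)\<^sup>2 + (u2 t)\<^sup>2)) has_integral sr_length T u1 u2) {0..T}"
    unfolding sr_length_def using u by (intro integrable_integral speed_integrable) (auto simp: admissible_def)
  ultimately show ?thesis
  proof (rule has_integral_le)
    fix t
    let ?A = "\<theta>0 + c * t"
    have "(cos ?A, sin ?A) \<bullet> (u1 t, u2 t) \<le> norm (cos ?A, sin ?A) * norm (u1 t, u2 t)" by (rule norm_cauchy_schwarz)
    then show "cos ?A * u1 t + sin ?A * u2 t \<le> sqrt ((u1 t)\<^sup>2 + (u2 t)\<^sup>2)" by (simp add: inner_prod_def norm_prod_def)
  qed
qed

text \<open>Integrating the derivatives of r^3 cos s and r^3 sin s over the arc converts the
  conditions on r^3 into values of the planar moments. The last clause is the substitution s =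
  \<kappa> t - \<tau>, which is needed for the length as well.\<close>

lemma graph_moments:
  fixes r r' :: "real \<Rightarrow> real" and \<kappa> \<tau> T :: real
  assumes \<kappa>: "\<kappa> > 0" and \<tau>: "\<tau> > 0" and T: "T = 2 * \<tau> / \<kappa>"
    and dr: "\<And>s. s \<in> {-\<tau>..\<tau>} \<Longrightarrow> (r has_real_derivative r' s) (at s)" and cr': "continuous_on {-\<tau>..\<tau>} r'"
    and ends: "r \<tau> = 1" "r (- \<tau>) = 1"
    and area: "integral {-\<tau>..\<tau>} (\<lambda>s. (r s)\<^sup>2) = 2 * \<tau>"
    and mc: "integral {-\<tau>..\<tau>} (\<lambda>s. (r s)^3 * cos s) = 2 * sin \<tau>"
    and ms: "integral {-\<tau>..\<tau>} (\<lambda>s. (r s)^3 * sin s) = 0"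
  defines "X \<equiv> \<lambda>t. r (\<kappa> * t - \<tau>) * cos (\<kappa> * t - \<tau>)"
    and "X' \<equiv> \<lambda>t. \<kappa> * (r' (\<kappa> * t - \<tau>) * cos (\<kappa> * t - \<tau>) - r (\<kappa> * t - \<tau>) * sin (\<kappa> * t - \<tau>))"
    and "Y \<equiv> \<lambda>t. r (\<kappa> * t - \<tau>) * sin (\<kappa> * t - \<tau>)"
    and "Y' \<equiv> \<lambda>t. \<kappa> * (r' (\<kappa> * t - \<tau>) * sin (\<kappa> * t - \<tau>) + r (\<kappa> * t - \<tau>) * cos (\<kappa> * t - \<tau>))"
  shows "ac_on 0 T X X'" "ac_on 0 T Y Y'" "planar_moments T X X' Y Y' = (2 * \<tau>, 0, 2 * sin \<tau>)"
    and "\<And>f. continuous_on {-\<tau>..\<tau>} f \<Longrightarrow> ((\<lambda>t. \<kappa> * f (\<kappa> * t - \<tau>)) has_integral integral {-\<tau>..\<tau>} f) {0..T}"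
proof -
  have \<kappa>T: "\<kappa> * T = 2 * \<tau>" and T0: "T \<ge> 0" using \<kappa> \<tau> T by auto
  have rng: "\<kappa> * t - \<tau> \<in> {-\<tau>..\<tau>}" if "t \<in> {0..T}" for t
  proof -
    have "\<kappa> * t \<le> \<kappa> * T" "0 \<le> \<kappa> * t" using that \<kappa> by (auto intro: mult_left_mono)
    then show ?thesis using \<kappa>T by simp
  qed
  have cr: "continuous_on {-\<tau>..\<tau>} r"
    using dr by (meson DERIV_isCont continuous_at_imp_continuous_on)
  have shift: "continuous_on {0..T} (\<lambda>t. f (\<kappa> * t - \<tau>))" if "continuous_on {-\<tau>..\<tau>} f" for f :: "real \<Rightarrow> real"
    by (rule continuous_on_compose2[OF that]) (use rng in \<open>auto intro!: continuous_intros\<close>)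
  show sub: "((\<lambda>t. \<kappa> * f (\<kappa> * t - \<tau>)) has_integral integral {-\<tau>..\<tau>} f) {0..T}" if f: "continuous_on {-\<tau>..\<tau>} f" for f
  proof -
    have "((\<lambda>t. \<kappa> *\<^sub>R f (\<kappa> * t - \<tau>)) has_integral integral {\<kappa> * 0 - \<tau>..\<kappa> * T - \<tau>} f) {0..T}"
      by (rule has_integral_substitution[OF T0 _ _ f]) (use rng \<kappa>T \<tau> in \<open>auto intro!: derivative_eq_intros\<close>)
    then show ?thesis using \<kappa>T by simp
  qed
  have dX: "(X has_real_derivative X' t) (at t)" and dY: "(Y has_real_derivative Y' t) (at t)" if "t \<in> {0..T}" for t
  proof -
    have "((\<lambda>t. r (\<kappa> * t - \<tau>)) has_real_derivative r' (\<kappa> * t - \<tau>) * \<kappa>) (at t)"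
      by (rule DERIV_chain2[where f=r]) (auto intro!: derivative_eq_intros dr rng that)
    note d = this
    have dc: "((\<lambda>t. cos (\<kappa> * t - \<tau>)) has_real_derivative - (\<kappa> * sin (\<kappa> * t - \<tau>))) (at t)"
      and ds: "((\<lambda>t. sin (\<kappa> * t - \<tau>)) has_real_derivative \<kappa> * cos (\<kappa> * t - \<tau>)) (at t)"
      by (auto intro!: derivative_eq_intros)
    show "(X has_real_derivative X' t) (at t)"
      unfolding X_def X'_def by (rule DERIV_cong[OF DERIV_mult[OF d dc]]) (simp add: algebra_simps)
    show "(Y has_real_derivative Y' t) (at t)"
      unfolding Y_def Y'_def by (rule DERIV_cong[OF DERIV_mult[OF d ds]]) (simp add: algebra_simps)
  qed
  have cX': "continuous_on {0..T} X'" and cY': "continuous_on {0..T} Y'"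
    unfolding X'_def Y'_def by (intro continuous_intros shift[OF cr] shift[OF cr'])+
  have C1: "ac_on 0 T h h'" if "\<And>t. t \<in> {0..T} \<Longrightarrow> (h has_real_derivative h' t) (at t)" "continuous_on {0..T} h'" for h h'
    by (rule ac_on_C1[OF has_vector_derivative_at_within that(2)])
      (use that(1) in \<open>simp add: has_real_derivative_iff_has_vector_derivative\<close>)
  show "ac_on 0 T X X'" "ac_on 0 T Y Y'"
    by (rule C1[OF dX cX'], assumption) (rule C1[OF dY cY'])
  have sc: "(sin s)\<^sup>2 + (cos s)\<^sup>2 = 1" for s :: real by simp
  have m1: "integral {0..T} (\<lambda>t. X t * Y' t - Y t * X' t) = 2 * \<tau>"
  proof (rule integral_unique, rule has_integral_eq)
    show "((\<lambda>t. \<kappa> * (r (\<kappa> * t - \<tau>))\<^sup>2) has_integral 2 * \<tau>) {0..T}"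
      using sub[of "\<lambda>s. (r s)\<^sup>2"] cr unfolding area by (auto intro!: continuous_intros)
    show "\<kappa> * (r (\<kappa> * t - \<tau>))\<^sup>2 = X t * Y' t - Y t * X' t" for t
      unfolding X_def X'_def Y_def Y'_def using sc[of "\<kappa> * t - \<tau>"] by algebra
  qed
  have R: "(X t)\<^sup>2 + (Y t)\<^sup>2 = (r (\<kappa> * t - \<tau>))\<^sup>2" for t
    unfolding X_def Y_def using sc[of "\<kappa> * t - \<tau>"] by algebra
  have ftc: "(f' has_integral f \<tau> - f (- \<tau>)) {-\<tau>..\<tau>}" if "\<And>s. s \<in> {-\<tau>..\<tau>} \<Longrightarrow> (f has_real_derivative f' s) (at s)" for f f'
    using that \<tau> by (intro fundamental_theorem_of_calculus)
      (auto simp: has_real_derivative_iff_has_vector_derivative intro: has_vector_derivative_at_within)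
  have ic: "((\<lambda>s. (r s)^3 * cos s) has_integral 2 * sin \<tau>) {-\<tau>..\<tau>}" and is': "((\<lambda>s. (r s)^3 * sin s) has_integral 0) {-\<tau>..\<tau>}"
    unfolding mc[symmetric] ms[symmetric] by (intro integrable_integral integrable_continuous_real continuous_intros cr)+
  have "((\<lambda>s. 3 * (r s)\<^sup>2 * r' s * cos s - (r s)^3 * sin s) has_integral (r \<tau>)^3 * cos \<tau> - (r (- \<tau>))^3 * cos (- \<tau>)) {-\<tau>..\<tau>}"
    by (rule ftc) (auto intro!: derivative_eq_intros dr simp: algebra_simps)
  from has_integral_diff[OF has_integral_mult_right[OF this, of "1/3"] has_integral_mult_right[OF is', of "2/3"]]
  have jc: "integral {-\<tau>..\<tau>} (\<lambda>s. (r s)\<^sup>2 * (r' s * cos s - r s * sin s)) = 0"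
    by (intro integral_unique) (simp add: ends algebra_simps power2_eq_square power3_eq_cube)
  have "((\<lambda>s. 3 * (r s)\<^sup>2 * r' s * sin s + (r s)^3 * cos s) has_integral (r \<tau>)^3 * sin \<tau> - (r (- \<tau>))^3 * sin (- \<tau>)) {-\<tau>..\<tau>}"
    by (rule ftc) (auto intro!: derivative_eq_intros dr simp: algebra_simps)
  from has_integral_add[OF has_integral_mult_right[OF this, of "1/3"] has_integral_mult_right[OF ic, of "2/3"]]
  have js: "integral {-\<tau>..\<tau>} (\<lambda>s. (r s)\<^sup>2 * (r' s * sin s + r s * cos s)) = 2 * sin \<tau>"
    by (intro integral_unique) (simp add: ends algebra_simps power2_eq_square power3_eq_cube)
  have m2: "integral {0..T} (\<lambda>t. ((X t)\<^sup>2 + (Y t)\<^sup>2) * X' t) = 0"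
    unfolding R X'_def
    using sub[of "\<lambda>s. (r s)\<^sup>2 * (r' s * cos s - r s * sin s)"] cr cr' unfolding jc
    by (intro integral_unique) (simp add: continuous_intros mult.left_commute)
  have m3: "integral {0..T} (\<lambda>t. ((X t)\<^sup>2 + (Y t)\<^sup>2) * Y' t) = 2 * sin \<tau>"
    unfolding R Y'_def
    using sub[of "\<lambda>s. (r s)\<^sup>2 * (r' s * sin s + r s * cos s)"] cr cr' unfolding js
    by (intro integral_unique) (simp add: continuous_intros mult.left_commute)
  show "planar_moments T X X' Y Y' = (2 * \<tau>, 0, 2 * sin \<tau>)"
    unfolding planar_moments_def m1 m2 m3 ..
qed

lemma arc_not_locally_optimal:
  fixes c \<theta>0 \<tau> T :: real
  assumes c: "c \<noteq> 0" and adm: "admissible T g (\<lambda>s. cos (\<theta>0 + c * s)) (\<lambda>s. sin (\<theta>0 + c * s))" and z: "g 0 = 0"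
    and \<tau>: "5 * pi / 4 \<le> \<tau>" "\<tau> < 3 * pi / 2" and pos: "conj_fun \<tau> > 0" and T: "T = 2 * \<tau> / \<bar>c\<bar>"
  shows "\<not> locally_optimal T g"
proof
  assume "locally_optimal T g"
  then obtain u1 u2 \<epsilon> where u: "admissible T g u1 u2" and \<epsilon>: "\<epsilon> > 0"
    and opt: "\<And>\<eta> v1 v2. admissible T \<eta> v1 v2 \<Longrightarrow> \<eta> 0 = g 0 \<Longrightarrow> \<eta> T = g T \<Longrightarrow>
        (\<forall>s\<in>{0..T}. dist (\<eta> s) (g s) < \<epsilon>) \<Longrightarrow> sr_length T u1 u2 \<le> sr_length T v1 v2"
    unfolding locally_optimal_def by metis
  define \<kappa> where "\<kappa> = \<bar>c\<bar>"
  have \<kappa>: "\<kappa> > 0" "T = 2 * \<tau> / \<kappa>" using c T by (auto simp: \<kappa>_def)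
  have \<tau>0: "\<tau> > 0" using \<tau> pi_gt3 by linarith
  have T0: "T > 0" "T \<ge> 0" and \<kappa>T: "\<kappa> * T = 2 * \<tau>" using \<kappa> \<tau>0 by auto
  define K where "K = T * (2 + 3 * T + 14 * T\<^sup>2)"
  have K: "K > 0" using T0 by (simp add: K_def add_pos_pos)
  define d where "d = min 1 (\<epsilon> / (2 * K))"
  have d: "d > 0" "d \<le> 1" "K * d < \<epsilon>"
  proof -
    show "d > 0" "d \<le> 1" using \<epsilon> K by (auto simp: d_def)
    have "d \<le> \<epsilon> / (2 * K)" by (simp add: d_def)
    then have "d * (2 * K) \<le> \<epsilon>" using K by (simp add: pos_le_divide_eq)
    moreover have "K * d = d * (2 * K) / 2" by simp
    ultimately show "K * d < \<epsilon>" using \<epsilon> by linarith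
  qed
  \<comment> \<open>Each planar velocity will be off by four terms of size at most d / 4, after the
    factors \<kappa> and 1 / \<kappa> of the two similarities have cancelled.\<close>
  obtain r r' where dr0: "\<forall>s\<in>{-\<tau>..\<tau>}. (r has_real_derivative r' s) (at s) \<and> r s > 0 \<and> \<bar>r s - 1\<bar> < d / 4 \<and> \<bar>r' s\<bar> < d / 4"
    and cr': "continuous_on {-\<tau>..\<tau>} r'" and ends: "r \<tau> = 1" "r (- \<tau>) = 1"
    and area: "integral {-\<tau>..\<tau>} (\<lambda>s. (r s)\<^sup>2) = 2 * \<tau>"
    and mc: "integral {-\<tau>..\<tau>} (\<lambda>s. (r s)^3 * cos s) = 2 * sin \<tau>"
    and ms: "integral {-\<tau>..\<tau>} (\<lambda>s. (r s)^3 * sin s) = 0"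
    and len: "integral {-\<tau>..\<tau>} (\<lambda>s. sqrt ((r' s)\<^sup>2 + (r s)\<^sup>2)) < 2 * \<tau>"
    using shorter_arc[OF \<tau> pos, of "d / 4"] d by auto
  have dr: "(r has_real_derivative r' s) (at s)" if "s \<in> {-\<tau>..\<tau>}" for s using dr0 that by blast
  note gm = graph_moments[OF \<kappa>(1) \<tau>0 \<kappa>(2) dr cr' ends area mc ms]
  define X where "X t = r (\<kappa> * t - \<tau>) * cos (\<kappa> * t - \<tau>)" for t
  define X' where "X' t = \<kappa> * (r' (\<kappa> * t - \<tau>) * cos (\<kappa> * t - \<tau>) - r (\<kappa> * t - \<tau>) * sin (\<kappa> * t - \<tau>))" for t
  define Y where "Y t = r (\<kappa> * t - \<tau>) * sin (\<kappa> * t - \<tau>)" for t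
  define Y' where "Y' t = \<kappa> * (r' (\<kappa> * t - \<tau>) * sin (\<kappa> * t - \<tau>) + r (\<kappa> * t - \<tau>) * cos (\<kappa> * t - \<tau>))" for t
  have acX: "ac_on 0 T X X'" unfolding X_def[abs_def] X'_def[abs_def] by (rule gm(1))
  have acY: "ac_on 0 T Y Y'" unfolding Y_def[abs_def] Y'_def[abs_def] by (rule gm(2))
  have mom: "planar_moments T X X' Y Y' = (2 * \<tau>, 0, 2 * sin \<tau>)"
    unfolding X_def[abs_def] X'_def[abs_def] Y_def[abs_def] Y'_def[abs_def] by (rule gm(3))
  have \<sigma>: "(sgn c)\<^sup>2 = 1" using c by (simp add: sgn_if)
  obtain a b where ab: "\<bar>a\<bar> \<le> \<kappa>" "\<bar>b\<bar> \<le> \<kappa>" "a\<^sup>2 + b\<^sup>2 = \<kappa>\<^sup>2"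
    and sim: "\<And>t. t \<in> {0..T} \<Longrightarrow> a * fst (g t) + b * fst (snd (g t)) + cos \<tau> = cos (\<kappa> * t - \<tau>) \<and>
      sgn c * (a * fst (snd (g t)) - b * fst (g t)) + - sin \<tau> = sin (\<kappa> * t - \<tau>) \<and>
      a * cos (\<theta>0 + c * t) + b * sin (\<theta>0 + c * t) = - (\<kappa> * sin (\<kappa> * t - \<tau>)) \<and>
      sgn c * (a * sin (\<theta>0 + c * t) - b * cos (\<theta>0 + c * t)) = \<kappa> * cos (\<kappa> * t - \<tau>)"
    using normalizing_similarity[OF c adm z \<kappa>_def, of \<tau>] by blast
  \<comment> \<open>The inverse of the normalizing similarity, in the same form and with the same
    sign: for a rotation the conjugate coefficients divided by \<kappa>^2, for a reflection the
    coefficients themselves divided by \<kappa>^2.\<close>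
  define a1 b1 where "a1 = a / \<kappa>\<^sup>2" and "b1 = - (sgn c * b / \<kappa>\<^sup>2)"
  have ab1: "\<bar>a1\<bar> \<le> 1 / \<kappa>" "\<bar>b1\<bar> \<le> 1 / \<kappa>" "a1\<^sup>2 + b1\<^sup>2 = 1 / \<kappa>\<^sup>2"
  proof -
    have "\<bar>a\<bar> / \<kappa>\<^sup>2 \<le> \<kappa> / \<kappa>\<^sup>2" "\<bar>b\<bar> / \<kappa>\<^sup>2 \<le> \<kappa> / \<kappa>\<^sup>2" using ab by (intro divide_right_mono; simp)+
    moreover have "\<kappa> / \<kappa>\<^sup>2 = 1 / \<kappa>" using \<kappa> by (simp add: power2_eq_square)
    moreover have "\<bar>sgn c\<bar> = 1" using c by (simp add: abs_sgn_eq)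
    ultimately show "\<bar>a1\<bar> \<le> 1 / \<kappa>" "\<bar>b1\<bar> \<le> 1 / \<kappa>" by (simp_all add: a1_def b1_def abs_mult)
    have "a1\<^sup>2 + b1\<^sup>2 = (a\<^sup>2 + (sgn c)\<^sup>2 * b\<^sup>2) / (\<kappa>\<^sup>2)\<^sup>2" by (simp add: a1_def b1_def power_divide power_mult_distrib add_divide_distrib)
    then show "a1\<^sup>2 + b1\<^sup>2 = 1 / \<kappa>\<^sup>2" unfolding \<sigma> using ab(3) \<kappa> by (simp add: power2_eq_square)
  qed
  have inv: "a1 * (a * x + b * y) + b1 * (sgn c * (a * y - b * x)) = x"
    "sgn c * (a1 * (sgn c * (a * y - b * x)) - b1 * (a * x + b * y)) = y" for x y
  proof -
    have "a1 * (a * x + b * y) + b1 * (sgn c * (a * y - b * x)) = (a * (a * x + b * y) - (sgn c)\<^sup>2 * b * (a * y - b * x)) / \<kappa>\<^sup>2"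
      using \<kappa> by (simp add: a1_def b1_def field_simps power2_eq_square)
    also have "\<dots> = (a\<^sup>2 + b\<^sup>2) * x / \<kappa>\<^sup>2" unfolding \<sigma> by (simp add: algebra_simps power2_eq_square)
    finally show "a1 * (a * x + b * y) + b1 * (sgn c * (a * y - b * x)) = x" using \<kappa> by (simp add: ab)
    have "sgn c * (a1 * (sgn c * (a * y - b * x)) - b1 * (a * x + b * y)) = (sgn c)\<^sup>2 * (a * (a * y - b * x) + b * (a * x + b * y)) / \<kappa>\<^sup>2"
      using \<kappa> by (simp add: a1_def b1_def field_simps power2_eq_square)
    also have "\<dots> = (a\<^sup>2 + b\<^sup>2) * y / \<kappa>\<^sup>2" unfolding \<sigma> by (simp add: algebra_simps power2_eq_square)
    finally show "sgn c * (a1 * (sgn c * (a * y - b * x)) - b1 * (a * x + b * y)) = y" using \<kappa> by (simp add: ab)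
  qed
  define e f where "e = - (a1 * cos \<tau> + b1 * (- sin \<tau>))" and "f = - (sgn c * (a1 * (- sin \<tau>) - b1 * cos \<tau>))"
  let ?u1 = "\<lambda>s. cos (\<theta>0 + c * s)" and ?u2 = "\<lambda>s. sin (\<theta>0 + c * s)"
  let ?x = "\<lambda>t. fst (g t)" and ?y = "\<lambda>t. fst (snd (g t))"
  let ?C = "\<lambda>t. cos (\<kappa> * t - \<tau>)" and ?S = "\<lambda>t. sin (\<kappa> * t - \<tau>)"
  let ?C' = "\<lambda>t. - (\<kappa> * sin (\<kappa> * t - \<tau>))" and ?S' = "\<lambda>t. \<kappa> * cos (\<kappa> * t - \<tau>)"
  have circ0: "a * ?x t + b * ?y t + cos \<tau> = ?C t" "sgn c * (a * ?y t - b * ?x t) + - sin \<tau> = ?S t"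
    "a * ?u1 t + b * ?u2 t = ?C' t" "sgn c * (a * ?u2 t - b * ?u1 t) = ?S' t"
    if "t \<in> {0..T}" for t
    using sim[OF that] by blast+
  have circ: "a1 * ?C t + b1 * ?S t + e = ?x t" "sgn c * (a1 * ?S t - b1 * ?C t) + f = ?y t"
    "a1 * ?C' t + b1 * ?S' t = ?u1 t" "sgn c * (a1 * ?S' t - b1 * ?C' t) = ?u2 t" if t: "t \<in> {0..T}" for t
  proof -
    have P: "a * ?x t + b * ?y t = ?C t - cos \<tau>" and Q: "sgn c * (a * ?y t - b * ?x t) = ?S t + sin \<tau>"
      using circ0(1,2)[OF t] by linarith+
    show "a1 * ?C t + b1 * ?S t + e = ?x t" "sgn c * (a1 * ?S t - b1 * ?C t) + f = ?y t"
      using inv[where x="?x t" and y="?y t"] unfolding P Q by (simp_all add: e_def f_def algebra_simps)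
    show "a1 * ?C' t + b1 * ?S' t = ?u1 t" "sgn c * (a1 * ?S' t - b1 * ?C' t) = ?u2 t"
      using inv[where x="?u1 t" and y="?u2 t"] unfolding circ0(3,4)[OF t] .
  qed
  define x where "x t = a1 * X t + b1 * Y t + e" for t
  define y where "y t = sgn c * (a1 * Y t - b1 * X t) + f" for t
  define x' where "x' t = a1 * X' t + b1 * Y' t" for t
  define y' where "y' t = sgn c * (a1 * Y' t - b1 * X' t)" for t
  have acx: "ac_on 0 T x x'"
    by (rule ac_on_cong[OF ac_on_add[OF ac_on_add[OF ac_on_cmult[OF acX, of a1] ac_on_cmult[OF acY, of b1]] ac_on_const[of 0 T e]]])
      (simp_all add: x_def x'_def)
  have acy: "ac_on 0 T y y'"
    by (rule ac_on_cong[OF ac_on_add[OF ac_on_cmult[OF ac_on_add[OF ac_on_cmult[OF acY, of a1] ac_on_cmult[OF acX, of "- b1"]], of "sgn c"] ac_on_const[of 0 T f]]])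
      (simp_all add: y_def y'_def)
  have acC: "ac_on 0 T ?C ?C'" and acS: "ac_on 0 T ?S ?S'"
    by (rule ac_on_C1_real; auto intro!: derivative_eq_intros continuous_intros)+
  have zT: "0 \<in> {0..T}" "T \<in> {0..T}" using T0 by auto
  have E: "X 0 = ?C 0" "Y 0 = ?S 0" "X T = ?C T" "Y T = ?S T" using ends \<kappa>T by (simp_all add: X_def Y_def)
  have xy0: "x 0 = 0" "y 0 = 0" using circ(1,2)[OF zT(1)] by (simp_all add: x_def y_def E z)
  have xyT: "x T = ?x T" "y T = ?y T" using circ(1,2)[OF zT(2)] unfolding x_def y_def E(3,4) by simp_all
  have mom0: "planar_moments T X X' Y Y' = planar_moments T ?C ?C' ?S ?S'"
    unfolding mom circle_moments[OF \<kappa>(1) \<tau>0 \<kappa>(2)] ..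
  have "planar_moments T x x' y y' = planar_moments T (\<lambda>t. a1 * ?C t + b1 * ?S t + e) (\<lambda>t. a1 * ?C' t + b1 * ?S' t)
      (\<lambda>t. sgn c * (a1 * ?S t - b1 * ?C t) + f) (\<lambda>t. sgn c * (a1 * ?S' t - b1 * ?C' t))"
    unfolding x_def[abs_def] x'_def[abs_def] y_def[abs_def] y'_def[abs_def]
    by (rule similar_moments_eq[OF T0(2) acX acY acC acS \<sigma> E mom0])
  also have "\<dots> = planar_moments T ?x ?u1 ?y ?u2"
    by (rule planar_moments_cong) (rule circ, assumption)+
  finally have momxy: "planar_moments T x x' y y' = planar_moments T ?x ?u1 ?y ?u2" .
  obtain \<eta> where \<eta>: "admissible T \<eta> x' y'" "\<eta> 0 = 0" and \<eta>xy: "\<And>t. fst (\<eta> t) = x t" "\<And>t. fst (snd (\<eta> t)) = y t"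
    using planar_admissible[OF acx acy T0(2) xy0] by blast
  have \<eta>T: "\<eta> T = g T"
  proof -
    obtain A W V A2 W2 V2 where m: "planar_moments T (\<lambda>t. fst (\<eta> t)) x' (\<lambda>t. fst (snd (\<eta> t))) y' = (A, W, V)"
        "planar_moments T ?x ?u1 ?y ?u2 = (A2, W2, V2)"
      and e: "\<eta> T = (fst (\<eta> T), fst (snd (\<eta> T)), A / 2, V / 2, - (W / 2))" "g T = (?x T, ?y T, A2 / 2, V2 / 2, - (W2 / 2))"
      using admissible_planar(3)[OF \<eta>(1) T0(2) \<eta>(2)] admissible_planar(3)[OF adm T0(2) z] by blast
    have "(A, W, V) = (A2, W2, V2)" using m momxy by (simp add: \<eta>xy)
    then have eq: "(fst (\<eta> T), fst (snd (\<eta> T)), A / 2, V / 2, - (W / 2)) = (?x T, ?y T, A2 / 2, V2 / 2, - (W2 / 2))"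
      by (simp add: \<eta>xy xyT)
    show ?thesis by (rule trans[OF trans[OF e(1) eq] e(2)[symmetric]])
  qed
  have near: "\<bar>x' t - ?u1 t\<bar> \<le> d \<and> \<bar>y' t - ?u2 t\<bar> \<le> d \<and> \<bar>?u1 t\<bar> \<le> 1 \<and> \<bar>?u2 t\<bar> \<le> 1" if t: "t \<in> {0..T}" for t
  proof -
    define s where "s = \<kappa> * t - \<tau>"
    have "\<kappa> * t \<le> \<kappa> * T" "0 \<le> \<kappa> * t" using t \<kappa>(1) by (auto intro: mult_left_mono)
    then have "s \<in> {-\<tau>..\<tau>}" using \<kappa>T by (simp add: s_def)
    then have rs: "\<bar>r s - 1\<bar> \<le> d / 4" "\<bar>r' s\<bar> \<le> d / 4" using dr0 by (auto intro: less_imp_le)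
    have m: "\<bar>p * q\<bar> \<le> A * B" if "\<bar>p\<bar> \<le> A" "\<bar>q\<bar> \<le> B" for p q A B :: real
      unfolding abs_mult using that by (intro mult_mono) auto
    have t4: "\<bar>r' s * cos s\<bar> \<le> d/4 * 1" "\<bar>r' s * sin s\<bar> \<le> d/4 * 1" "\<bar>(r s - 1) * cos s\<bar> \<le> d/4 * 1" "\<bar>(r s - 1) * sin s\<bar> \<le> d/4 * 1"
      by (intro m rs; simp)+
    have "\<bar>r' s * cos s - (r s - 1) * sin s\<bar> \<le> d / 2" "\<bar>r' s * sin s + (r s - 1) * cos s\<bar> \<le> d / 2"
      using t4 unfolding abs_le_iff by linarith+
    then have D: "\<bar>\<kappa> * (r' s * cos s - (r s - 1) * sin s)\<bar> \<le> \<kappa> * (d / 2)" "\<bar>\<kappa> * (r' s * sin s + (r s - 1) * cos s)\<bar> \<le> \<kappa> * (d / 2)"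
      using \<kappa> by (intro m; simp)+
    have XD: "X' t - ?C' t = \<kappa> * (r' s * cos s - (r s - 1) * sin s)" and YD: "Y' t - ?S' t = \<kappa> * (r' s * sin s + (r s - 1) * cos s)"
      by (simp_all add: X'_def Y'_def s_def algebra_simps)
    have h: "1 / \<kappa> * (\<kappa> * (d / 2)) = d / 2" using \<kappa> by simp
    have q: "\<bar>a1 * (X' t - ?C' t)\<bar> \<le> d / 2" "\<bar>b1 * (Y' t - ?S' t)\<bar> \<le> d / 2" "\<bar>a1 * (Y' t - ?S' t)\<bar> \<le> d / 2" "\<bar>b1 * (X' t - ?C' t)\<bar> \<le> d / 2"
      using m[OF ab1(1) D(1)] m[OF ab1(2) D(2)] m[OF ab1(1) D(2)] m[OF ab1(2) D(1)] unfolding h XD YD by auto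
    have "x' t - ?u1 t = a1 * (X' t - ?C' t) + b1 * (Y' t - ?S' t)"
      unfolding x'_def circ(3)[OF t, symmetric] by (simp add: algebra_simps)
    then have A: "\<bar>x' t - ?u1 t\<bar> \<le> d" using q unfolding abs_le_iff by linarith
    have "y' t - ?u2 t = sgn c * (a1 * (Y' t - ?S' t) - b1 * (X' t - ?C' t))"
      unfolding y'_def circ(4)[OF t, symmetric] by (simp add: algebra_simps)
    then have "\<bar>y' t - ?u2 t\<bar> = \<bar>a1 * (Y' t - ?S' t) - b1 * (X' t - ?C' t)\<bar>" using c by (simp add: abs_mult abs_sgn_eq)
    also have "\<dots> \<le> d" using q unfolding abs_le_iff by linarith
    finally show ?thesis using A by simp
  qed
  have "sr_length T u1 u2 \<le> sr_length T x' y'"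
  proof (rule opt[OF \<eta>(1)])
    show "\<eta> 0 = g 0" "\<eta> T = g T" using \<eta> z \<eta>T by auto
    show "\<forall>s\<in>{0..T}. dist (\<eta> s) (g s) < \<epsilon>"
    proof
      fix s assume s: "s \<in> {0..T}"
      have "dist (\<eta> s) (g s) \<le> K * d"
        unfolding K_def by (rule close_controls[OF \<eta> adm z T0(1) less_imp_le[OF d(1)] d(2) near s])
      then show "dist (\<eta> s) (g s) < \<epsilon>" using d(3) by simp
    qed
  qed
  moreover have "T \<le> sr_length T u1 u2" by (rule sr_length_ge_time[OF u adm z T0(2)])
  moreover have "\<kappa> * sr_length T x' y' < \<kappa> * T"
  proof -
    have cr: "continuous_on {-\<tau>..\<tau>} r" using dr by (meson DERIV_isCont continuous_at_imp_continuous_on)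
    have "continuous_on {-\<tau>..\<tau>} (\<lambda>s. sqrt ((r' s)\<^sup>2 + (r s)\<^sup>2))" by (intro continuous_intros cr cr')
    then have "((\<lambda>t. \<kappa> * sqrt ((r' (\<kappa> * t - \<tau>))\<^sup>2 + (r (\<kappa> * t - \<tau>))\<^sup>2)) has_integral
        integral {-\<tau>..\<tau>} (\<lambda>s. sqrt ((r' s)\<^sup>2 + (r s)\<^sup>2))) {0..T}"
      by (rule gm(4)[rotated])
    moreover have "sqrt ((x' t)\<^sup>2 + (y' t)\<^sup>2) = sqrt ((r' (\<kappa> * t - \<tau>))\<^sup>2 + (r (\<kappa> * t - \<tau>))\<^sup>2)" for t
    proof -
      have "(x' t)\<^sup>2 + (y' t)\<^sup>2 = (a1\<^sup>2 + b1\<^sup>2) * ((X' t)\<^sup>2 + (Y' t)\<^sup>2)"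
        unfolding x'_def y'_def using \<sigma> by algebra
      also have "(X' t)\<^sup>2 + (Y' t)\<^sup>2 = \<kappa>\<^sup>2 * ((r' (\<kappa> * t - \<tau>))\<^sup>2 + (r (\<kappa> * t - \<tau>))\<^sup>2)"
        unfolding X'_def Y'_def using sin_cos_squared_add[of "\<kappa> * t - \<tau>"] by algebra
      finally show ?thesis using \<kappa> by (simp add: ab1)
    qed
    ultimately have "((\<lambda>t. \<kappa> * sqrt ((x' t)\<^sup>2 + (y' t)\<^sup>2)) has_integral
        integral {-\<tau>..\<tau>} (\<lambda>s. sqrt ((r' s)\<^sup>2 + (r s)\<^sup>2))) {0..T}" by simp
    from integral_unique[OF this] have "\<kappa> * sr_length T x' y' = integral {-\<tau>..\<tau>} (\<lambda>s. sqrt ((r' s)\<^sup>2 + (r s)\<^sup>2))"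
      by (simp add: sr_length_def)
    then show ?thesis using len \<kappa>T by simp
  qed
  ultimately show False using \<kappa>(1) by simp
qed

section \<open>The supremum of the locally optimal times\<close>

theorem theorem6p3:
  fixes \<theta>0 c \<alpha> \<beta> :: real and th cc :: "real \<Rightarrow> real" and g :: "real \<Rightarrow> cartan"
  assumes "\<alpha> = 0" and "c \<noteq> 0"
    and "is_Exp \<theta>0 c \<alpha> \<beta> th cc g"
  shows "t1_conj g = 4 / \<bar>c\<bar> * p1V0"
proof -
  have c: "c \<noteq> 0" by fact
  have z: "g 0 = 0" and init: "th 0 = \<theta>0" "cc 0 = c" and dth: "\<And>t. (th has_real_derivative cc t) (at t)"
    and dcc: "\<And>t. (cc has_real_derivative 0) (at t)"
    and dg: "\<And>t. (g has_vector_derivative (cos (th t) *\<^sub>R X1 (g t) + sin (th t) *\<^sub>R X2 (g t))) (at t)"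
    using assms by (auto simp: is_Exp_def)
  have cc: "cc t = c" for t using DERIV_isconst_all[of cc t 0] dcc init by simp
  have th: "th t = \<theta>0 + c * t" for t
  proof -
    have "((\<lambda>t. th t - c * t) has_real_derivative 0) (at t)" for t
      using dth[of t] by (auto intro!: derivative_eq_intros simp: cc)
    then have "th t - c * t = th 0 - c * 0" by (intro DERIV_isconst_all) blast
    then show ?thesis using init by simp
  qed
  have adm: "admissible T g (\<lambda>s. cos (\<theta>0 + c * s)) (\<lambda>s. sin (\<theta>0 + c * s))" for T
    unfolding admissible_def
  proof (intro conjI ballI)
    have cont: "continuous_on {0..T} (\<lambda>s. cos (\<theta>0 + c * s))" "continuous_on {0..T} (\<lambda>s. sin (\<theta>0 + c * s))"
      by (intro continuous_intros)+
    then show "(\<lambda>s. cos (\<theta>0 + c * s)) \<in> borel_measurable (lebesgue_on {0..T})" "(\<lambda>s. sin (\<theta>0 + c * s)) \<in> borel_measurable (lebesgue_on {0..T})"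
      by (simp_all add: continuous_imp_measurable_on_sets_lebesgue)
    show "bounded ((\<lambda>s. cos (\<theta>0 + c * s)) ` {0..T})" "bounded ((\<lambda>s. sin (\<theta>0 + c * s)) ` {0..T})"
      unfolding bounded_iff by (auto intro!: exI[of _ 1])
    show "((\<lambda>s. cos (\<theta>0 + c * s) *\<^sub>R X1 (g s) + sin (\<theta>0 + c * s) *\<^sub>R X2 (g s)) has_integral (g t - g 0)) {0..t}" if "t \<in> {0..T}" for t
      using that dg unfolding th by (intro fundamental_theorem_of_calculus) (auto intro: has_vector_derivative_at_within)
  qed
  note ca = first_conjugate_angle
  define L where "L = 4 / \<bar>c\<bar> * p1V0"
  have cL: "\<bar>c\<bar> * L = 4 * p1V0" using c by (simp add: L_def)
  have opt: "locally_optimal (2 * \<tau> / \<bar>c\<bar>) g" if "5 * pi / 4 \<le> \<tau>" "\<tau> < 2 * p1V0" for \<tau>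
    using that ca(2) ca(3)[of \<tau>] pi_gt_zero by (intro arc_locally_optimal[OF c adm z]) auto
  have upper: "t \<le> L" if t: "t > 0" "locally_optimal t g" for t
  proof (rule ccontr)
    assume "\<not> t \<le> L"
    then have "\<bar>c\<bar> * L < \<bar>c\<bar> * t" using c by simp
    then have "2 * p1V0 < min (\<bar>c\<bar> * t / 2) (3 * pi / 2)" using cL ca(2) by simp
    \<comment> \<open>A half-angle just beyond the conjugate one, below 3 pi / 2 where the sign of
      \<open>conj_fun\<close> is known, and reached before time t, so that optimality at t would be
      inherited.\<close>
    then obtain \<tau> where "2 * p1V0 < \<tau>" "\<tau> < min (\<bar>c\<bar> * t / 2) (3 * pi / 2)" using dense by blast
    then have \<tau>: "2 * p1V0 < \<tau>" "\<tau> < \<bar>c\<bar> * t / 2" "\<tau> < 3 * pi / 2" by linarith+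
    have \<tau>0: "\<tau> > 0" "5 * pi / 4 \<le> \<tau>" using \<tau>(1) ca(1) pi_gt_zero by linarith+
    have "2 * \<tau> / \<bar>c\<bar> \<le> t" using \<tau>(2) c by (simp add: field_simps)
    then have "locally_optimal (2 * \<tau> / \<bar>c\<bar>) g"
      using \<tau>0 c by (intro locally_optimal_shorter[OF t(2)]) auto
    moreover have "\<not> locally_optimal (2 * \<tau> / \<bar>c\<bar>) g"
      by (rule arc_not_locally_optimal[OF c adm z \<tau>0(2) \<tau>(3) ca(4)[OF \<tau>(1,3)] refl])
    ultimately show False by simp
  qed
  have "Sup {t. t > 0 \<and> locally_optimal t g} = L"
  proof (rule cSup_eq)
    show "t \<le> L" if "t \<in> {t. t > 0 \<and> locally_optimal t g}" for t using that upper by simp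
    fix u assume u: "\<And>t. t \<in> {t. t > 0 \<and> locally_optimal t g} \<Longrightarrow> t \<le> u"
    show "L \<le> u"
    proof (rule ccontr)
      assume "\<not> L \<le> u"
      then have "\<bar>c\<bar> * u < \<bar>c\<bar> * L" using c by simp
      then have "max (5 * pi / 4) (\<bar>c\<bar> * u / 2) < 2 * p1V0" using ca(1) cL by simp
      \<comment> \<open>An optimal time between u and L contradicts the bound u; the maximum with 5
        pi / 4 keeps \<tau> in the range where the arc is calibrated.\<close>
      then obtain \<tau> where "max (5 * pi / 4) (\<bar>c\<bar> * u / 2) < \<tau>" "\<tau> < 2 * p1V0" using dense by blast
      then have \<tau>: "5 * pi / 4 < \<tau>" "\<bar>c\<bar> * u / 2 < \<tau>" "\<tau> < 2 * p1V0" by linarith+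
      have "\<tau> > 0" using \<tau>(1) pi_gt_zero by linarith
      then have "2 * \<tau> / \<bar>c\<bar> > 0" using c by simp
      moreover have "locally_optimal (2 * \<tau> / \<bar>c\<bar>) g" using \<tau> by (intro opt) auto
      ultimately have "2 * \<tau> / \<bar>c\<bar> \<le> u" using u by blast
      then show False using \<tau>(2) c by (simp add: field_simps)
    qed
  qed
  then show ?thesis by (simp add: t1_conj_def L_def)
qed

end
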